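(* \textsc{min-max} RFTT (on general weighted graphs) admits a polynomial-time $O(\log n)$-approximation algorithm, where $n$ is the number of clients.
   Context: RFTT: an instance is $(G,\tau)$ with $G=(V\cup\{s\},E,c)$ a connected graph with depot $s$, nonnegative edge weights $c$, clients $V=\{v_1,\dots,v_n\}$ and turnover times $\tau\in\mathbb{N}^n$. A solution gives for each day $k\ge1$ a closed walk $T_k$ in $G$ from $s$ to $s$ and a set $J_k\subseteq V$ of clients on $T_k$ visited that day; it is feasible if for all $t\ge0$ and all $j$, $v_j\in\bigcup_{k=t+1}^{t+\tau_j}J_k$; solutions are periodic. \textsc{min-max} minimizes $\max_k c(T_k)$, where $c(T_k)$ is the total edge weight of $T_k$ with multiplicity. *)

theory Defs
  imports
    Complex_Main
    "HOL-Library.Landau_Symbols"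
    "HOL-Library.Log_Nat"
    "HOL-Computational_Algebra.Polynomial"
    "Graph_Theory.Graph_Theory"
begin

section \<open>Replenishment with fixed turnover times\<close>

text \<open>
  The depot is vertex \<open>0\<close> and client \<open>v\<^sub>j\<close> is vertex \<open>j\<close>, for \<open>1 \<le> j \<le> n\<close>.
  An undirected edge is a pair of opposite arcs of a symmetric loop-free digraph.
  Weights are rational, because an instance has to be the finite input of an algorithm.
\<close>

record rftt =
  clients :: nat
  graph :: "nat pair_pre_digraph"
  weight :: "nat \<times> nat \<Rightarrow> rat"
  turnover :: "nat \<Rightarrow> nat"

definition rftt_instance :: "rftt \<Rightarrow> bool" where
  "rftt_instance I \<longleftrightarrow>
     pair_graph (graph I) \<and>
     pverts (graph I) = {0..clients I} \<and>
     Digraph_Component.connected (with_proj (graph I)) \<and>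
     (\<forall>(u, v) \<in> parcs (graph I). 0 \<le> weight I (u, v) \<and> weight I (u, v) = weight I (v, u)) \<and>
     (\<forall>j \<in> {1..clients I}. 1 \<le> turnover I j)"

text \<open>Days are numbered from 1; the values at day 0 are irrelevant.\<close>

record plan =
  tour :: "nat \<Rightarrow> (nat \<times> nat) awalk"
  visited :: "nat \<Rightarrow> nat set"

definition solution :: "rftt \<Rightarrow> plan \<Rightarrow> bool" where
  "solution I S \<longleftrightarrow>
     (\<forall>k\<ge>1. pre_digraph.awalk (with_proj (graph I)) 0 (tour S k) 0 \<and>
        visited S k \<subseteq>
          {1..clients I} \<inter> set (pre_digraph.awalk_verts (with_proj (graph I)) 0 (tour S k))) \<and>
     (\<exists>P\<ge>1. \<forall>k\<ge>1. tour S (k + P) = tour S k \<and> visited S (k + P) = visited S k)"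

definition feasible :: "rftt \<Rightarrow> plan \<Rightarrow> bool" where
  "feasible I S \<longleftrightarrow>
     solution I S \<and> (\<forall>t. \<forall>j \<in> {1..clients I}. j \<in> (\<Union>k \<in> {t + 1..t + turnover I j}. visited S k))"

definition tour_cost :: "rftt \<Rightarrow> (nat \<times> nat) awalk \<Rightarrow> real" where
  "tour_cost I T = wf_digraph.awalk_cost (\<lambda>e. of_rat (weight I e)) T"

text \<open>The set of tour costs is finite by periodicity, so the maximum exists.\<close>

definition max_cost :: "rftt \<Rightarrow> plan \<Rightarrow> real" where
  "max_cost I S = (MAX k \<in> {1..}. tour_cost I (tour S k))"

definition opt :: "rftt \<Rightarrow> real" where
  "opt I = (INF S \<in> {S. feasible I S}. max_cost I S)"


section \<open>Random access programs with logarithmic cost\<close>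

text \<open>
  Programs compute on arrays of unbounded natural numbers. A program mentions only finitely many
  array names, while indices are computed, so this is a random access machine with structured
  control flow. Costs follow the logarithmic cost criterion: evaluating an expression costs the
  total bit length of all intermediate values (including indices). Running time is therefore
  polynomially related to that of Turing machines, although multiplication and division are
  primitive. Output goes to a write-only tape, so its size is bounded by the running time.
\<close>

datatype binop = Add | Sub | Mul | Div

datatype expr =
    Num nat
  | Cell nat expr  \<comment> \<open>array name and index\<close>
  | Bin binop expr expr

datatype com =
    Skip
  | Assign nat expr expr  \<comment> \<open>array name, index and new value\<close>
  | Write expr
  | Seq com com
  | Cond expr com com
  | While expr com

type_synonym memory = "nat \<Rightarrow> nat \<Rightarrow> nat"
type_synonym state = "memory \<times> nat list"

definition bits :: "nat \<Rightarrow> nat" where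
  "bits x = max 1 (floorlog 2 x)"

primrec binop_val :: "binop \<Rightarrow> nat \<Rightarrow> nat \<Rightarrow> nat" where
  "binop_val Add x y = x + y"
| "binop_val Sub x y = x - y"
| "binop_val Mul x y = x * y"
| "binop_val Div x y = x div y"

primrec expr_val :: "expr \<Rightarrow> memory \<Rightarrow> nat" where
  "expr_val (Num x) m = x"
| "expr_val (Cell a e) m = m a (expr_val e m)"
| "expr_val (Bin f e1 e2) m = binop_val f (expr_val e1 m) (expr_val e2 m)"

primrec expr_cost :: "expr \<Rightarrow> memory \<Rightarrow> nat" where
  "expr_cost (Num x) m = bits x"
| "expr_cost (Cell a e) m = expr_cost e m + bits (expr_val (Cell a e) m)"
| "expr_cost (Bin f e1 e2) m =
     expr_cost e1 m + expr_cost e2 m + bits (expr_val (Bin f e1 e2) m)"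

text \<open>\<open>exec c s t s'\<close>: started in state \<open>s\<close>, program \<open>c\<close> halts in state \<open>s'\<close> after time \<open>t\<close>.
  A guard holds iff its value is nonzero.\<close>

inductive exec :: "com \<Rightarrow> state \<Rightarrow> nat \<Rightarrow> state \<Rightarrow> bool" where
  Skip: "exec Skip s 1 s"
| Assign: "exec (Assign a e1 e2) (m, out) (1 + expr_cost e1 m + expr_cost e2 m)
     (m(a := (m a)(expr_val e1 m := expr_val e2 m)), out)"
| Write: "exec (Write e) (m, out) (1 + expr_cost e m) (m, out @ [expr_val e m])"
| Seq: "exec c1 s t1 s' \<Longrightarrow> exec c2 s' t2 s'' \<Longrightarrow> exec (Seq c1 c2) s (1 + t1 + t2) s''"
| CondTrue: "expr_val e (fst s) \<noteq> 0 \<Longrightarrow> exec c1 s t s' \<Longrightarrow>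
     exec (Cond e c1 c2) s (1 + expr_cost e (fst s) + t) s'"
| CondFalse: "expr_val e (fst s) = 0 \<Longrightarrow> exec c2 s t s' \<Longrightarrow>
     exec (Cond e c1 c2) s (1 + expr_cost e (fst s) + t) s'"
| WhileTrue: "expr_val e (fst s) \<noteq> 0 \<Longrightarrow> exec c s t1 s' \<Longrightarrow> exec (While e c) s' t2 s'' \<Longrightarrow>
     exec (While e c) s (1 + expr_cost e (fst s) + t1 + t2) s''"
| WhileFalse: "expr_val e (fst s) = 0 \<Longrightarrow> exec (While e c) s (1 + expr_cost e (fst s)) s"

inductive_cases exec_SkipE: "exec Skip s t s'"
inductive_cases exec_AssignE: "exec (Assign a e1 e2) s t s'"
inductive_cases exec_WriteE: "exec (Write e) s t s'"
inductive_cases exec_SeqE: "exec (Seq c1 c2) s t s'"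
inductive_cases exec_CondE: "exec (Cond e c1 c2) s t s'"
inductive_cases exec_WhileE: "exec (While e c) s t s'"

lemma exec_deterministic:
  "exec c s t s' \<Longrightarrow> exec c s u s'' \<Longrightarrow> t = u \<and> s' = s''"
proof (induction arbitrary: u s'' rule: exec.induct)
  case (Seq c1 s t1 s' c2 t2 s2)
  from Seq.prems obtain u1 u2 r where "u = 1 + u1 + u2" "exec c1 s u1 r" "exec c2 r u2 s''"
    by - (erule exec_SeqE, simp)
  with Seq.IH show ?case by metis
next
  case (WhileTrue e s c t1 s' t2 s2)
  from WhileTrue.prems WhileTrue.hyps obtain u1 u2 r where
    "u = 1 + expr_cost e (fst s) + u1 + u2" "exec c s u1 r" "exec (While e c) r u2 s''"
    by - (erule exec_WhileE, simp_all)
  with WhileTrue.IH show ?case by metis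
next
  case (CondTrue e s c1 t s' c2)
  from CondTrue.prems CondTrue.hyps(1) obtain v where
    "u = 1 + expr_cost e (fst s) + v" "exec c1 s v s''"
    by (auto elim: exec_CondE)
  with CondTrue.IH show ?case by metis
next
  case (CondFalse e s c2 t s' c1)
  from CondFalse.prems CondFalse.hyps(1) obtain v where
    "u = 1 + expr_cost e (fst s) + v" "exec c2 s v s''"
    by (auto elim: exec_CondE)
  with CondFalse.IH show ?case by metis
next
  case (WhileFalse e s c)
  from WhileFalse.prems show ?case
    by (rule exec_WhileE) (use WhileFalse.hyps in auto)
qed (auto elim: exec_SkipE exec_AssignE exec_WriteE)

text \<open>The input is the initial segment of array 0; everything else is 0 at the start.\<close>

definition input_memory :: "nat list \<Rightarrow> memory" where
  "input_memory xs a i = (if a = 0 \<and> i < length xs then xs ! i else 0)"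

definition input_size :: "nat list \<Rightarrow> nat" where
  "input_size xs = (\<Sum>x\<leftarrow>xs. bits x)"

definition runs :: "com \<Rightarrow> nat list \<Rightarrow> nat \<Rightarrow> nat list \<Rightarrow> bool" where
  "runs c xs t ys \<longleftrightarrow> (\<exists>m. exec c (input_memory xs, []) t (m, ys))"


section \<open>Encodings and approximation algorithms\<close>

text \<open>
  An instance is encoded as \<open>n\<close>, then the turnover times in binary, then the adjacency matrix row
  by row; an edge contributes \<open>1\<close> and the numerator and denominator of its weight.
\<close>

definition encode_entry :: "rftt \<Rightarrow> nat \<times> nat \<Rightarrow> nat list" where
  "encode_entry I e =
     (if e \<in> parcs (graph I)
      then [1, nat (fst (quotient_of (weight I e))), nat (snd (quotient_of (weight I e)))]
      else [0, 0, 0])"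

definition encode_instance :: "rftt \<Rightarrow> nat list" where
  "encode_instance I =
     clients I # map (turnover I) [1..<clients I + 1] @
     concat (map (encode_entry I) (List.product [0..<clients I + 1] [0..<clients I + 1]))"

text \<open>
  An algorithm outputs one full period of its solution, day by day: the tour of each day,
  given by its arcs, and the clients visited.
\<close>

type_synonym schedule = "((nat \<times> nat) list \<times> nat list) list"

definition encode_list :: "('a \<Rightarrow> nat list) \<Rightarrow> 'a list \<Rightarrow> nat list" where
  "encode_list f xs = length xs # concat (map f xs)"

definition encode_schedule :: "schedule \<Rightarrow> nat list" where
  "encode_schedule =
     encode_list (\<lambda>(T, J). encode_list (\<lambda>(u, v). [u, v]) T @ encode_list (\<lambda>v. [v]) J)"

definition plan_of :: "schedule \<Rightarrow> plan" where
  "plan_of D = \<lparr> tour = (\<lambda>k. fst (D ! ((k - 1) mod length D))),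
                 visited = (\<lambda>k. set (snd (D ! ((k - 1) mod length D)))) \<rparr>"

definition min_max_approx_algorithm :: "com \<Rightarrow> (nat \<Rightarrow> real) \<Rightarrow> bool" where
  "min_max_approx_algorithm c \<alpha> \<longleftrightarrow>
     (\<forall>I. rftt_instance I \<longrightarrow>
        (\<exists>t D. runs c (encode_instance I) t (encode_schedule D) \<and> D \<noteq> [] \<and>
           feasible I (plan_of D) \<and>
           max_cost I (plan_of D) \<le> \<alpha> (clients I) * opt I))"

definition polynomial_time :: "com \<Rightarrow> bool" where
  "polynomial_time c \<longleftrightarrow>
     (\<exists>p :: nat poly. \<forall>I. rftt_instance I \<longrightarrow>
        (\<exists>t ys. runs c (encode_instance I) t ys \<and> t \<le> poly p (input_size (encode_instance I))))"

end

theory Submission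
  imports Defs
begin

text \<open>
  Round every turnover time down to a power of two, capped at the largest power of two \<open>\<le> n\<close>.
  This leaves \<open>O(log n)\<close> classes. Let \<open>p\<close> be the rounded turnover time of a class. In any
  feasible solution \<open>2 p\<close> tours suffice to visit all clients of the class: the tours of the first
  \<open>2 p\<close> days, or one tour per client when \<open>2 p > n\<close>. So a minimum spanning tree of the class and
  the depot costs at most \<open>2 p OPT\<close>, and the closed walk around the tree built by Prim's algorithm
  has length \<open>C \<le> 4 p OPT\<close>. Cut this walk into \<open>p\<close> pieces of length at most \<open>C / p\<close> and
  serve piece \<open>k mod p\<close> on day \<open>k\<close>. Since the distance of a client from the depot is at most
  \<open>OPT / 2\<close>, each class costs at most \<open>5 OPT\<close> per day. The capping makes the period at most \<open>n\<close>.

  The program runs on integers, after multiplication of all weights by a common denominator. All its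
  loops are bounded by a polynomial in the input size \<open>s\<close> and all its values by \<open>2 ^ (s + 3)\<^sup>2\<close>, so
  that a time bound can be read off from the syntax.
\<close>

section \<open>Weakest preconditions with a syntactic time bound\<close>

text \<open>Trees and their minimality are never formalised. Prim's algorithm is compared directly
  with a family of paths from the depot, such as the tours of an arbitrary solution: each time a
  client is attached at distance \<open>d\<close>, an arc of cost at least \<open>d\<close> is
  removed from that family, so the walk length is at most twice the cost of the family. The walk
  itself is not stored either. Each client only keeps the rank and the position of its first visit,
  and \<open>pos a + dist a b \<le> pos b\<close> for \<open>a\<close> before \<open>b\<close> is
  all that scheduling requires. Classes can be served independently because all rounded turnover
  times divide the period: serving a class on fixed residues survives the cyclic reading of the
  schedule. The obstacle is to get a polynomial time bound without separate cost proofs. All loops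
  therefore make a number of iterations that is fixed on entry, with idle rounds where necessary, so
  that one invariant indexed by the iteration number yields correctness, termination and time
  together. This also explains flat loops over pairs and triples of vertices, and tables filled
  completely, where a more adaptive program would be faster.\<close>

primrec expr_weight :: "expr \<Rightarrow> nat" where
  "expr_weight (Num x) = bits x"
| "expr_weight (Cell a e) = expr_weight e + 1"
| "expr_weight (Bin f e1 e2) = expr_weight e1 + expr_weight e2 + 1"

text \<open>Bounds the running time when every loop makes at most \<open>K\<close> iterations and all memory cells
  stay below \<open>2 ^ B\<close>; polymorphic, so that it can also be read as a polynomial.\<close>

primrec time_bound :: "'a::comm_semiring_1 \<Rightarrow> 'a \<Rightarrow> com \<Rightarrow> 'a" where
  "time_bound K B Skip = 1"
| "time_bound K B (Assign a e1 e2) =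
     1 + of_nat ((expr_weight e1)\<^sup>2) * B + of_nat ((expr_weight e2)\<^sup>2) * B"
| "time_bound K B (Write e) = 1 + of_nat ((expr_weight e)\<^sup>2) * B"
| "time_bound K B (Seq c1 c2) = 1 + time_bound K B c1 + time_bound K B c2"
| "time_bound K B (Cond e c1 c2) =
     1 + of_nat ((expr_weight e)\<^sup>2) * B + (time_bound K B c1 + time_bound K B c2)"
| "time_bound K B (While e c) =
     K * (1 + of_nat ((expr_weight e)\<^sup>2) * B + time_bound K B c)
       + (1 + of_nat ((expr_weight e)\<^sup>2) * B)"

text \<open>Evaluation at a point is a semiring homomorphism, hence commutes with a bound built from
  sums and products only.\<close>

lemma poly_time_bound: "poly (time_bound K B c) x = time_bound (poly K x) (poly B x) c"
  by (induction c) (simp_all only: time_bound.simps poly_add poly_mult poly_1 of_nat_poly poly_pCons poly_0 mult_zero_right add_0_right)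

definition bounded :: "nat \<Rightarrow> state \<Rightarrow> bool" where
  "bounded B s \<longleftrightarrow> (\<forall>a i. fst s a i < 2 ^ B)"

primrec writes :: "com \<Rightarrow> nat set" where
  "writes Skip = {}"
| "writes (Assign a e1 e2) = {a}"
| "writes (Write e) = {}"
| "writes (Seq c1 c2) = writes c1 \<union> writes c2"
| "writes (Cond e c1 c2) = writes c1 \<union> writes c2"
| "writes (While e c) = writes c"

primrec outputs :: "com \<Rightarrow> bool" where
  "outputs Skip = False"
| "outputs (Assign a e1 e2) = False"
| "outputs (Write e) = True"
| "outputs (Seq c1 c2) \<longleftrightarrow> outputs c1 \<or> outputs c2"
| "outputs (Cond e c1 c2) \<longleftrightarrow> outputs c1 \<or> outputs c2"
| "outputs (While e c) = outputs c"

definition frame :: "com \<Rightarrow> state \<Rightarrow> state \<Rightarrow> bool" where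
  "frame c s s' \<longleftrightarrow> (\<forall>a. a \<notin> writes c \<longrightarrow> fst s' a = fst s a) \<and> (\<not> outputs c \<longrightarrow> snd s' = snd s)"

lemma frameD: "frame c s s' \<Longrightarrow> a \<notin> writes c \<Longrightarrow> fst s' a = fst s a"
  by (simp add: frame_def)

lemma exec_frame: "exec c s t s' \<Longrightarrow> frame c s s'"
  by (induction rule: exec.induct) (auto simp: frame_def)

text \<open>Correctness, time and cell size are established together. Boundedness is both a premise
  and part of the conclusion, so it passes through compositions and invariants need not mention
  it.\<close>

definition wp :: "nat \<Rightarrow> nat \<Rightarrow> com \<Rightarrow> (state \<Rightarrow> bool) \<Rightarrow> state \<Rightarrow> bool" where
  "wp K B c Q s \<longleftrightarrow> (bounded B s \<longrightarrow>
     (\<exists>t s'. exec c s t s' \<and> t \<le> time_bound K B c \<and> bounded B s' \<and> Q s'))"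

lemma bits_pos: "1 \<le> bits x"
  by (simp add: bits_def)

lemma less_power_bits: "x < 2 ^ bits x"
proof (cases "x = 0")
  case False
  then have "x < 2 ^ floorlog 2 x" using floorlog_bounds[of x 2] by simp
  also have "\<dots> \<le> 2 ^ bits x" by (rule power_increasing) (auto simp: bits_def)
  finally show ?thesis .
qed simp

lemma bits_le: "x < 2 ^ k \<Longrightarrow> 1 \<le> k \<Longrightarrow> bits x \<le> k"
  by (auto simp: bits_def intro: floorlog_leI)

lemma expr_weight_pos: "1 \<le> expr_weight e"
  by (induction e) (use bits_pos in auto)

lemma expr_val_less:
  assumes "bounded B (m, out)" "1 \<le> B"
  shows "expr_val e m < 2 ^ (expr_weight e * B)"
proof (induction e)
  case (Num x)
  have "x < 2 ^ bits x" by (rule less_power_bits)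
  also have "\<dots> \<le> 2 ^ (bits x * B)" using \<open>1 \<le> B\<close> by (intro power_increasing) auto
  finally show ?case by simp
next
  case (Cell a e)
  have "m a (expr_val e m) < 2 ^ B" using assms by (simp add: bounded_def)
  also have "\<dots> \<le> 2 ^ (expr_weight (Cell a e) * B)" by (intro power_increasing) auto
  finally show ?case by simp
next
  case (Bin f e1 e2)
  let ?x = "2 ^ (expr_weight e1 * B) :: nat" and ?y = "2 ^ (expr_weight e2 * B) :: nat"
  \<comment> \<open>Both bounds are at least 2, so their sum is at most their product, and addition
    is covered by the exponent that multiplication requires.\<close>
  have ge: "?x \<ge> 2 ^ 1" "?y \<ge> 2 ^ 1"
    using expr_weight_pos[of e1] expr_weight_pos[of e2] \<open>1 \<le> B\<close>
    by (intro power_increasing; simp)+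
  have "binop_val f (expr_val e1 m) (expr_val e2 m) < ?x * ?y"
  proof (cases f)
    case Add
    have "expr_val e1 m + expr_val e2 m < ?x + ?y" using Bin.IH by simp
    also have "\<dots> \<le> ?x * ?y"
    proof -
      obtain x' y' where "?x = 2 + x'" "?y = 2 + y'" using ge by (metis le_Suc_ex power_one_right)
      then show ?thesis by (simp add: algebra_simps)
    qed
    finally show ?thesis using Add by simp
  next
    case Sub
    have "expr_val e1 m - expr_val e2 m < ?x" using Bin.IH by simp
    also have "\<dots> \<le> ?x * ?y" using ge by simp
    finally show ?thesis using Sub by simp
  next
    case Mul
    then show ?thesis using Bin.IH by (simp add: mult_strict_mono)
  next
    case Div
    have "expr_val e1 m div expr_val e2 m < ?x" using Bin.IH(1) div_le_dividend le_less_trans by blast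
    also have "\<dots> \<le> ?x * ?y" using ge by simp
    finally show ?thesis using Div by simp
  qed
  also have "\<dots> = 2 ^ ((expr_weight e1 + expr_weight e2) * B)" by (simp add: power_add algebra_simps)
  also have "\<dots> \<le> 2 ^ (expr_weight (Bin f e1 e2) * B)" by (intro power_increasing) auto
  finally show ?case by simp
qed

text \<open>An expression has at most \<open>expr_weight e\<close> subexpressions, each with a value
  of at most \<open>expr_weight e * B\<close> bits; hence the square.\<close>

lemma expr_cost_le:
  assumes "bounded B (m, out)" "1 \<le> B"
  shows "expr_cost e m \<le> (expr_weight e)\<^sup>2 * B"
proof (induction e)
  case (Num x)
  have "bits x * 1 \<le> bits x * (bits x * B)" using bits_pos[of x] \<open>1 \<le> B\<close> by (intro mult_le_mono) auto
  then show ?case by (simp add: power2_eq_square algebra_simps)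
next
  case (Cell a e)
  have "bits (m a (expr_val e m)) \<le> B" using assms by (intro bits_le) (auto simp: bounded_def)
  moreover have "B \<le> (2 * expr_weight e + 1) * B" by simp
  ultimately show ?case using Cell.IH by (simp add: power2_eq_square algebra_simps)
next
  case (Bin f e1 e2)
  have "1 * 1 \<le> expr_weight (Bin f e1 e2) * B" using \<open>1 \<le> B\<close> by (intro mult_le_mono) auto
  then have "bits (expr_val (Bin f e1 e2) m) \<le> expr_weight (Bin f e1 e2) * B"
    using expr_val_less[OF assms, of "Bin f e1 e2"] by (intro bits_le) auto
  then have "expr_cost (Bin f e1 e2) m
      \<le> ((expr_weight e1)\<^sup>2 + (expr_weight e2)\<^sup>2 + (expr_weight e1 + expr_weight e2 + 1)) * B"
    using Bin.IH by (simp add: algebra_simps)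
  also have "\<dots> \<le> (expr_weight (Bin f e1 e2))\<^sup>2 * B"
    by (intro mult_le_mono) (auto simp: power2_eq_square algebra_simps)
  finally show ?case .
qed

text \<open>A consequence rule that also supplies the frame, so that specifications of subprograms
  can stay silent about arrays they leave alone.\<close>

lemma wp_mono_frame:
  assumes "wp K B c Q s" "\<And>s'. Q s' \<Longrightarrow> frame c s s' \<Longrightarrow> bounded B s' \<Longrightarrow> Q' s'"
  shows "wp K B c Q' s"
  using assms unfolding wp_def by (metis exec_frame)

lemma wp_bounded:
  assumes "bounded B s \<Longrightarrow> wp K B c Q s"
  shows "wp K B c Q s"
  using assms by (auto simp: wp_def)

lemma wp_Skip: "Q s \<Longrightarrow> wp K B Skip Q s"
  unfolding wp_def using exec.Skip[of s] by (intro impI exI[of _ 1] exI[of _ s]) simp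

lemma wp_Assign:
  assumes "1 \<le> B" "expr_val e2 m < 2 ^ B"
    "Q (m(a := (m a)(expr_val e1 m := expr_val e2 m)), out)"
  shows "wp K B (Assign a e1 e2) Q (m, out)"
  unfolding wp_def
proof (intro impI exI conjI)
  assume b: "bounded B (m, out)"
  show "exec (Assign a e1 e2) (m, out) (1 + expr_cost e1 m + expr_cost e2 m)
     (m(a := (m a)(expr_val e1 m := expr_val e2 m)), out)" by (rule exec.Assign)
  show "1 + expr_cost e1 m + expr_cost e2 m \<le> time_bound K B (Assign a e1 e2)"
    using expr_cost_le[OF b assms(1), of e1] expr_cost_le[OF b assms(1), of e2] by simp
  show "bounded B (m(a := (m a)(expr_val e1 m := expr_val e2 m)), out)"
    using b assms(2) by (simp add: bounded_def)
qed (use assms in auto)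

lemma wp_Write:
  assumes "1 \<le> B" "Q (m, out @ [expr_val e m])"
  shows "wp K B (Write e) Q (m, out)"
  unfolding wp_def
proof (intro impI exI conjI)
  assume b: "bounded B (m, out)"
  show "exec (Write e) (m, out) (1 + expr_cost e m) (m, out @ [expr_val e m])" by (rule exec.Write)
  show "1 + expr_cost e m \<le> time_bound K B (Write e)"
    using expr_cost_le[OF b assms(1), of e] by simp
  show "bounded B (m, out @ [expr_val e m])" using b by (simp add: bounded_def)
qed (use assms in auto)

lemma wp_Seq:
  assumes "wp K B c1 (wp K B c2 Q) s"
  shows "wp K B (Seq c1 c2) Q s"
  unfolding wp_def
proof
  assume "bounded B s"
  then obtain t1 s1 where 1: "exec c1 s t1 s1" "t1 \<le> time_bound K B c1" "bounded B s1"
    "wp K B c2 Q s1" using assms unfolding wp_def by blast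
  then obtain t2 s2 where 2: "exec c2 s1 t2 s2" "t2 \<le> time_bound K B c2" "bounded B s2" "Q s2"
    unfolding wp_def by blast
  then show "\<exists>t s'. exec (Seq c1 c2) s t s' \<and> t \<le> time_bound K B (Seq c1 c2) \<and> bounded B s' \<and> Q s'"
    using exec.Seq[OF 1(1) 2(1)] 1 2 by (intro exI[of _ "1 + t1 + t2"] exI[of _ s2]) auto
qed

definition holds :: "expr \<Rightarrow> memory \<Rightarrow> bool" where
  "holds e m \<longleftrightarrow> expr_val e m \<noteq> 0"

lemma wp_Cond:
  assumes "1 \<le> B" "holds e m \<Longrightarrow> wp K B c1 Q (m, out)" "\<not> holds e m \<Longrightarrow> wp K B c2 Q (m, out)"
  shows "wp K B (Cond e c1 c2) Q (m, out)"
  unfolding wp_def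
proof
  assume b: "bounded B (m, out)"
  note c = expr_cost_le[OF b assms(1), of e]
  show "\<exists>t s'. exec (Cond e c1 c2) (m, out) t s' \<and> t \<le> time_bound K B (Cond e c1 c2) \<and> bounded B s' \<and> Q s'"
  proof (cases "holds e m")
    case True
    then obtain t s' where "exec c1 (m, out) t s'" "t \<le> time_bound K B c1" "bounded B s'" "Q s'"
      using b assms(2)[OF True] unfolding wp_def by blast
    then show ?thesis using c True exec.CondTrue[of e "(m, out)" c1 t s' c2]
      by (intro exI[of _ "1 + expr_cost e m + t"] exI[of _ s']) (auto simp: holds_def)
  next
    case False
    then obtain t s' where "exec c2 (m, out) t s'" "t \<le> time_bound K B c2" "bounded B s'" "Q s'"
      using b assms(3)[OF False] unfolding wp_def by blast
    then show ?thesis using c False exec.CondFalse[of e "(m, out)" c2 t s' c1]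
      by (intro exI[of _ "1 + expr_cost e m + t"] exI[of _ s']) (auto simp: holds_def)
  qed
qed

text \<open>The invariant carries the iteration number and \<open>h\<close> is the exact number of
  iterations; termination and time then follow from \<open>h \<le> K\<close> without a
  variant.\<close>

lemma wp_While:
  assumes B: "1 \<le> B" and "h \<le> K" and "I 0 s"
    and step: "\<And>k s. k < h \<Longrightarrow> I k s \<Longrightarrow> holds e (fst s) \<and> wp K B c (I (Suc k)) s"
    and stop: "\<And>s. I h s \<Longrightarrow> \<not> holds e (fst s) \<and> Q s"
  shows "wp K B (While e c) Q s"
proof -
  define w where "w = (expr_weight e)\<^sup>2 * B"
  have "\<exists>t s'. exec (While e c) s t s' \<and>
      t \<le> (h - k) * (1 + w + time_bound K B c) + (1 + w) \<and> bounded B s' \<and> Q s'"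
    if "k \<le> h" "I k s" "bounded B s" for k s
    using that
  proof (induction "h - k" arbitrary: k s)
    case 0
    then have h: "\<not> holds e (fst s)" "Q s" using stop by auto
    have "expr_cost e (fst s) \<le> w"
      using expr_cost_le[of B "fst s" "snd s" e] B 0 by (simp add: w_def)
    then show ?case using h exec.WhileFalse[of e s c] 0
      by (intro exI[of _ "1 + expr_cost e (fst s)"] exI[of _ s]) (auto simp: holds_def)
  next
    case (Suc d)
    then have k: "k < h" by simp
    have h: "holds e (fst s)" and "wp K B c (I (Suc k)) s" using step[OF k \<open>I k s\<close>] by auto
    then obtain t1 s1 where 1: "exec c s t1 s1" "t1 \<le> time_bound K B c" "bounded B s1" "I (Suc k) s1"
      using Suc.prems unfolding wp_def by blast
    obtain t2 s2 where 2: "exec (While e c) s1 t2 s2"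
      "t2 \<le> (h - Suc k) * (1 + w + time_bound K B c) + (1 + w)" "bounded B s2" "Q s2"
    proof -
      have "d = h - Suc k" "Suc k \<le> h" using Suc.hyps(2) k by auto
      from Suc.hyps(1)[OF this 1(4,3)] show ?thesis using that by blast
    qed
    have "expr_cost e (fst s) \<le> w"
      using expr_cost_le[of B "fst s" "snd s" e] B Suc.prems by (simp add: w_def)
    moreover have "h - k = Suc (h - Suc k)" using k by simp
    ultimately have "1 + expr_cost e (fst s) + t1 + t2 \<le> (h - k) * (1 + w + time_bound K B c) + (1 + w)"
      using 1(2) 2(2) by simp
    then show ?case using exec.WhileTrue[of e s c t1 s1 t2 s2] h 1 2 unfolding holds_def by blast
  qed
  from this[of 0 s] assms(3) have "bounded B s \<Longrightarrow> \<exists>t s'. exec (While e c) s t s' \<and>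
      t \<le> h * (1 + w + time_bound K B c) + (1 + w) \<and> bounded B s' \<and> Q s'" by simp
  moreover have "h * (1 + w + time_bound K B c) + (1 + w) \<le> time_bound K B (While e c)"
    using mult_le_mono1[OF \<open>h \<le> K\<close>, of "1 + w + time_bound K B c"] by (simp add: w_def)
  ultimately show ?thesis unfolding wp_def by (meson order_trans)
qed

section \<open>Arithmetic guards and counting loops\<close>

abbreviation Var :: "nat \<Rightarrow> expr" where "Var a \<equiv> Cell a (Num 0)"
abbreviation Set :: "nat \<Rightarrow> expr \<Rightarrow> com" where "Set a e \<equiv> Assign a (Num 0) e"
abbreviation When :: "expr \<Rightarrow> com \<Rightarrow> com" where "When e c \<equiv> Cond e c Skip"

abbreviation plus_expr (infixl "+." 65) where "e +. f \<equiv> Bin Add e f"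
abbreviation minus_expr (infixl "-." 65) where "e -. f \<equiv> Bin Sub e f"
abbreviation times_expr (infixl "*." 70) where "e *. f \<equiv> Bin Mul e f"
abbreviation div_expr (infixl "'/." 70) where "e /. f \<equiv> Bin Div e f"
abbreviation mod_expr (infixl "%." 70) where "e %. f \<equiv> e -. e /. f *. f"
abbreviation Seq_syntax (infixr ";;" 55) where "c1 ;; c2 \<equiv> Seq c1 c2"

text \<open>Guards are numbers: truncated subtraction provides comparisons, products and sums act as
  conjunction and disjunction.\<close>

definition less_expr (infix "<." 50) where "(e <. f) = f -. e"
definition eq_expr (infix "=." 50) where "(e =. f) = Num 1 -. ((e -. f) +. (f -. e))"
definition not_expr ("~. _" [49] 49) where "(~. e) = Num 1 -. e"
definition and_expr (infixr "&." 45) where "(e &. f) = e *. f"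
definition or_expr (infixr "|." 44) where "(e |. f) = e +. f"

lemma holds_simps [simp]:
  "holds (e <. f) m \<longleftrightarrow> expr_val e m < expr_val f m"
  "holds (e =. f) m \<longleftrightarrow> expr_val e m = expr_val f m"
  "holds (~. e) m \<longleftrightarrow> \<not> holds e m"
  "holds (e &. f) m \<longleftrightarrow> holds e m \<and> holds f m"
  "holds (e |. f) m \<longleftrightarrow> holds e m \<or> holds f m"
  by (auto simp: holds_def less_expr_def eq_expr_def not_expr_def and_expr_def or_expr_def)

lemma holds_Cell [simp]: "holds (Cell a e) m \<longleftrightarrow> expr_val (Cell a e) m \<noteq> 0"
  by (simp add: holds_def)

definition For :: "nat \<Rightarrow> expr \<Rightarrow> com \<Rightarrow> com" where
  "For i e c = Set i (Num 0) ;; While (Var i <. e) (c ;; Set i (Var i +. Num 1))"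

lemma writes_For [simp]: "writes (For i e c) = insert i (writes c)"
  by (auto simp: For_def)

lemma outputs_For [simp]: "outputs (For i e c) = outputs c"
  by (simp add: For_def)

text \<open>Premise \<open>bound\<close> evaluates the limit only in states allowed by the frame, so
  the limit may be read from arrays that the body leaves alone. Premise \<open>indep\<close> makes
  the counter update invisible to the invariant. The counter itself reaches \<open>h\<close>, which
  must therefore fit into a cell.\<close>

lemma wp_For:
  assumes B: "1 \<le> B" and "h \<le> K" and hB: "h < 2 ^ B"
    and i: "i \<notin> writes c"
    and start: "I 0 (m0(i := (m0 i)(0 := 0))) out0"
    and bound: "\<And>m out. frame (For i e c) (m0, out0) (m, out) \<Longrightarrow> expr_val e m = h"
    and indep: "\<And>k m out f. I k (m(i := f)) out = I k m out"
    and step: "\<And>k m out. k < h \<Longrightarrow> I k m out \<Longrightarrow> m i 0 = k \<Longrightarrow> frame (For i e c) (m0, out0) (m, out)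
       \<Longrightarrow> bounded B (m, out) \<Longrightarrow> wp K B c (\<lambda>(m', out'). I (Suc k) m' out') (m, out)"
    and stop: "\<And>m out. I h m out \<Longrightarrow> frame (For i e c) (m0, out0) (m, out) \<Longrightarrow> Q (m, out)"
  shows "wp K B (For i e c) Q (m0, out0)"
  unfolding For_def
proof (rule wp_Seq, rule wp_Assign[OF B])
  define J where "J = (\<lambda>k (m, out). I k m out \<and> m i 0 = k \<and> frame (For i e c) (m0, out0) (m, out))"
  show "wp K B (While (Var i <. e) (c ;; Set i (Var i +. Num 1))) Q
    (m0(i := (m0 i)(expr_val (Num 0) m0 := expr_val (Num 0) m0)), out0)"
  proof (rule wp_While[OF B \<open>h \<le> K\<close>, where I = J])
    show "J 0 (m0(i := (m0 i)(expr_val (Num 0) m0 := expr_val (Num 0) m0)), out0)"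
      using start by (auto simp: J_def frame_def)
  next
    fix k s assume k: "k < h" and J: "J k s"
    obtain m out where s: "s = (m, out)" by (cases s)
    have f: "frame (For i e c) (m0, out0) (m, out)" and mi: "m i 0 = k" and I: "I k m out"
      using J by (auto simp: J_def s)
    have "wp K B c (\<lambda>(m', out'). I (Suc k) m' out') (m, out)" if "bounded B (m, out)"
      using step[OF k I mi f that] .
    then have "wp K B c (\<lambda>(m', out'). I (Suc k) m' out') (m, out)" by (rule wp_bounded)
    then have "wp K B c (wp K B (Set i (Var i +. Num 1)) (J (Suc k))) (m, out)"
    proof (rule wp_mono_frame)
      fix s' assume Q: "case s' of (m', out') \<Rightarrow> I (Suc k) m' out'" and fr: "frame c (m, out) s'"
      obtain m' out' where s': "s' = (m', out')" by (cases s')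
      have mi': "m' i 0 = k" using frameD[OF fr i] mi s' by simp
      show "wp K B (Set i (Var i +. Num 1)) (J (Suc k)) s'"
        unfolding s'
      proof (rule wp_Assign[OF B])
        show "expr_val (Var i +. Num 1) m' < 2 ^ B" using k mi' hB by simp
        show "J (Suc k) (m'(i := (m' i)(expr_val (Num 0) m' := expr_val (Var i +. Num 1) m')), out')"
          using Q s' indep f fr mi' by (auto simp: J_def frame_def)
      qed
    qed
    then show "holds (Var i <. e) (fst s) \<and> wp K B (c ;; Set i (Var i +. Num 1)) (J (Suc k)) s"
      using bound[OF f] mi k by (auto simp: s intro: wp_Seq)
  next
    fix s assume J: "J h s"
    obtain m out where s: "s = (m, out)" by (cases s)
    have f: "frame (For i e c) (m0, out0) (m, out)" and "m i 0 = h" "I h m out"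
      using J by (auto simp: J_def s)
    then show "\<not> holds (Var i <. e) (fst s) \<and> Q s"
      using bound[OF f] stop[of m out] by (simp add: s)
  qed
qed simp

section \<open>Finite metrics and Prim's algorithm\<close>

fun path_cost :: "('a \<Rightarrow> 'a \<Rightarrow> nat) \<Rightarrow> 'a list \<Rightarrow> nat" where
  "path_cost d (x # y # zs) = d x y + path_cost d (y # zs)"
| "path_cost d _ = 0"

lemma path_cost_append:
  "path_cost d (xs @ y # ys) = path_cost d (xs @ [y]) + path_cost d (y # ys)"
  by (induction xs rule: induct_list012) auto

definition paths_cost :: "('a \<Rightarrow> 'a \<Rightarrow> nat) \<Rightarrow> 'a list list \<Rightarrow> nat" where
  "paths_cost d Q = (\<Sum>q\<leftarrow>Q. path_cost d q)"

text \<open>The paths of \<open>Q\<close> connect the vertices \<open>R\<close> still missing to the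
  tree \<open>T\<close>. Tours of a solution have this shape from the start, and the exchange step
  preserves it.\<close>

definition covers :: "'a set \<Rightarrow> 'a set \<Rightarrow> 'a set \<Rightarrow> 'a list list \<Rightarrow> bool" where
  "covers V T R Q \<longleftrightarrow>
     (\<forall>q \<in> set Q. q \<noteq> [] \<and> hd q \<in> T \<and> set q \<subseteq> V) \<and> R \<subseteq> (\<Union>q \<in> set Q. set q)"

lemma paths_cost_simps [simp]:
  "paths_cost d [] = 0" "paths_cost d (q # Q) = path_cost d q + paths_cost d Q"
  "paths_cost d (Q @ Q') = paths_cost d Q + paths_cost d Q'"
  by (auto simp: paths_cost_def)

lemma paths_cost_map_le:
  assumes "\<And>q. q \<in> set Q \<Longrightarrow> path_cost d (f q) \<le> path_cost d q"
  shows "paths_cost d (map f Q) \<le> paths_cost d Q"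
  using assms by (induction Q) (auto simp: add_mono)

locale fin_metric =
  fixes V :: "'a set" and d :: "'a \<Rightarrow> 'a \<Rightarrow> nat"
  assumes d_diag: "x \<in> V \<Longrightarrow> d x x = 0"
    and d_sym: "x \<in> V \<Longrightarrow> y \<in> V \<Longrightarrow> d x y = d y x"
    and d_tri: "x \<in> V \<Longrightarrow> y \<in> V \<Longrightarrow> z \<in> V \<Longrightarrow> d x z \<le> d x y + d y z"
begin

lemma path_cost_Cons_le:
  "set (x # y # zs) \<subseteq> V \<Longrightarrow> path_cost d (x # zs) \<le> path_cost d (x # y # zs)"
  using d_tri[of x y "hd zs"] by (cases zs) auto

lemma path_cost_filter_le:
  "set (x # xs) \<subseteq> V \<Longrightarrow> path_cost d (x # filter P xs) \<le> path_cost d (x # xs)"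
proof (induction xs arbitrary: x)
  case (Cons y ys)
  have "path_cost d (y # filter P ys) \<le> path_cost d (y # ys)"
    using Cons by simp
  moreover have "path_cost d (x # filter P ys) \<le> path_cost d (x # y # filter P ys)"
    using Cons.prems by (intro path_cost_Cons_le) auto
  ultimately show ?case by auto
qed simp

lemma path_cost_rev: "set xs \<subseteq> V \<Longrightarrow> path_cost d (rev xs) = path_cost d xs"
proof (induction xs rule: induct_list012)
  case (3 x y zs)
  then show ?case using path_cost_append[of d "rev zs" y "[x]"] d_sym[of x y] by simp
qed auto

text \<open>Tours also pass through other classes. Shortcutting those vertices by the triangle
  inequality leaves a cover on the class and the root, the only vertices between which Prim's
  algorithm compares distances.\<close>

lemma covers_filter:
  assumes "covers V {x} R Q"
  obtains Q' where "covers (insert x R) {x} R Q'" "paths_cost d Q' \<le> paths_cost d Q"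
proof
  let ?f = "filter (\<lambda>y. y \<in> insert x R)"
  have q: "\<exists>qs. q = x # qs \<and> set (x # qs) \<subseteq> V" if "q \<in> set Q" for q
    using assms that unfolding covers_def by (cases q) fastforce+
  show "paths_cost d (map ?f Q) \<le> paths_cost d Q"
  proof (rule paths_cost_map_le)
    fix q assume "q \<in> set Q"
    then obtain qs where "q = x # qs" "set (x # qs) \<subseteq> V" using q by blast
    then show "path_cost d (?f q) \<le> path_cost d q"
      using path_cost_filter_le[of x qs] by simp
  qed
  show "covers (insert x R) {x} R (map ?f Q)"
    unfolding covers_def
  proof (intro conjI ballI)
    fix q' assume "q' \<in> set (map ?f Q)"
    then obtain q where "q \<in> set Q" "q' = ?f q" by auto
    moreover obtain qs where "q = x # qs" using q \<open>q \<in> set Q\<close> by blast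
    ultimately show "q' \<noteq> []" "hd q' \<in> {x}" "set q' \<subseteq> insert x R" by auto
  qed (use assms in \<open>auto simp: covers_def\<close>)
qed

text \<open>The exchange argument for minimum spanning trees: an arc \<open>(a, b)\<close> leaving \<open>T\<close> on the path
  that reaches \<open>v\<close> is given up, and the piece after it is traversed from \<open>v\<close> in both directions.\<close>

lemma covers_exchange:
  assumes Q: "covers (T \<union> R) T R Q" and TR: "T \<union> R \<subseteq> V" "v \<in> R" "v \<notin> T"
    and min: "\<And>a b. a \<in> T \<Longrightarrow> b \<in> R \<Longrightarrow> b \<notin> T \<Longrightarrow> \<delta> \<le> d a b"
  obtains Q' where "covers (T \<union> R) (insert v T) (R - {v}) Q'" "\<delta> + paths_cost d Q' \<le> paths_cost d Q"
proof -
  obtain q where q: "q \<in> set Q" "v \<in> set q" using Q TR(2) by (auto simp: covers_def)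
  obtain Q1 Q2 where Q12: "Q = Q1 @ q # Q2" using q(1) by (meson split_list)
  obtain q1 q2 where q12: "q = q1 @ v # q2" using q(2) by (meson split_list)
  have qT: "hd q \<in> T" "set q \<subseteq> T \<union> R" using Q q(1) by (auto simp: covers_def)
  \<comment> \<open>\<open>b\<close> is the first vertex outside \<open>T\<close> on the way to
    \<open>v\<close>, so its predecessor \<open>a\<close> lies in \<open>T\<close> and the bound
    \<open>\<delta>\<close> applies to the arc between them.\<close>
  obtain p1 b p2 where p: "q1 @ [v] = p1 @ b # p2" "b \<notin> T" "set p1 \<subseteq> T"
  proof -
    have "\<exists>x \<in> set (q1 @ [v]). x \<notin> T" using TR(3) by auto
    from split_list_first_prop[OF this] show ?thesis using that by blast
  qed
  have "p1 \<noteq> []"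
  proof
    assume "p1 = []"
    then have "hd q = b" using p(1) q12 by (cases q1) auto
    then show False using qT(1) p(2) by simp
  qed
  then obtain p0 a where p1: "p1 = p0 @ [a]" by (meson rev_exhaust)
  have aT: "a \<in> T" using p(3) p1 by simp
  have qeq: "q = p0 @ [a] @ b # p2 @ q2"
    using q12 p(1) p1 by (metis append.assoc append_Cons append_Nil)
  have bR: "b \<in> R" using qT(2) p(2) qeq by auto
  \<comment> \<open>\<open>b\<close> may be \<open>v\<close> itself. In any case the segment ends in
    \<open>v\<close>, so its reversal starts at the new tree vertex.\<close>
  obtain p3 where p3: "b # p2 = p3 @ [v]"
    using p(1) by (cases p2 rule: rev_cases) (auto simp flip: append_Cons append_assoc)
  let ?A = "p0 @ [a]" and ?B = "rev (b # p2)" and ?C = "v # q2"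
  have pc: "path_cost d q = path_cost d ?A + d a b + path_cost d (b # p2) + path_cost d ?C"
  proof -
    have "path_cost d q = path_cost d ?A + path_cost d (a # b # p2 @ q2)"
      using path_cost_append[of d p0 a "b # p2 @ q2"] by (simp add: qeq)
    moreover have "path_cost d (b # p2 @ q2) = path_cost d (p3 @ [v]) + path_cost d (v # q2)"
      using path_cost_append[of d p3 v q2] p3 by (metis append.assoc append_Cons append_Nil)
    ultimately show ?thesis using p3 by simp
  qed
  have "set (b # p2) \<subseteq> V" using qT(2) qeq TR(1) by auto
  then have "path_cost d ?B = path_cost d (b # p2)" by (rule path_cost_rev)
  then have "\<delta> + paths_cost d (Q1 @ [?A, ?B, ?C] @ Q2) \<le> paths_cost d Q"
    using pc min[OF aT bR p(2)] Q12 by simp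
  moreover have "covers (T \<union> R) (insert v T) (R - {v}) (Q1 @ [?A, ?B, ?C] @ Q2)"
  proof -
    have sets: "set ?A \<union> set ?B \<union> set ?C = set q"
    proof -
      have "insert b (set p2) = insert v (set p3)" using arg_cong[OF p3, of set] by simp
      then show ?thesis by (auto simp: qeq)
    qed
    have hds: "hd ?A \<in> T" "hd ?B = v" "hd ?C = v"
      using qT(1) p3 by (auto simp: qeq hd_append split: if_splits)
    show ?thesis
      unfolding covers_def
    proof (intro conjI ballI)
      fix q' assume "q' \<in> set (Q1 @ [?A, ?B, ?C] @ Q2)"
      then consider "q' \<in> set Q" | "q' = ?A" | "q' = ?B" | "q' = ?C" using Q12 by auto
      then have "q' \<noteq> [] \<and> hd q' \<in> insert v T \<and> set q' \<subseteq> T \<union> R"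
      proof cases
        case 1 then show ?thesis using Q by (auto simp: covers_def)
      next
        case 2 then show ?thesis using hds sets qT by auto
      next
        case 3 then show ?thesis using hds sets qT by auto
      next
        case 4 then show ?thesis using hds sets qT by auto
      qed
      then show "q' \<noteq> []" "hd q' \<in> insert v T" "set q' \<subseteq> T \<union> R" by auto
    next
      have "(\<Union>q \<in> set (Q1 @ [?A, ?B, ?C] @ Q2). set q)
          = (\<Union>q \<in> set Q1. set q) \<union> (set ?A \<union> set ?B \<union> set ?C) \<union> (\<Union>q \<in> set Q2. set q)"
        by auto
      also have "\<dots> = (\<Union>q \<in> set Q. set q)" unfolding sets Q12 by auto
      finally show "R - {v} \<subseteq> (\<Union>q \<in> set (Q1 @ [?A, ?B, ?C] @ Q2). set q)"
        using Q by (auto simp: covers_def)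
    qed
  qed
  ultimately show ?thesis using that by blast
qed

text \<open>Attaching \<open>v\<close> to \<open>u\<close> inserts the detour \<open>u, v, u\<close> into the closed walk traversing a tree twice;
  \<open>c\<close> are the positions of first visits on this walk, \<open>rk\<close> orders them.\<close>

lemma insert_position:
  assumes T: "T \<subseteq> V" "u \<in> T" "v \<in> V"
    and rk: "\<And>a b. a \<in> T \<Longrightarrow> b \<in> T \<Longrightarrow> rk a \<le> rk b \<Longrightarrow> c a + d a b \<le> c b"
    and rk': "\<And>a. a \<in> T \<Longrightarrow> rk' a = (if rk a \<le> rk u then rk a else Suc (rk a))" "rk' v = Suc (rk u :: nat)"
    and c': "\<And>a. a \<in> T \<Longrightarrow> c' a = (if rk a \<le> rk u then c a else c a + 2 * d u v)"
      "c' v = c u + d u v"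
    and ab: "a \<in> insert v T" "b \<in> insert v T" "rk' a \<le> rk' b" and v: "v \<notin> T"
  shows "c' a + d a b \<le> c' b"
proof -
  have u: "u \<in> V" using T by auto
  consider "a = v" "b = v" | "a = v" "b \<in> T" | "a \<in> T" "b = v" | "a \<in> T" "b \<in> T"
    using ab by auto
  then show ?thesis
  proof cases
    case 1 then show ?thesis using d_diag T(3) by simp
  next
    case 2
    then have b: "\<not> rk b \<le> rk u" "b \<in> V" using ab(3) rk' T(1) by (auto split: if_splits)
    then have "c u + d u b \<le> c b" using rk[OF T(2) 2(2)] by simp
    \<comment> \<open>The way back from \<open>v\<close> costs \<open>d u v\<close> again; with the
      way out this is exactly the shift of everything ranked after \<open>u\<close>.\<close>
    moreover have "d v b \<le> d u v + d u b" using d_tri[of v u b] d_sym[of u v] u b T(3) by simp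
    ultimately show ?thesis using 2 b c' by simp
  next
    case 3
    then have a: "rk a \<le> rk u" "a \<in> V" using ab(3) rk' T(1) by (auto split: if_splits)
    then have "c a + d a u \<le> c u" using rk[OF 3(1) T(2)] by simp
    moreover have "d a v \<le> d a u + d u v" using d_tri[of a u v] u a T(3) by simp
    ultimately show ?thesis using 3 a c' by simp
  next
    case 4
    then have "rk a \<le> rk b" using ab(3) rk' by (auto split: if_splits)
    then show ?thesis using rk[OF 4] c'(1)[OF 4(1)] c'(1)[OF 4(2)] by (auto split: if_splits)
  qed
qed

end


section \<open>Hop-bounded distances\<close>

text \<open>\<open>big\<close> marks a missing edge. It exceeds the cost of every simple path, which
  has fewer than \<open>N\<close> arcs, so a computed value below \<open>big\<close> certifies a
  genuine walk. The zero diagonal allows waiting at a vertex.\<close>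

locale int_weighted_graph = pair_graph G for G :: "nat pair_pre_digraph" +
  fixes n N :: nat and w :: "nat \<Rightarrow> nat \<Rightarrow> nat" and big :: nat
  assumes N: "N = Suc n"
    and verts: "pverts G = {..<N}"
    and big_pos: "0 < big"
    and conn: "Digraph_Component.connected (with_proj G)"
    and w_diag: "w u u = 0"
    and w_sym: "(u, v) \<in> parcs G \<Longrightarrow> w u v = w v u"
    and w_small: "(u, v) \<in> parcs G \<Longrightarrow> N * w u v < big"
    and w_big: "u \<noteq> v \<Longrightarrow> (u, v) \<notin> parcs G \<Longrightarrow> w u v = big"
begin

abbreviation walk_cost :: "(nat \<times> nat) list \<Rightarrow> nat" where
  "walk_cost p \<equiv> (\<Sum>(u, v)\<leftarrow>p. w u v)"

text \<open>The Bellman-Ford recursion for all pairs. Since waiting is free, \<open>k\<close> bounds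
  the number of arcs instead of fixing it. Splitting off the first arc makes the minimising
  \<open>x\<close> the next hop of a cheapest walk.\<close>

primrec sp :: "nat \<Rightarrow> nat \<Rightarrow> nat \<Rightarrow> nat" where
  "sp 0 u v = (if u = v then 0 else big)"
| "sp (Suc k) u v = (MIN x \<in> {..<N}. w u x + sp k x v)"

lemma sp_Suc_le: "x < N \<Longrightarrow> sp (Suc k) u v \<le> w u x + sp k x v"
  by simp

lemma sp_SucE:
  obtains x where "x < N" "sp (Suc k) u v = w u x + sp k x v"
proof -
  have "sp (Suc k) u v \<in> (\<lambda>x. w u x + sp k x v) ` {..<N}"
    unfolding sp.simps by (rule Min_in) (auto simp: N lessThan_empty_iff)
  then show ?thesis using that by auto
qed

lemma sp_SucI:
  assumes "x < N" "\<And>y. y < N \<Longrightarrow> w u x + sp k x v \<le> w u y + sp k y v"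
  shows "sp (Suc k) u v = w u x + sp k x v"
  unfolding sp.simps using assms by (intro Min_eqI) auto

lemma sp_mono: "u < N \<Longrightarrow> sp (Suc k) u v \<le> sp k u v"
  using sp_Suc_le[of u k u v] by (simp add: w_diag)

lemma sp_le_big: "u < N \<Longrightarrow> sp k u v \<le> big"
proof (induction k)
  case (Suc k) then show ?case using sp_mono[of u k v] by linarith
qed simp

lemma sp_diag: "u < N \<Longrightarrow> sp k u u = 0"
proof (induction k)
  case (Suc k) then show ?case using sp_mono[of u k u] by linarith
qed simp

lemma arc_less: "(u, v) \<in> parcs G \<Longrightarrow> u < N \<and> v < N"
  using in_arcsD1 in_arcsD2 verts by fastforce

lemma arcI: "w u v < big \<Longrightarrow> u \<noteq> v \<Longrightarrow> (u, v) \<in> parcs G"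
  using w_big by fastforce

lemma sp_le_walk_cost: "awalk u p v \<Longrightarrow> length p \<le> k \<Longrightarrow> sp k u v \<le> walk_cost p"
proof (induction p arbitrary: u k)
  case Nil
  then show ?case by (auto simp: awalk_Nil_iff verts sp_diag)
next
  case (Cons e p)
  obtain k' where k: "k = Suc k'" using Cons.prems by (cases k) auto
  obtain x where e: "e = (u, x)" "awalk x p v" "(u, x) \<in> parcs G"
    using Cons.prems by (cases e) (auto simp: awalk_Cons_iff)
  have "sp k u v \<le> w u x + sp k' x v" unfolding k using e arc_less by (intro sp_Suc_le) auto
  then show ?case using Cons.IH[OF e(2), of k'] Cons.prems k e by auto
qed

text \<open>A step with \<open>x = u\<close> is a wait and is dropped; any other step costs less
  than \<open>big\<close> and so is an arc.\<close>

lemma sp_walk: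
  assumes "u < N" "v < N" "sp k u v < big"
  obtains p where "awalk u p v" "walk_cost p = sp k u v"
proof -
  have "\<exists>p. awalk u p v \<and> walk_cost p = sp k u v"
    using assms
  proof (induction k arbitrary: u)
    case 0
    then show ?case by (intro exI[of _ "[]"]) (auto simp: awalk_Nil_iff verts split: if_splits)
  next
    case (Suc k)
    obtain x where x: "x < N" "sp (Suc k) u v = w u x + sp k x v" by (rule sp_SucE)
    then obtain p where p: "awalk x p v" "walk_cost p = sp k x v" using Suc by fastforce
    show ?case
    proof (cases "x = u")
      case True then show ?thesis using p x w_diag by auto
    next
      case False
      then have "(u, x) \<in> parcs G" using x Suc.prems by (intro arcI) auto
      then show ?thesis using p x by (intro exI[of _ "(u, x) # p"]) (auto simp: awalk_Cons_iff)
    qed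
  qed
  then show ?thesis using that by blast
qed

definition dist :: "nat \<Rightarrow> nat \<Rightarrow> nat" where
  "dist = sp N"

text \<open>Removing a cycle does not increase the cost, and a walk without repeated vertices has
  fewer than \<open>N\<close> arcs.\<close>

lemma dist_le_walk_cost: "awalk u p v \<Longrightarrow> dist u v \<le> walk_cost p"
proof (induction "length p" arbitrary: p rule: less_induct)
  case less
  show ?case
  proof (cases "distinct (pawalk_verts u p)")
    case True
    then have "apath u p v" using less.prems by (simp add: apath_def)
    then have "length p < card (pverts G)" by (rule length_apath_less)
    then show ?thesis using less.prems by (auto simp: verts dist_def intro: sp_le_walk_cost)
  next
    case False
    then obtain q r s where p: "p = q @ r @ s" and "\<exists>x. awalk u q x \<and> awalk x r x \<and> awalk x s v" "r \<noteq> []"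
      using awalk_not_distinct_decomp[OF less.prems] by blast
    then have "awalk u (q @ s) v" by (auto intro: awalk_appendI)
    then show ?thesis using less.hyps[of "q @ s"] \<open>r \<noteq> []\<close> by (simp add: p)
  qed
qed

lemma dist_less_big:
  assumes "u < N" "v < N"
  shows "dist u v < big"
proof -
  have "strongly_connected (with_proj G)"
    using symmetric_connected_imp_strongly_connected sym_arcs conn by blast
  then have "u \<rightarrow>\<^sup>*\<^bsub>with_proj G\<^esub> v" using assms verts by (auto simp: strongly_connected_def)
  then obtain p where p: "apath u p v" using reachable_apath by blast
  then have aw: "awalk u p v" by (simp add: apath_def)
  have len: "length p < N" using length_apath_less[OF p] by (simp add: verts)
  \<comment> \<open>Sums the integer form \<open>N * w x y + 1 \<le> big\<close> over the arcs; in
    this form the claim includes the empty walk.\<close>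
  have "N * walk_cost p + length p \<le> length p * big"
  proof -
    have "set p \<subseteq> parcs G" using aw by auto
    then show ?thesis
    proof (induction p)
      case (Cons e p)
      obtain x y where e: "e = (x, y)" by (cases e)
      then have "N * w x y < big" using w_small[of x y] Cons.prems by auto
      then show ?case using Cons e by (simp add: algebra_simps)
    qed simp
  qed
  then have "N * walk_cost p \<le> length p * big" by simp
  also have "\<dots> < N * big" using len big_pos by simp
  finally have "walk_cost p < big" by simp
  then show ?thesis using dist_le_walk_cost[OF aw] by simp
qed

lemma dist_walk:
  assumes "u < N" "v < N"
  obtains p where "awalk u p v" "walk_cost p = dist u v"
  using sp_walk[of u v N] dist_less_big[OF assms] assms by (metis dist_def)

lemma walk_cost_rev: "set p \<subseteq> parcs G \<Longrightarrow> walk_cost (rev_path p) = walk_cost p"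
  by (induction p) (auto dest: w_sym)

lemma dist_sym_le: "u < N \<Longrightarrow> v < N \<Longrightarrow> dist u v \<le> dist v u"
proof -
  assume uv: "u < N" "v < N"
  obtain p where p: "awalk v p u" "walk_cost p = dist v u" using dist_walk uv by metis
  then have "set p \<subseteq> parcs G" by auto
  then show ?thesis using dist_le_walk_cost[of u "rev_path p" v] p walk_cost_rev by simp
qed

sublocale dist: fin_metric "{..<N}" dist
proof
  fix x y z assume x: "x \<in> {..<N}"
  show "dist x x = 0" using x by (simp add: dist_def sp_diag)
  assume y: "y \<in> {..<N}"
  show "dist x y = dist y x" using dist_sym_le x y by (meson lessThan_iff order_antisym)
  assume z: "z \<in> {..<N}"
  obtain p q where "awalk x p y" "walk_cost p = dist x y" "awalk y q z" "walk_cost q = dist y z"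
    using dist_walk x y z by (metis lessThan_iff)
  then show "dist x z \<le> dist x y + dist y z"
    using dist_le_walk_cost[of x "p @ q" z] awalk_appendI by fastforce
qed

lemma path_cost_awalk_verts: "awalk u p v \<Longrightarrow> path_cost dist (pawalk_verts u p) \<le> walk_cost p"
proof (induction p arbitrary: u)
  case (Cons e p)
  obtain x where e: "e = (u, x)" "awalk x p v" "(u, x) \<in> parcs G"
    using Cons.prems by (cases e) (auto simp: awalk_Cons_iff)
  have "dist u x \<le> walk_cost [e]" using e arc_less
    by (intro dist_le_walk_cost) (auto simp: awalk_simps verts)
  moreover have "\<exists>zs. pawalk_verts x p = x # zs"
    using e(2) by (cases p) (auto simp: awalk_Cons_iff)
  ultimately show ?case using Cons.IH[OF e(2)] e by auto
qed auto

end

section \<open>The program\<close>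

abbreviation (input) aN :: nat where "aN \<equiv> 2"
abbreviation (input) aNN :: nat where "aNN \<equiv> 3"
abbreviation (input) aD :: nat where "aD \<equiv> 4"
abbreviation (input) aS :: nat where "aS \<equiv> 5"
abbreviation (input) aBig :: nat where "aBig \<equiv> 6"
abbreviation (input) aW :: nat where "aW \<equiv> 7"
abbreviation (input) aDist :: nat where "aDist \<equiv> 8"
abbreviation (input) aHop :: nat where "aHop \<equiv> 9"
abbreviation (input) aQ :: nat where "aQ \<equiv> 10"
abbreviation (input) aP :: nat where "aP \<equiv> 11"
abbreviation (input) ap :: nat where "ap \<equiv> 12"
abbreviation (input) aIn :: nat where "aIn \<equiv> 13"
abbreviation (input) aRank :: nat where "aRank \<equiv> 14"
abbreviation (input) aPos :: nat where "aPos \<equiv> 15"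
abbreviation (input) aGroup :: nat where "aGroup \<equiv> 16"
abbreviation (input) aLen :: nat where "aLen \<equiv> 17"
abbreviation (input) au :: nat where "au \<equiv> 18"
abbreviation (input) av :: nat where "av \<equiv> 19"
abbreviation (input) adelta :: nat where "adelta \<equiv> 20"
abbreviation (input) acur :: nat where "acur \<equiv> 21"
abbreviation (input) aT :: nat where "aT \<equiv> 22"
abbreviation (input) aTail :: nat where "aTail \<equiv> 23"
abbreviation (input) aHead :: nat where "aHead \<equiv> 24"
abbreviation (input) aC :: nat where "aC \<equiv> 25"
abbreviation (input) aJ :: nat where "aJ \<equiv> 26"
abbreviation (input) aq :: nat where "aq \<equiv> 27"
abbreviation (input) ax :: nat where "ax \<equiv> 28"
abbreviation (input) i1 :: nat where "i1 \<equiv> 29"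
abbreviation (input) i2 :: nat where "i2 \<equiv> 30"
abbreviation (input) i3 :: nat where "i3 \<equiv> 31"

text \<open>The first \<open>N\<close> input cells hold \<open>n\<close> and the turnover times;
  three cells per pair of vertices follow, with \<open>i1\<close> as flat index of the pair.\<close>

abbreviation entry :: "nat \<Rightarrow> expr" where
  "entry j \<equiv> Cell 0 (Var aN +. Num 3 *. Var i1 +. Num j)"

definition scale_loop :: com where
  "scale_loop = For i1 (Var aNN)
     (When (entry 0) (Set aD (Var aD *. entry 2)) ;;
      Set aS (Var aS +. entry 1))"

definition weight_loop :: com where
  "weight_loop = For i1 (Var aNN)
     (Cond (Var i1 /. Var aN =. Var i1 %. Var aN)
       (Assign aW (Var i1) (Num 0) ;; Assign aDist (Var i1) (Num 0))
       (Assign aDist (Var i1) (Var aBig) ;;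
        Cond (entry 0)
          (Assign aW (Var i1) (entry 1 *. (Var aD /. entry 2)))
          (Assign aW (Var i1) (Var aBig))))"

text \<open>\<open>aD\<close> is the product of all denominators and \<open>aS\<close> the sum of
  all numerators. A scaled weight is at most \<open>D * S\<close>, so one more than
  \<open>N * D * S\<close> can serve as the mark of a missing edge.\<close>

definition init :: com where
  "init =
     Set aN (Cell 0 (Num 0) +. Num 1) ;; Set aNN (Var aN *. Var aN) ;;
     Set aD (Num 1) ;; Set aS (Num 0) ;; scale_loop ;;
     Set aBig (Num 1 +. Var aN *. Var aD *. Var aS) ;; weight_loop"

text \<open>For \<open>i1 = k * (N * N) + u * N + v\<close> this is the cost of stepping from
  \<open>u\<close> to \<open>x\<close> and going on to \<open>v\<close> with at most
  \<open>k\<close> arcs. The minimum belongs to layer \<open>k + 1\<close>, hence the offset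
  \<open>aNN\<close> in the assignments of \<open>distances\<close>.\<close>

abbreviation hop_cost :: "expr \<Rightarrow> expr" where
  "hop_cost x \<equiv> Cell aW (Var i1 %. Var aNN /. Var aN *. Var aN +. x)
     +. Cell aDist (Var i1 /. Var aNN *. Var aNN +. x *. Var aN +. Var i1 %. Var aN)"

definition distances :: com where
  "distances = For i1 (Var aN *. Var aNN)
     (Set ax (Num 0) ;;
      For i2 (Var aN) (When (hop_cost (Var i2) <. hop_cost (Var ax)) (Set ax (Var i2))) ;;
      Assign aHop (Var aNN +. Var i1) (Var ax) ;;
      Assign aDist (Var aNN +. Var i1) (hop_cost (Var ax)))"

text \<open>Cell 0 of the input holds \<open>n\<close>, so that the rounded value for the depot is the period.
  It is then reset to 0, which keeps the depot out of all classes.\<close>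

definition turnovers :: com where
  "turnovers = For i1 (Var aN)
     (Set aq (Num 1) ;;
      For i2 (Var aN)
        (When (Num 2 *. Var aq <. Cell 0 (Var i1) +. Num 1 &. Num 2 *. Var aq <. Var aN)
          (Set aq (Num 2 *. Var aq))) ;;
      Assign aQ (Var i1) (Var aq)) ;;
   Set aP (Cell aQ (Num 0)) ;; Assign aQ (Num 0) (Num 0)"

abbreviation dist_expr :: "expr \<Rightarrow> expr \<Rightarrow> expr" where
  "dist_expr u v \<equiv> Cell aDist (Var aN *. Var aNN +. u *. Var aN +. v)"

text \<open>A vertex \<open>v\<close> is in the tree of class \<open>p\<close> iff \<open>aIn[v] = p\<close>; no reset between classes is needed.
  The value 0 of \<open>av\<close> means that no candidate has been found.\<close>

definition nearest :: com where
  "nearest = Set av (Num 0) ;; For i3 (Var aNN)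
     (When (Cell aIn (Var i3 /. Var aN) =. Var ap &. Cell aQ (Var i3 %. Var aN) =. Var ap &.
          (~. (Cell aIn (Var i3 %. Var aN) =. Var ap)) &.
          ((Var av =. Num 0) |. dist_expr (Var i3 /. Var aN) (Var i3 %. Var aN) <. dist_expr (Var au) (Var av)))
        (Set au (Var i3 /. Var aN) ;; Set av (Var i3 %. Var aN)))"

definition shift :: com where
  "shift = For i3 (Var aN)
     (When (Cell aIn (Var i3) =. Var ap &. Cell aRank (Var au) <. Cell aRank (Var i3))
        (Assign aRank (Var i3) (Cell aRank (Var i3) +. Num 1) ;;
         Assign aPos (Var i3) (Cell aPos (Var i3) +. Num 2 *. Var adelta)))"

text \<open>Executed \<open>N\<close> times for every class, whatever its size; a round without a
  candidate is idle.\<close>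

definition attach :: com where
  "attach = nearest ;;
     When (Var av)
       (Set adelta (dist_expr (Var au) (Var av)) ;; shift ;;
        Assign aRank (Var av) (Cell aRank (Var au) +. Num 1) ;;
        Assign aPos (Var av) (Cell aPos (Var au) +. Var adelta) ;;
        Assign aIn (Var av) (Var ap) ;;
        Set aLen (Var aLen +. Num 2 *. Var adelta))"

text \<open>The added 1 keeps the divisor positive and the group of the last position below
  \<open>p\<close>.\<close>

definition assign_groups :: com where
  "assign_groups = For i2 (Var aN)
     (When (Cell aQ (Var i2) =. Var ap)
       (Assign aGroup (Var i2) (Cell aPos (Var i2) *. Var ap /. (Var aLen +. Num 1))))"

text \<open>All \<open>p\<close> up to \<open>n\<close> are tried; if \<open>p\<close> is not a
  power of two, the class is empty and its rounds are idle.\<close>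

definition classes :: com where
  "classes = For i1 (Cell 0 (Num 0))
     (Set ap (Var i1 +. Num 1) ;;
      Assign aIn (Num 0) (Var ap) ;; Assign aRank (Num 0) (Num 0) ;; Assign aPos (Num 0) (Num 0) ;;
      Set aLen (Num 0) ;; For i2 (Var aN) attach ;; assign_groups)"

text \<open>Follows the next hops down through the layers \<open>N\<close> to 1. A hop to the
  current vertex is a wait and contributes no arc.\<close>

definition go_to :: com where
  "go_to = For i2 (Var aN)
     (Set ax (Cell aHop ((Var aN -. Var i2) *. Var aNN +. Var acur *. Var aN +. Var av)) ;;
      When (~. (Var ax =. Var acur))
        (Assign aTail (Var aT) (Var acur) ;; Assign aHead (Var aT) (Var ax) ;;
         Set aT (Var aT +. Num 1) ;; Set acur (Var ax)))"

text \<open>The loop index runs through the triples \<open>(p - 1, rank, v)\<close> in lexicographic order, so that the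
  clients of a day are met class by class, and within a class along the closed walk.\<close>

definition stops :: com where
  "stops = For i3 (Var aN *. Var aNN)
     (Set av (Var i3 %. Var aN) ;;
      When (Cell aQ (Var av) =. Var i3 /. Var aNN +. Num 1 &.
          Cell aRank (Var av) =. Var i3 /. Var aN %. Var aN &.
          Var i1 %. Cell aQ (Var av) =. Cell aGroup (Var av))
        (go_to ;; Assign aJ (Var aC) (Var av) ;; Set aC (Var aC +. Num 1)))"

definition write_day :: com where
  "write_day = Write (Var aT) ;;
     For i3 (Var aT) (Write (Cell aTail (Var i3)) ;; Write (Cell aHead (Var i3))) ;;
     Write (Var aC) ;; For i3 (Var aC) (Write (Cell aJ (Var i3)))"

definition day :: com where
  "day = Set acur (Num 0) ;; Set aT (Num 0) ;; Set aC (Num 0) ;; stops ;;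
     Set av (Num 0) ;; go_to ;; write_day"

definition algorithm :: com where
  "algorithm = init ;; distances ;; turnovers ;; classes ;; Write (Var aP) ;; For i1 (Var aP) day"


section \<open>Verification of the program\<close>

text \<open>\<open>N * N * N * N + N\<close> bounds the length of a stored tour: at most
  \<open>N\<close> arcs in each of the \<open>N * N * N\<close> rounds of \<open>stops\<close>, and
  \<open>N\<close> for the return to the depot. All other loop limits are smaller or equal.\<close>

locale resources =
  fixes n N K B :: nat
  assumes N: "N = Suc n" and K: "N * N * N * N + N \<le> K" and KB: "K < 2 ^ B"
begin

lemma K_ge: "N \<le> K" "N * N \<le> K" "N * N * N \<le> K" "N * N * N * N \<le> K"
proof -
  have "1 \<le> N * N" "1 \<le> N" unfolding N by simp_all
  then have "N * N * 1 \<le> N * N * (N * N)" "N * N * N * 1 \<le> N * N * N * N"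
    by (intro mult_le_mono order_refl; simp)+
  then show "N \<le> K" "N * N \<le> K" "N * N * N \<le> K" "N * N * N * N \<le> K"
    using K by (metis add_leE order_trans mult.assoc mult_1_right)+
qed

lemma B_pos: "1 \<le> B"
proof (cases B)
  case 0
  then show ?thesis using K KB N by simp
qed simp

lemma less_B: "x \<le> K \<Longrightarrow> x < 2 ^ B"
  using KB by simp

lemma N_pos: "0 < N" using N by simp

lemma idx_less: "u < N \<Longrightarrow> v < N \<Longrightarrow> u * N + v < N * N"
proof -
  assume "u < N" "v < N"
  then have "u * N + v < u * N + N" by simp
  also have "\<dots> = Suc u * N" by simp
  also have "\<dots> \<le> N * N" using \<open>u < N\<close> by (intro mult_le_mono1) auto
  finally show ?thesis .
qed

lemma idx_div_mod: "v < N \<Longrightarrow> (u * N + v) div N = u" "v < N \<Longrightarrow> (u * N + v) mod N = v"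
  using N_pos by auto

lemma div_less: "e < N * N \<Longrightarrow> e div N < N"
  by (simp add: less_mult_imp_div_less)

end

section \<open>Scaling the weights to integers\<close>

locale scaling = resources +
  fixes A :: "nat \<Rightarrow> nat" and M :: nat
  assumes A0: "A 0 = n" and A_less: "A i < M"
    and prod_less: "M ^ (N * N) < 2 ^ B" and sum_less: "N * N * M < 2 ^ B"
begin

definition scale :: "nat \<Rightarrow> nat" where
  "scale h = (\<Prod>e<h. if A (N + 3 * e) \<noteq> 0 then A (N + 3 * e + 2) else 1)"

definition num_sum :: "nat \<Rightarrow> nat" where
  "num_sum h = (\<Sum>e<h. A (N + 3 * e + 1))"

definition large :: nat where
  "large = 1 + N * scale (N * N) * num_sum (N * N)"

definition flat_weight :: "nat \<Rightarrow> nat" where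
  "flat_weight e = (if e div N = e mod N then 0
     else if A (N + 3 * e) \<noteq> 0 then A (N + 3 * e + 1) * (scale (N * N) div A (N + 3 * e + 2))
     else large)"

lemma M_pos: "1 \<le> M" using A_less[of 0] by simp

lemma scale_le: "h \<le> N * N \<Longrightarrow> scale h \<le> M ^ (N * N)"
proof -
  assume h: "h \<le> N * N"
  have "scale h \<le> (\<Prod>e<h. M)" unfolding scale_def
    by (rule prod_mono) (use A_less M_pos in \<open>auto simp: less_imp_le\<close>)
  also have "\<dots> = M ^ h" by simp
  also have "\<dots> \<le> M ^ (N * N)" using h M_pos by (rule power_increasing)
  finally show ?thesis .
qed

lemma scale_less: "h \<le> N * N \<Longrightarrow> scale h < 2 ^ B"
  using scale_le prod_less by (meson le_less_trans)

lemma num_sum_le: "h \<le> N * N \<Longrightarrow> num_sum h \<le> N * N * M"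
proof -
  assume h: "h \<le> N * N"
  have "num_sum h \<le> (\<Sum>e<h. M)" unfolding num_sum_def
    by (rule sum_mono) (use A_less in \<open>auto simp: less_imp_le\<close>)
  also have "\<dots> \<le> N * N * M" using h by simp
  finally show ?thesis .
qed

lemma num_le_sum: "e < N * N \<Longrightarrow> A (N + 3 * e + 1) \<le> num_sum (N * N)"
  unfolding num_sum_def by (rule member_le_sum) auto

lemma flat_weight_le: "e < N * N \<Longrightarrow> flat_weight e \<le> large"
proof -
  assume e: "e < N * N"
  have "A (N + 3 * e + 1) * (scale (N * N) div A (N + 3 * e + 2)) \<le> num_sum (N * N) * scale (N * N)"
    using num_le_sum[OF e] by (intro mult_le_mono) auto
  also have "\<dots> \<le> N * (num_sum (N * N) * scale (N * N))" using N_pos by simp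
  finally show ?thesis by (auto simp: flat_weight_def large_def algebra_simps)
qed

lemma scale_loop:
  assumes "m 0 = A" "m aN 0 = N" "m aNN 0 = N * N" "m aD 0 = 1" "m aS 0 = 0"
  shows "wp K B scale_loop (\<lambda>(m', out'). m' aD 0 = scale (N * N) \<and> m' aS 0 = num_sum (N * N)) (m, out)"
  unfolding scale_loop_def
proof (rule wp_For[where I = "\<lambda>h m out. m aD 0 = scale h \<and> m aS 0 = num_sum h" and h = "N * N", OF B_pos])
  fix h m' out'
  assume h: "h < N * N" and I: "m' aD 0 = scale h \<and> m' aS 0 = num_sum h" and i: "m' i1 0 = h"
    and f: "frame (For i1 (Var aNN) (When (entry 0) (Set aD (Var aD *. entry 2)) ;;
      Set aS (Var aS +. entry 1))) (m, out) (m', out')"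
  have m: "m' 0 = A" "m' aN 0 = N" using assms frameD[OF f, of 0] frameD[OF f, of aN] by auto
  have l: "scale (Suc h) < 2 ^ B" "num_sum (Suc h) < 2 ^ B"
    using h scale_less[of "Suc h"] num_sum_le[of "Suc h"] sum_less by auto
  show "wp K B (When (entry 0) (Set aD (Var aD *. entry 2)) ;; Set aS (Var aS +. entry 1))
    (\<lambda>(m', out'). m' aD 0 = scale (Suc h) \<and> m' aS 0 = num_sum (Suc h)) (m', out')"
    by (intro wp_Seq wp_Cond wp_Assign wp_Skip B_pos)
      (use l in \<open>auto simp: scale_def num_sum_def I i m\<close>)
qed (auto simp: scale_def num_sum_def K_ge less_B assms frame_def)

lemma weight_loop:
  assumes "m 0 = A" "m aN 0 = N" "m aNN 0 = N * N" "m aD 0 = scale (N * N)" "m aBig 0 = large"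
    "large < 2 ^ B"
  shows "wp K B weight_loop (\<lambda>(m', out'). \<forall>e < N * N. m' aW e = flat_weight e \<and>
      m' aDist e = (if e div N = e mod N then 0 else large)) (m, out)"
  unfolding weight_loop_def
proof (rule wp_For[where I = "\<lambda>h m out. \<forall>e < h. m aW e = flat_weight e \<and>
      m aDist e = (if e div N = e mod N then 0 else large)" and h = "N * N", OF B_pos], goal_cases)
  case (7 h m' out')
  note f = 7(4)
  have m: "m' 0 = A" "m' aN 0 = N" "m' aD 0 = scale (N * N)" "m' aBig 0 = large"
    using assms frameD[OF f, of 0] frameD[OF f, of aN] frameD[OF f, of aD] frameD[OF f, of aBig] by auto
  have l: "flat_weight h < 2 ^ B" using flat_weight_le[OF 7(1)] assms by simp
  show ?case
    by (intro wp_Seq wp_Cond wp_Assign wp_Skip B_pos)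
      (use 7(1) l in \<open>auto simp: minus_div_mult_eq_mod flat_weight_def less_Suc_eq 7(2,3) m assms(6)\<close>)
qed (auto simp: K_ge less_B assms frame_def)

lemma writes_init: "writes scale_loop = {i1, aD, aS}" "writes weight_loop = {i1, aW, aDist}"
  by (auto simp: scale_loop_def weight_loop_def)

lemma init:
  assumes "m 0 = A" "large < 2 ^ B"
  shows "wp K B init (\<lambda>(m', out'). m' aN 0 = N \<and> m' aNN 0 = N * N \<and>
      (\<forall>e < N * N. m' aW e = flat_weight e \<and>
      m' aDist e = (if e div N = e mod N then 0 else large))) (m, out)"
  unfolding init_def
proof (intro wp_Seq wp_Assign B_pos, goal_cases)
  case 5
  let ?m = "\<lambda>x y. m(aN := (m aN)(0 := x), aNN := (m aNN)(0 := y), aD := (m aD)(0 := 1), aS := (m aS)(0 := 0))"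
  show ?case
  proof (rule wp_mono_frame[OF scale_loop], goal_cases)
    case (6 s')
    obtain m' out' where s': "s' = (m', out')" by (cases s')
    note f = frameD[OF 6(2), unfolded writes_init s', simplified]
    have m: "m' 0 = A" "m' aN 0 = N" "m' aNN 0 = N * N"
      using f[of 0] f[of aN] f[of aNN] by (simp_all add: assms A0 N)
    have sums: "m' aD 0 = scale (N * N)" "m' aS 0 = num_sum (N * N)" using 6(1) s' by auto
    show ?case
      unfolding s'
    proof (intro wp_Seq wp_Assign B_pos, goal_cases)
      case 2
      show ?case
      proof (rule wp_mono_frame[OF weight_loop], goal_cases)
        case (7 s'')
        obtain m'' out'' where s'': "s'' = (m'', out'')" by (cases s'')
        note g = frameD[OF 7(2), unfolded writes_init s'', simplified]
        show ?case using 7(1) g[of aN] g[of aNN] by (auto simp: s'' m)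
      qed (use assms(2) in \<open>simp_all add: m sums large_def\<close>)
    qed (use assms(2) in \<open>simp add: m sums large_def\<close>)
  qed (simp_all add: assms A0 N)
qed (use less_B[OF K_ge(1)] less_B[OF K_ge(2)] power_increasing[of 1 B 2] B_pos in \<open>simp_all add: assms A0 N\<close>)

end

section \<open>All-pairs distances with next hops\<close>

locale phases = resources n N K B + int_weighted_graph G n N w big
  for n N K B :: nat and G :: "nat pair_pre_digraph" and w :: "nat \<Rightarrow> nat \<Rightarrow> nat" and big :: nat +
  fixes A :: "nat \<Rightarrow> nat"
  assumes A0: "A 0 = n" and big_less: "4 * N * big < 2 ^ B"
begin

lemma big_less_B: "big < 2 ^ B"
proof -
  have "1 * big \<le> 4 * N * big" using N_pos by (intro mult_le_mono1) simp
  then show ?thesis using big_less by linarith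
qed

definition flat_sp :: "nat \<Rightarrow> nat" where
  "flat_sp e = sp (e div (N * N)) (e mod (N * N) div N) (e mod N)"

lemma block_div_mod: "e < b \<Longrightarrow> (k * b + e) div b = k" "e < b \<Longrightarrow> (k * b + e) mod b = e"
  for e b k :: nat
  by auto

lemma one_less_B: "Suc 0 < 2 ^ B"
  using power_increasing[of 1 B "2::nat"] B_pos by simp

lemma flat_sp_idx:
  assumes "x < N" "v < N"
  shows "flat_sp (k * (N * N) + x * N + v) = sp k x v"
proof -
  have l: "x * N + v < N * N" using assms by (rule idx_less)
  have "(k * (N * N) + (x * N + v)) div (N * N) = k" "(k * (N * N) + (x * N + v)) mod (N * N) = x * N + v"
    using block_div_mod[OF l] by blast+
  moreover have "(k * (N * N) + x * N + v) mod N = v"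
    using assms by (metis add.assoc mod_mult_self3 mult.assoc mod_less distrib_right)
  ultimately show ?thesis using assms by (simp add: flat_sp_def add.assoc)
qed

lemma flat_sp_le: "flat_sp e \<le> big"
proof -
  have "e mod (N * N) < N * N" using N_pos by simp
  then show ?thesis unfolding flat_sp_def by (intro sp_le_big div_less)
qed

definition good_hop :: "nat \<Rightarrow> nat \<Rightarrow> bool" where
  "good_hop e x \<longleftrightarrow> x < N \<and>
     flat_sp (N * N + e) = w (e mod (N * N) div N) x + sp (e div (N * N)) x (e mod N)"

lemma writes_distances: "writes distances = {i1, ax, i2, aHop, aDist}"
  by (auto simp: distances_def)

text \<open>Layer 0 is already present. Round \<open>h\<close> fills cell \<open>N * N + h\<close>
  from cells of the preceding layer, all of which lie below that index.\<close>

lemma distances: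
  assumes m: "m aN 0 = N" "m aNN 0 = N * N" "\<forall>e < N * N. m aW e = w (e div N) (e mod N)"
    "\<forall>e < N * N. m aDist e = sp 0 (e div N) (e mod N)"
  shows "wp K B distances (\<lambda>(m', out').
      (\<forall>u < N. \<forall>v < N. m' aDist (N * (N * N) + u * N + v) = dist u v) \<and>
      (\<forall>k < N. \<forall>u < N. \<forall>v < N. m' aHop (Suc k * (N * N) + u * N + v) < N \<and>
         sp (Suc k) u v = w u (m' aHop (Suc k * (N * N) + u * N + v))
           + sp k (m' aHop (Suc k * (N * N) + u * N + v)) v)) (m, out)"
  unfolding distances_def
proof (rule wp_For[where I = "\<lambda>h m out. (\<forall>e < N * N + h. m aDist e = flat_sp e) \<and>
    (\<forall>e < h. good_hop e (m aHop (N * N + e)))" and h = "N * (N * N)", OF B_pos], goal_cases)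
  case 4
  then show ?case using m(4) by (auto simp: flat_sp_def mod_less div_less)
next
  case (7 h m' out')
  define k u v where "k = h div (N * N)" and "u = h mod (N * N) div N" and "v = h mod N"
  have m': "m' aN 0 = N" "m' aNN 0 = N * N" "m' aW = m aW"
    using 7(4) by (auto simp: frame_def m)
  have "h mod (N * N) < N * N" using N_pos by simp
  then have u: "u < N" unfolding u_def by (rule div_less)
  have v: "v < N" using N_pos by (simp add: v_def)
  \<comment> \<open>Stated for any later memory \<open>m''\<close> with the same tables, because the
    inner loop evaluates the expression both at its counter and at the best candidate so
    far.\<close>
  have cost: "expr_val (hop_cost e) m'' = w u x + sp k x v"
    if x: "x < N" "expr_val e m'' = x" and m'': "m'' i1 = m' i1" "m'' aN = m' aN" "m'' aNN = m' aNN"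
      "m'' aW = m' aW" "m'' aDist = m' aDist" for e x m''
  proof -
    have "k * (N * N) \<le> h" by (simp add: k_def)
    then have "k * (N * N) + x * N + v < N * N + h" using idx_less[OF x(1) v] by linarith
    then have "m' aDist (k * (N * N) + x * N + v) = sp k x v" using 7(2) flat_sp_idx[OF x(1) v] by simp
    moreover have "m aW (u * N + x) = w u x"
      using m(3) idx_less[OF u x(1)] idx_div_mod[OF x(1)] by simp
    moreover have "(h - k * (N * N)) div N = u" "h - h div N * N = v"
      by (simp_all add: k_def u_def v_def minus_div_mult_eq_mod)
    ultimately show ?thesis
      using m'' x(2) m' 7(3) by (simp add: k_def[symmetric])
  qed
  show ?case
  proof (intro wp_Seq wp_Assign B_pos, simp, rule wp_For[where I = "\<lambda>y m out. m ax 0 < N \<and>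
      (\<forall>z < y. w u (m ax 0) + sp k (m ax 0) v \<le> w u z + sp k z v)" and h = N, OF B_pos], goal_cases)
    case (7 y m2 out2)
    have m2: "m2 i1 = m' i1" "m2 aN = m' aN" "m2 aNN = m' aNN" "m2 aW = m' aW" "m2 aDist = m' aDist"
      using 7(4) by (auto simp: frame_def)
    note c = cost[OF _ _ m2]
    have "expr_val (hop_cost (Var i2)) m2 = w u y + sp k y v"
      by (rule c) (use 7 in auto)
    moreover have "expr_val (hop_cost (Var ax)) m2 = w u (m2 ax 0) + sp k (m2 ax 0) v"
      by (rule c) (use 7 in auto)
    ultimately show ?case
      by (intro wp_Cond wp_Assign wp_Skip B_pos)
        (use 7 less_B[OF K_ge(1)] in \<open>auto simp: less_Suc_eq simp del: expr_val.simps(3)\<close>)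
  next
    case (8 m2 out2)
    have m2: "m2 i1 = m' i1" "m2 aN = m' aN" "m2 aNN = m' aNN" "m2 aW = m' aW" "m2 aDist = m' aDist"
       "m2 aHop = m' aHop"
      using 8(2) by (auto simp: frame_def)
    have "expr_val (hop_cost (Var ax)) m2 = w u (m2 ax 0) + sp k (m2 ax 0) v"
      by (rule cost[OF _ _ m2(1-5)]) (use 8 in auto)
    moreover have s: "sp (Suc k) u v = w u (m2 ax 0) + sp k (m2 ax 0) v"
      by (rule sp_SucI) (use 8 in auto)
    moreover have f: "flat_sp (N * N + h) = sp (Suc k) u v"
      using N_pos by (simp add: flat_sp_def k_def u_def v_def)
    ultimately have e: "expr_val (hop_cost (Var ax)) m2 = flat_sp (N * N + h)" by simp
    have g: "good_hop h (m2 ax 0)" using 8(1) s f by (simp add: good_hop_def k_def u_def v_def)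
    have "expr_val (hop_cost (Var ax)) (m2(aHop := (m2 aHop)(N * N + h := m2 ax 0))) = flat_sp (N * N + h)"
      using e by simp
    then show ?case
      using 7(1-3) m' m2 8(1) g less_B[OF K_ge(1)] flat_sp_le[of "N * N + h"] big_less_B
      by (intro wp_Seq wp_Assign B_pos)
        (auto simp del: expr_val.simps(3) simp add: expr_val.simps(3)[of Add "Var aNN"] less_Suc_eq)
  qed (use m' less_B[OF K_ge(1)] K_ge(1) N_pos in \<open>auto simp: frame_def\<close>)
next
  case (8 m' out')
  have "m' aDist (N * (N * N) + u * N + v) = dist u v" if "u < N" "v < N" for u v
    using 8(1) flat_sp_idx[OF that, of N] idx_less[OF that] by (simp add: dist_def add.assoc)
  moreover have "m' aHop (Suc k * (N * N) + u * N + v) < N \<and>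
         sp (Suc k) u v = w u (m' aHop (Suc k * (N * N) + u * N + v))
           + sp k (m' aHop (Suc k * (N * N) + u * N + v)) v" if k: "k < N" and uv: "u < N" "v < N" for k u v
  proof -
    let ?e = "k * (N * N) + u * N + v"
    have "?e < Suc k * (N * N)" using idx_less[OF uv] by simp
    also have "\<dots> \<le> N * (N * N)" using k by (intro mult_le_mono1) simp
    finally have "good_hop ?e (m' aHop (N * N + ?e))" using 8(1) by blast
    moreover have "?e div (N * N) = k" "?e mod (N * N) = u * N + v"
      using block_div_mod[OF idx_less[OF uv]] by (simp_all add: add.assoc)
    moreover have "?e mod N = v"
      using uv by (metis add.assoc mod_mult_self3 mult.assoc mod_less distrib_right)
    moreover have "flat_sp (N * N + ?e) = sp (Suc k) u v"
      using flat_sp_idx[OF uv, of "Suc k"] by (simp add: add.assoc)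
    ultimately show ?thesis using idx_div_mod[OF uv(2), of u] by (simp add: good_hop_def add.assoc)
  qed
  ultimately show ?case by blast
qed (use m K_ge(3) less_B[of "N * (N * N)"] in \<open>auto simp: frame_def mult.assoc\<close>)

end

section \<open>Rounding the turnover times\<close>

context phases
begin

text \<open>The largest power of two below or equal to both \<open>t\<close> and \<open>n\<close>,
  or 1 if there is none, as for \<open>n = 0\<close>, where the schedule still has one day.\<close>

definition is_period :: "nat \<Rightarrow> nat \<Rightarrow> bool" where
  "is_period t q \<longleftrightarrow> (\<exists>l. q = 2 ^ l) \<and> (q = 1 \<or> q \<le> t \<and> q \<le> n) \<and> (t < 2 * q \<or> n < 2 * q)"

lemma writes_turnovers: "writes turnovers = {i1, aq, i2, aQ, aP}"
  by (auto simp: turnovers_def)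

lemma turnovers:
  assumes m: "m aN 0 = N" "m 0 = A"
  shows "wp K B turnovers (\<lambda>(m', out'). m' aQ 0 = 0 \<and> is_period n (m' aP 0) \<and>
      (\<forall>j \<in> {1..n}. is_period (A j) (m' aQ j))) (m, out)"
  unfolding turnovers_def
proof (rule wp_Seq, rule wp_For[where I = "\<lambda>h m out. \<forall>j < h. is_period (A j) (m aQ j) \<and> m aQ j < 2 ^ B" and h = N, OF B_pos], goal_cases)
  case (7 h m' out')
  have m': "m' aN 0 = N" "m' 0 = A" using 7(4) by (auto simp: frame_def m)
  show ?case
  proof (intro wp_Seq wp_Assign B_pos, simp add: one_less_B, rule wp_For[where I = "\<lambda>y m out. (\<exists>l. m aq 0 = 2 ^ l) \<and>
      (m aq 0 = 1 \<or> m aq 0 \<le> A h \<and> m aq 0 \<le> n) \<and> (2 ^ y \<le> m aq 0 \<or> A h < 2 * m aq 0 \<or> n < 2 * m aq 0)"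
        and h = N, OF B_pos], goal_cases)
    case 4
    then show ?case using power_0[of "2::nat"] by (auto intro: exI[of _ 0])
  next
    case (7 y m2 out2)
    have m2: "m2 aN 0 = N" "m2 0 = A" "m2 i1 0 = h" using 7(4) m' \<open>m' i1 0 = h\<close> by (auto simp: frame_def)
    obtain l where l: "m2 aq 0 = 2 ^ l" using 7(2) by blast
    have "2 * m2 aq 0 < 2 ^ B" if "2 * m2 aq 0 < N"
      using that less_B[OF K_ge(1)] by simp
    moreover have "\<exists>l'. 2 * m2 aq 0 = 2 ^ l'" using l by (intro exI[of _ "Suc l"]) simp
    ultimately show ?case
      by (intro wp_Cond wp_Assign wp_Skip B_pos) (use 7(2) in \<open>auto simp: m2 N\<close>)
  next
    case (8 m2 out2)
    have m2: "m2 i1 0 = h" "m2 aQ = m' aQ" using 8(2) \<open>m' i1 0 = h\<close> by (auto simp: frame_def)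
    \<comment> \<open>If all \<open>N\<close> rounds have doubled the value, it is at least
      \<open>2 ^ N\<close>, and \<open>n < 2 * q\<close> holds in this case as well; so
      \<open>N\<close> rounds are enough.\<close>
    have "n < 2 ^ N" using N by (metis Suc_lessD less_exp)
    then have p: "is_period (A h) (m2 aq 0)" using 8(1) by (auto simp: is_period_def)
    have "m2 aq 0 \<le> N" using 8(1) N by auto
    then have "m2 aq 0 < 2 ^ B" using less_B K_ge(1) by simp
    then show ?case using p 7(2) m2 by (intro wp_Assign B_pos) (auto simp: less_Suc_eq)
  qed (use m' less_B[OF K_ge(1)] K_ge(1) power_increasing[of 1 B "2::nat"] B_pos in \<open>auto simp: frame_def\<close>)
next
  case (8 m' out')
  then show ?case by (intro wp_Seq wp_Assign B_pos) (auto simp: A0 N)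
qed (use m K_ge(1) less_B[OF K_ge(1)] in \<open>auto simp: frame_def\<close>)

end

section \<open>Prim's algorithm on one class, and cutting the closed walk\<close>

locale clustering = phases +
  fixes q :: "nat \<Rightarrow> nat"
  assumes q0: "q 0 = 0"
begin

definition cl :: "nat \<Rightarrow> nat set" where
  "cl p = {v. v < N \<and> q v = p}"

definition ready :: "memory \<Rightarrow> bool" where
  "ready m \<longleftrightarrow> m aN 0 = N \<and> m aNN 0 = N * N \<and> m 0 = A \<and> m aQ = q \<and>
     (\<forall>u < N. \<forall>v < N. m aDist (N * (N * N) + u * N + v) = dist u v)"

lemma ready_cong:
  assumes "ready m" "m' aN = m aN" "m' aNN = m aNN" "m' 0 = m 0" "m' aQ = m aQ" "m' aDist = m aDist"
  shows "ready m'"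
  using assms by (simp add: ready_def)

lemma dist_le_big: "u < N \<Longrightarrow> dist u v \<le> big"
  unfolding dist_def by (rule sp_le_big)

definition reached :: "memory \<Rightarrow> nat \<Rightarrow> nat set" where
  "reached m p = {v. v < N \<and> m aIn v = p}"

lemma writes_nearest: "writes nearest = {i3, au, av}"
  by (auto simp: nearest_def)

lemma nearest:
  assumes r: "ready m" and p: "m ap 0 = p" "1 \<le> p" and 0: "0 \<in> reached m p"
  shows "wp K B nearest (\<lambda>(m', out').
     (m' av 0 = 0 \<and> cl p \<subseteq> reached m p) \<or>
     (m' av 0 \<noteq> 0 \<and> m' au 0 \<in> reached m p \<and> m' av 0 \<in> cl p - reached m p \<and>
       (\<forall>a \<in> reached m p. \<forall>b \<in> cl p - reached m p. dist (m' au 0) (m' av 0) \<le> dist a b))) (m, out)"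
proof -
  define cand where "cand = (\<lambda>e. e div N \<in> reached m p \<and> e mod N \<in> cl p - reached m p)"
  have cand_iff: "cand e \<longleftrightarrow> m aIn (e div N) = p \<and> q (e mod N) = p \<and> m aIn (e mod N) \<noteq> p"
    if "e < N * N" for e
    using div_less[OF that] N_pos by (auto simp: cand_def reached_def cl_def)
  \<comment> \<open>The depot has rounded value 0 and is in no class \<open>p \<ge> 1\<close>; this
    is what frees the value 0 to mean that nothing was found.\<close>
  have nz: "v \<noteq> 0" if "v \<in> cl p" for v using that p(2) q0 unfolding cl_def by (metis (mono_tags, lifting) mem_Collect_eq not_one_le_zero)
  define I where "I = (\<lambda>h (m' :: memory) (out' :: nat list). (m' av 0 = 0 \<and> (\<forall>e<h. \<not> cand e)) \<or>
     (m' av 0 \<noteq> 0 \<and> m' au 0 \<in> reached m p \<and> m' av 0 \<in> cl p - reached m p \<and>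
       (\<forall>e<h. cand e \<longrightarrow> dist (m' au 0) (m' av 0) \<le> dist (e div N) (e mod N))))"
  show ?thesis
    unfolding nearest_def
  proof (intro wp_Seq wp_Assign B_pos, simp, rule wp_For[where I = I and h = "N * N", OF B_pos], goal_cases)
    case (7 h m' out')
    have m': "m' aN 0 = N" "m' aNN 0 = N * N" "m' aQ = q" "m' aIn = m aIn" "m' ap 0 = p" "m' aDist = m aDist"
      using 7(4) r p by (auto simp: frame_def ready_def)
    have v: "h mod N < N" using N_pos by simp
    note u = div_less[OF 7(1)]
    have d1: "m aDist (N * (N * N) + h div N * N + h mod N) = dist (h div N) (h mod N)"
      using r u v unfolding ready_def by blast
    have d2: "m aDist (N * (N * N) + m' au 0 * N + m' av 0) = dist (m' au 0) (m' av 0)" if "m' av 0 \<noteq> 0"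
      using that 7(2) r by (auto simp: I_def ready_def reached_def cl_def)
    have bnd: "h div N < 2 ^ B" "h mod N < 2 ^ B" using u v less_B K_ge(1) by (meson le_trans less_imp_le)+
    show ?case
      apply (intro wp_Cond wp_Seq wp_Assign wp_Skip B_pos)
      subgoal using bnd by (simp add: m' 7)
      subgoal using bnd by (simp add: m' 7 minus_div_mult_eq_mod)
      subgoal premises prems
      proof -
        have c: "cand h" using prems by (simp add: m' 7 minus_div_mult_eq_mod cand_iff[OF 7(1)])
        have "m' av 0 \<noteq> 0 \<Longrightarrow> dist (h div N) (h mod N) < dist (m' au 0) (m' av 0)"
          using prems d1 d2 by (auto simp: m' 7 minus_div_mult_eq_mod)
        then show ?thesis using 7(2) c nz
          by (auto simp: I_def m' 7 minus_div_mult_eq_mod less_Suc_eq cand_def)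
      qed
      subgoal premises prems
      proof -
        have "cand h \<Longrightarrow> m' av 0 \<noteq> 0 \<and> dist (m' au 0) (m' av 0) \<le> dist (h div N) (h mod N)"
          using prems d1 d2 by (auto simp: m' 7 minus_div_mult_eq_mod cand_iff[OF 7(1)])
        then show ?thesis using 7(2) by (auto simp: I_def less_Suc_eq)
      qed
      done
  next
    case (8 m' out')
    have e: "cand (a * N + b) \<and> a * N + b < N * N \<and> (a * N + b) div N = a \<and> (a * N + b) mod N = b"
      if "a \<in> reached m p" "b \<in> cl p - reached m p" for a b
    proof -
      have "a < N" "b < N" using that by (auto simp: reached_def cl_def)
      then show ?thesis using that idx_less[of a b] idx_div_mod[of b a] by (simp add: cand_def)
    qed
    show ?case
      using 8(1) unfolding I_def
    proof (elim disjE conjE, goal_cases)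
      case 1
      then have "cl p \<subseteq> reached m p" using e[OF 0] by blast
      then show ?thesis using 1(1) by simp
    next
      case 2
      have "dist (m' au 0) (m' av 0) \<le> dist a b" if "a \<in> reached m p" "b \<in> cl p - reached m p" for a b
        using 2(4) e[OF that] by metis
      then show ?thesis using 2(1-3) by simp
    qed
  qed (use r in \<open>auto simp: ready_def I_def K_ge less_B frame_def\<close>)
qed

lemma writes_shift: "writes shift = {i3, aRank, aPos}"
  by (auto simp: shift_def)

lemma shift:
  assumes r: "ready m" and u: "m au 0 < N"
    and b: "\<And>w. w \<in> reached m (m ap 0) \<Longrightarrow> m aRank w \<le> N \<and> m aPos w + 2 * m adelta 0 < 2 ^ B"
  shows "wp K B shift (\<lambda>(m', out'). \<forall>w.
     m' aRank w = (if w \<in> reached m (m ap 0) \<and> m aRank (m au 0) < m aRank w then Suc (m aRank w) else m aRank w) \<and>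
     m' aPos w = (if w \<in> reached m (m ap 0) \<and> m aRank (m au 0) < m aRank w then m aPos w + 2 * m adelta 0 else m aPos w)) (m, out)"
proof -
  define c where "c = (\<lambda>h w. w < h \<and> m aIn w = m ap 0 \<and> m aRank (m au 0) < m aRank w)"
  define I where "I = (\<lambda>h (m' :: memory) (out' :: nat list). \<forall>w. m' aRank w = (if c h w then Suc (m aRank w) else m aRank w) \<and>
     m' aPos w = (if c h w then m aPos w + 2 * m adelta 0 else m aPos w))"
  have N1: "N + 1 \<le> K"
  proof -
    have "1 \<le> N * N * N * N" using N by simp
    then show ?thesis using K by linarith
  qed
  show ?thesis
    unfolding shift_def
  proof (rule wp_For[where I = I and h = N, OF B_pos], goal_cases)
    case (7 h m' out')
    have m': "m' aIn = m aIn" "m' ap = m ap" "m' au = m au" "m' adelta = m adelta"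
      using 7(4) by (auto simp: frame_def)
    have c: "c (Suc h) w \<longleftrightarrow> c h w \<or> w = h \<and> c (Suc h) h" for w by (auto simp: c_def less_Suc_eq)
    \<comment> \<open>Neither cell has been changed yet: index \<open>h\<close> is still to come,
      and \<open>u\<close> is not ranked after itself. So the guard may read the memory that the
      loop is modifying.\<close>
    have nc: "\<not> c h h" "\<not> c h (m au 0)" by (auto simp: c_def)
    have rk: "m' aRank h = m aRank h" "m' aPos h = m aPos h" "m' aRank (m au 0) = m aRank (m au 0)"
      using 7(2) nc by (auto simp: I_def)
    have "c (Suc h) h \<Longrightarrow> h \<in> reached m (m ap 0)" using 7(1) by (auto simp: c_def reached_def)
    then have bb: "c (Suc h) h \<Longrightarrow> Suc (m aRank h) < 2 ^ B \<and> m aPos h + 2 * m adelta 0 < 2 ^ B"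
      using b less_B N1 by (metis Suc_eq_plus1 add_le_mono1 le_trans)
    have cc: "c (Suc h) h \<longleftrightarrow> m aIn h = m ap 0 \<and> m aRank (m au 0) < m aRank h" by (simp add: c_def)
    show ?case
      apply (intro wp_Cond wp_Seq wp_Assign wp_Skip B_pos)
      subgoal using bb by (auto simp: 7 m' rk cc)
      subgoal using bb by (auto simp: 7 m' rk cc)
      subgoal premises prems
        using 7(2) c nc prems by (auto simp: I_def 7(3) m' rk cc)
      subgoal premises prems
        using 7(2) c nc prems by (auto simp: I_def 7(3) m' rk cc)
      done
  qed (use r in \<open>auto simp: ready_def K_ge less_B frame_def I_def c_def reached_def\<close>)
qed

text \<open>The clause on \<open>covers\<close> is the optimality argument: whatever cover the run
  is compared with, after paying for the walk built so far it still affords connecting the rest. The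
  alternative \<open>h < card\<close> measures progress while clients are missing.
  \<open>aIn \<le> p\<close> lets the next class start without clearing marks, and the last clause
  protects the results of earlier classes.\<close>

definition prim_inv :: "memory \<Rightarrow> nat \<Rightarrow> nat \<Rightarrow> memory \<Rightarrow> bool" where
  "prim_inv m0 p h m \<longleftrightarrow>
     ready m \<and> m ap 0 = p \<and> 0 \<in> reached m p \<and> reached m p \<subseteq> insert 0 (cl p) \<and>
     (\<forall>a \<in> reached m p. \<forall>b \<in> reached m p. m aRank a \<le> m aRank b \<longrightarrow> m aPos a + dist a b \<le> m aPos b) \<and>
     (\<forall>a \<in> reached m p. m aRank a < card (reached m p) \<and> m aPos a \<le> m aLen 0) \<and>
     m aLen 0 \<le> 2 * h * big \<and>
     (\<forall>Q. covers {..<N} {0} (cl p) Q \<longrightarrow>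
        (\<exists>Q'. covers (insert 0 (cl p)) (reached m p) (cl p - reached m p) Q' \<and>
           m aLen 0 + 2 * paths_cost dist Q' \<le> 2 * paths_cost dist Q)) \<and>
     (cl p \<subseteq> reached m p \<or> h < card (reached m p)) \<and>
     (\<forall>w. m aIn w \<le> p) \<and>
     (\<forall>w. w \<noteq> 0 \<and> q w \<noteq> p \<longrightarrow> m aRank w = m0 aRank w \<and> m aPos w = m0 aPos w)"

lemma prim_inv_loop_variable [simp]: "prim_inv m0 p h (m(i2 := f)) = prim_inv m0 p h m"
  by (simp add: prim_inv_def reached_def ready_def)

lemma reached_card: "finite (reached m p)" "card (reached m p) \<le> N"
proof -
  have s: "reached m p \<subseteq> {..<N}" by (auto simp: reached_def)
  then show "finite (reached m p)" by (rule finite_subset) simp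
  show "card (reached m p) \<le> N" using card_mono[OF _ s] by simp
qed

lemma writes_attach: "writes attach = {i3, au, av, adelta, aRank, aPos, aIn, aLen}"
  by (auto simp: attach_def writes_nearest writes_shift)

lemma attach:
  assumes I: "prim_inv m0 p h m" and p: "1 \<le> p" "p \<le> n" and h: "h < N"
  shows "wp K B attach (\<lambda>(m', out'). prim_inv m0 p (Suc h) m') (m, out)"
  unfolding attach_def
proof (rule wp_Seq, rule wp_mono_frame[OF nearest[where p = p]], goal_cases)
  case (5 s1)
  obtain m1 out1 where s1: "s1 = (m1, out1)" by (cases s1)
  note f1 = frameD[OF 5(2), unfolded writes_nearest s1, simplified]
  have m1: "m1 aN = m aN" "m1 aNN = m aNN" "m1 0 = m 0" "m1 aQ = m aQ" "m1 aDist = m aDist"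
    "m1 ap = m ap" "m1 aIn = m aIn" "m1 aRank = m aRank" "m1 aPos = m aPos" "m1 aLen = m aLen"
    by (simp_all add: f1)
  have r: "ready m" and mp: "m ap 0 = p" using I by (auto simp: prim_inv_def)
  have r1: "ready m1" by (rule ready_cong[OF r]) (simp_all add: m1)
  have re1: "reached m1 p = reached m p" by (simp add: reached_def m1)
  let ?T = "reached m p"
  show ?case
    unfolding s1
  proof (rule wp_Cond[OF B_pos])
    assume "\<not> holds (Var av) m1"
    then have "cl p \<subseteq> ?T" using 5(1) s1 by auto
    moreover have "2 * h * big \<le> 2 * Suc h * big" by simp
    ultimately have "prim_inv m0 p (Suc h) m1"
      using I r1 unfolding prim_inv_def re1 m1 by (meson order_trans)
    then show "wp K B Skip (\<lambda>(m', out'). prim_inv m0 p (Suc h) m') (m1, out1)"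
      by (intro wp_Skip) simp
  next
    assume nz: "holds (Var av) m1"
    define u v where "u = m1 au 0" and "v = m1 av 0"
    have uv: "v \<noteq> 0" "u \<in> ?T" "v \<in> cl p" "v \<notin> ?T"
      and min: "\<And>a b. a \<in> ?T \<Longrightarrow> b \<in> cl p - ?T \<Longrightarrow> dist u v \<le> dist a b"
      using 5(1) s1 nz by (auto simp: u_def v_def)
    have uvN: "u < N" "v < N" "q v = p" using uv by (auto simp: reached_def cl_def)
    have duv: "m1 aDist (N * (N * N) + u * N + v) = dist u v" using r1 uvN by (simp add: ready_def)
    let ?d = "dist u v"
    have d_big: "?d \<le> big" using uvN by (intro dist_le_big)
    have m1N: "m1 aN 0 = N" "m1 aNN 0 = N * N" using r1 by (auto simp: ready_def)
    let ?m2 = "m1(adelta := (m1 adelta)(0 := ?d))"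
    have re2: "reached ?m2 p = ?T" by (simp add: reached_def m1)
    have pos: "m aPos w \<le> m aLen 0" "m aRank w < card ?T" if "w \<in> ?T" for w
      using I that by (auto simp: prim_inv_def)
    have mono: "m aPos a + dist a b \<le> m aPos b" if "a \<in> ?T" "b \<in> ?T" "m aRank a \<le> m aRank b" for a b
      using I that unfolding prim_inv_def by blast
    \<comment> \<open>Each attachment lengthens the walk by at most \<open>2 * big\<close>, so
      positions stay within the reserve \<open>4 * N * big < 2 ^ B\<close>.\<close>
    have len: "m aLen 0 + 2 * ?d \<le> 2 * Suc h * big" using I d_big by (simp add: prim_inv_def)
    also have "\<dots> \<le> 4 * N * big" using h by (intro mult_le_mono1) simp
    finally have len_B: "m aLen 0 + 2 * ?d < 2 ^ B" using big_less by simp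
    have pB: "p < 2 ^ B" using p N K_ge(1) by (intro less_B) simp
    have NB: "N < 2 ^ B" using less_B K_ge(1) by simp
    show "wp K B (Set adelta (dist_expr (Var au) (Var av)) ;; shift ;;
        Assign aRank (Var av) (Cell aRank (Var au) +. Num 1) ;;
        Assign aPos (Var av) (Cell aPos (Var au) +. Var adelta) ;;
        Assign aIn (Var av) (Var ap) ;;
        Set aLen (Var aLen +. Num 2 *. Var adelta)) (\<lambda>(m', out'). prim_inv m0 p (Suc h) m') (m1, out1)"
    proof (rule wp_Seq, rule wp_Assign[OF B_pos], goal_cases)
      case 1
      then show ?case using d_big big_less_B by (simp add: m1N duv u_def[symmetric] v_def[symmetric])
    next
      case 2
      have "wp K B (shift ;;
        Assign aRank (Var av) (Cell aRank (Var au) +. Num 1) ;;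
        Assign aPos (Var av) (Cell aPos (Var au) +. Var adelta) ;;
        Assign aIn (Var av) (Var ap) ;;
        Set aLen (Var aLen +. Num 2 *. Var adelta)) (\<lambda>(m', out'). prim_inv m0 p (Suc h) m') (?m2, out1)"
      proof (rule wp_Seq, rule wp_mono_frame[OF shift], goal_cases)
        case 1 then show ?case by (rule ready_cong[OF r1]) simp_all
      next
        case 2 then show ?case using uvN by (simp add: u_def)
      next
        case (3 w)
        then have "w \<in> ?T" using re2 by (simp add: m1 mp)
        then show ?case using pos[of w] len_B reached_card(2)[of m p] by (simp add: m1)
      next
        case (4 s3)
        obtain m3 out3 where s3: "s3 = (m3, out3)" by (cases s3)
        note f3 = frameD[OF 4(2), unfolded writes_shift s3, simplified]
        have m3: "m3 aN = m aN" "m3 aNN = m aNN" "m3 0 = m 0" "m3 aQ = m aQ" "m3 aDist = m aDist"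
          "m3 ap 0 = p" "m3 aIn = m aIn" "m3 aLen = m aLen" "m3 au 0 = u" "m3 av 0 = v" "m3 adelta 0 = ?d"
          by (simp_all add: f3 m1 mp u_def v_def)
        have rp: "m3 aRank w = (if w \<in> ?T \<and> m aRank u < m aRank w then Suc (m aRank w) else m aRank w)"
          "m3 aPos w = (if w \<in> ?T \<and> m aRank u < m aRank w then m aPos w + 2 * ?d else m aPos w)" for w
          using 4(1) by (simp_all add: s3 m1 mp re2 u_def[symmetric])
        have ru: "m3 aRank u = m aRank u" "m3 aPos u = m aPos u" using rp by auto
        let ?m' = "m3(aRank := (m3 aRank)(v := Suc (m aRank u)), aPos := (m3 aPos)(v := m aPos u + ?d),
            aIn := (m aIn)(v := p), aLen := (m aLen)(0 := m aLen 0 + 2 * ?d))"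
        have T': "reached ?m' p = insert v ?T" using uvN by (auto simp: reached_def)
        have card': "card (reached ?m' p) = Suc (card ?T)" using uv reached_card(1) by (simp add: T')
        have TR: "?T \<union> (cl p - ?T) = insert 0 (cl p)" using I by (auto simp: prim_inv_def)
        have clN: "cl p \<subseteq> {..<N}" by (auto simp: cl_def)
        have "prim_inv m0 p (Suc h) ?m'"
          unfolding prim_inv_def
        proof (intro conjI, goal_cases)
          case 1 then show ?case by (rule ready_cong[OF r]) (simp_all add: m3)
        next
          case 2 then show ?case by (simp add: m3)
        next
          case 3 then show ?case using I by (simp add: T' prim_inv_def)
        next
          case 4 then show ?case using I uv by (auto simp: T' prim_inv_def)
        next
          case 5
          show ?case
          proof (intro ballI impI)
            fix a b
            assume ab: "a \<in> reached ?m' p" "b \<in> reached ?m' p" and le: "?m' aRank a \<le> ?m' aRank b"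
            show "?m' aPos a + dist a b \<le> ?m' aPos b"
            proof (rule dist.insert_position[of ?T u v "m aRank" "m aPos" "?m' aRank" "?m' aPos"], goal_cases)
              case 1 then show ?case by (auto simp: reached_def)
            next
              case (4 a b) then show ?case using mono by simp
            next
              case (5 a) then show ?case using uv(4) by (auto simp: rp)
            next
              case (7 a) then show ?case using uv(4) by (auto simp: rp)
            qed (use uv uvN ab[unfolded T'] le in simp_all)
          qed
        next
          case 6
          show ?case
          proof
            fix a assume "a \<in> reached ?m' p"
            then have "a = v \<or> a \<in> ?T \<and> a \<noteq> v" using uv by (auto simp: T')
            then show "?m' aRank a < card (reached ?m' p) \<and> ?m' aPos a \<le> ?m' aLen 0"
              unfolding card' using pos[OF uv(2)] pos[of a] by (auto simp: rp)
          qed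
        next
          case 7 then show ?case using len by simp
        next
          case 8
          show ?case
          proof (intro allI impI)
            fix Q assume "covers {..<N} {0} (cl p) Q"
            then obtain Q1 where Q1: "covers (insert 0 (cl p)) ?T (cl p - ?T) Q1"
              "m aLen 0 + 2 * paths_cost dist Q1 \<le> 2 * paths_cost dist Q"
              using I by (auto simp: prim_inv_def)
            \<comment> \<open>The exchange saves \<open>?d\<close> on the cover and the walk grows
              by \<open>2 * ?d\<close>; with the factor 2 on covers this balances.\<close>
            obtain Q2 where Q2: "covers (?T \<union> (cl p - ?T)) (insert v ?T) (cl p - ?T - {v}) Q2"
              "?d + paths_cost dist Q2 \<le> paths_cost dist Q1"
              by (rule dist.covers_exchange[of ?T "cl p - ?T" Q1 v ?d]; unfold TR)
                (use Q1 uv clN min N_pos in auto)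
            have "cl p - ?T - {v} = cl p - reached ?m' p" by (auto simp: T')
            then show "\<exists>Q'. covers (insert 0 (cl p)) (reached ?m' p) (cl p - reached ?m' p) Q' \<and>
               ?m' aLen 0 + 2 * paths_cost dist Q' \<le> 2 * paths_cost dist Q"
              using Q1 Q2 TR T' by (intro exI[of _ Q2]) auto
          qed
        next
          case 9 then show ?case using I uv unfolding card' by (auto simp: prim_inv_def)
        next
          case 10 then show ?case using I by (auto simp: prim_inv_def)
        next
          case 11
          then show ?case using I uvN by (auto simp: prim_inv_def rp reached_def cl_def)
        qed
        then show ?case
          unfolding s3 using pos[OF uv(2)] len_B reached_card(2)[of m p] pB NB
          by (intro wp_Seq wp_Assign B_pos) (auto simp: m3 ru)
      qed
      then show ?case by (simp add: m1N duv u_def[symmetric] v_def[symmetric])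
    qed
  qed
qed (use I p in \<open>auto simp: prim_inv_def\<close>)

text \<open>\<open>X\<close> bounds the length of one piece of the walk. The last clause quantifies
  over all covers because the program never sees the solution it will be compared with.\<close>

definition class_ok :: "memory \<Rightarrow> nat \<Rightarrow> nat \<Rightarrow> bool" where
  "class_ok m p X \<longleftrightarrow>
     (\<forall>a \<in> cl p. m aRank a < N \<and> m aGroup a < p) \<and>
     (\<forall>a \<in> cl p. \<forall>b \<in> cl p. m aRank a \<le> m aRank b \<longrightarrow> m aPos a + dist a b \<le> m aPos b) \<and>
     (\<forall>a \<in> cl p. \<forall>b \<in> cl p. m aGroup a = m aGroup b \<longrightarrow> m aPos b \<le> m aPos a + X) \<and>
     (\<forall>Q. covers {..<N} {0} (cl p) Q \<longrightarrow> p * X \<le> 2 * paths_cost dist Q)"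

lemma class_ok_cong:
  assumes "class_ok m p X"
    "\<And>a. a \<in> cl p \<Longrightarrow> m' aRank a = m aRank a \<and> m' aPos a = m aPos a \<and> m' aGroup a = m aGroup a"
  shows "class_ok m' p X"
  using assms unfolding class_ok_def by simp

lemma class_ok_loop_variable [simp]: "class_ok (m(i1 := f)) p X = class_ok m p X"
  by (simp add: class_ok_def)

text \<open>Positions more than \<open>C div p\<close> apart differ by at least \<open>C + 1\<close>
  after multiplication by \<open>p\<close>, and \<open>C + 1\<close> is the divisor that defines the
  groups.\<close>

lemma same_group_le:
  fixes a b C p :: nat
  assumes "a * p div (C + 1) = b * p div (C + 1)" "0 < p"
  shows "b \<le> a + C div p"
proof (rule ccontr)
  assume "\<not> b \<le> a + C div p"
  then have "a + C div p + 1 \<le> b" by simp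
  then have "(a + C div p + 1) * p \<le> b * p" by (rule mult_le_mono1)
  moreover have "C < (C div p + 1) * p" using assms(2) by (metis dividend_less_div_times add.commute distrib_right mult_1)
  ultimately have "a * p + (C + 1) \<le> b * p" by (simp add: algebra_simps)
  then have "(a * p + (C + 1)) div (C + 1) \<le> b * p div (C + 1)" by (rule div_le_mono)
  moreover have "(a * p + (C + 1)) div (C + 1) = a * p div (C + 1) + 1" by (rule div_add_self2) simp
  ultimately show False using assms(1) by linarith
qed

lemma writes_assign_groups: "writes assign_groups = {i2, aGroup}"
  by (auto simp: assign_groups_def)

lemma assign_groups:
  assumes I: "prim_inv m0 p N m" and p: "1 \<le> p" "p \<le> n"
  shows "wp K B assign_groups (\<lambda>(m', out'). (\<exists>X. class_ok m' p X) \<and>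
     (\<forall>w. q w \<noteq> p \<longrightarrow> m' aGroup w = m aGroup w)) (m, out)"
proof -
  \<comment> \<open>A tree on at most \<open>N\<close> vertices cannot satisfy the progress
    alternative after \<open>N\<close> rounds.\<close>
  have full: "cl p \<subseteq> reached m p" using I reached_card(2)[of m p] by (auto simp: prim_inv_def)
  let ?g = "\<lambda>w. m aPos w * p div (m aLen 0 + 1)"
  have g: "?g w < p" if "w \<in> cl p" for w
  proof -
    have "m aPos w \<le> m aLen 0" using I full that by (auto simp: prim_inv_def)
    then have "m aPos w * p < p * (m aLen 0 + 1)" using p(1) by (metis le_imp_less_Suc mult.commute mult_less_mono2 Suc_eq_plus1 less_le_trans zero_less_one)
    then show ?thesis by (intro less_mult_imp_div_less) simp
  qed
  define I' where "I' = (\<lambda>h (m' :: memory) (out' :: nat list). (\<forall>w. m' aGroup w = (if w < h \<and> q w = p then ?g w else m aGroup w)))"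
  show ?thesis
    unfolding assign_groups_def
  proof (rule wp_For[where I = I' and h = N, OF B_pos], goal_cases)
    case (7 h m' out')
    have m': "m' aQ = q" "m' aPos = m aPos" "m' aLen = m aLen" "m' ap 0 = p"
      using 7(4) I by (auto simp: frame_def prim_inv_def ready_def)
    have "p \<le> K" using p N K_ge(1) by simp
    then have "?g h < 2 ^ B" if "q h = p"
      using g[of h] that 7(1) by (intro less_B) (simp add: cl_def)
    then show ?case
      using 7(2) by (intro wp_Cond wp_Assign wp_Skip B_pos) (auto simp: I'_def 7(3) m' less_Suc_eq)
  next
    case (8 m' out')
    have m': "m' aRank = m aRank" "m' aPos = m aPos" using 8(2) by (auto simp: frame_def)
    have gr: "m' aGroup w = ?g w" if "w \<in> cl p" for w using 8(1) that by (auto simp: I'_def cl_def)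
    have "class_ok m' p (m aLen 0 div p)"
      unfolding class_ok_def m'
    proof (intro conjI ballI allI impI)
      fix a assume a: "a \<in> cl p"
      have "m aRank a < card (reached m p)" using I a full unfolding prim_inv_def by blast
      then show "m aRank a < N" using reached_card(2)[of m p] by simp
      show "m' aGroup a < p" using gr g a by simp
      fix b assume b: "b \<in> cl p"
      show "m aPos a + dist a b \<le> m aPos b" if "m aRank a \<le> m aRank b"
        using I a b that full unfolding prim_inv_def by blast
      show "m aPos b \<le> m aPos a + m aLen 0 div p" if "m' aGroup a = m' aGroup b"
        using same_group_le[of "m aPos a" p "m aLen 0" "m aPos b"] that gr a b p by simp
    next
      fix Q assume "covers {..<N} {0} (cl p) Q"
      then have "m aLen 0 \<le> 2 * paths_cost dist Q" using I unfolding prim_inv_def by (meson le_trans le_add1)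
      moreover have "p * (m aLen 0 div p) \<le> m aLen 0" by simp
      ultimately show "p * (m aLen 0 div p) \<le> 2 * paths_cost dist Q" by linarith
    qed
    then show ?case using 8(1) by (auto simp: I'_def)
  qed (use I in \<open>auto simp: prim_inv_def ready_def K_ge less_B frame_def I'_def\<close>)
qed

lemma writes_classes: "writes classes = {i1, ap, aIn, aRank, aPos, aLen, i2, i3, au, av, adelta, aGroup}"
  by (auto simp: classes_def writes_attach writes_assign_groups)

lemma classes:
  assumes r: "ready m" and In: "\<And>w. m aIn w = 0"
  shows "wp K B classes (\<lambda>(m', out'). \<forall>p \<in> {1..n}. \<exists>X. class_ok m' p X) (m, out)"
  unfolding classes_def
proof (rule wp_For[where I = "\<lambda>h m out. (\<forall>w. m aIn w \<le> h) \<and> (\<forall>p \<in> {1..h}. \<exists>X. class_ok m p X)"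
      and h = n, OF B_pos], goal_cases)
  case (7 h m1 out1)
  let ?p = "Suc h"
  have m1: "m1 aN = m aN" "m1 aNN = m aNN" "m1 0 = m 0" "m1 aQ = m aQ" "m1 aDist = m aDist"
    using 7(4) by (auto simp: frame_def writes_attach writes_assign_groups)
  have p: "1 \<le> ?p" "?p \<le> n" using 7(1) by auto
  have pB: "?p < 2 ^ B" using p N K_ge(1) by (intro less_B) simp
  let ?m = "m1(ap := (m1 ap)(0 := ?p), aIn := (m1 aIn)(0 := ?p), aRank := (m1 aRank)(0 := 0),
     aPos := (m1 aPos)(0 := 0), aLen := (m1 aLen)(0 := 0))"
  have r1: "ready ?m" by (rule ready_cong[OF r]) (simp_all add: m1)
  have "m1 aIn v \<noteq> ?p" for v using 7(2) by (metis Suc_n_not_le_n)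
  then have re: "reached ?m ?p = {0}" using N_pos by (auto simp: reached_def)
  have inv0: "prim_inv m1 ?p 0 ?m"
    unfolding prim_inv_def re
  proof (intro conjI, goal_cases)
    case 8
    show ?case
    proof (intro allI impI)
      fix Q assume Q: "covers {..<N} {0} (cl ?p) Q"
      obtain Q' where Q': "covers (insert 0 (cl ?p)) {0} (cl ?p) Q'" "paths_cost dist Q' \<le> paths_cost dist Q"
        using dist.covers_filter[OF Q] by blast
      then show "\<exists>Q'. covers (insert 0 (cl ?p)) {0} (cl ?p - {0}) Q' \<and>
          ?m aLen 0 + 2 * paths_cost dist Q' \<le> 2 * paths_cost dist Q"
        by (intro exI[of _ Q']) (auto simp: covers_def)
    qed
  qed (use r1 7(2) N_pos dist.d_diag[of 0] in \<open>auto simp: le_Suc_eq\<close>)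
  have "wp K B (For i2 (Var aN) attach) (wp K B assign_groups
     (\<lambda>(m', out'). (\<forall>w. m' aIn w \<le> Suc h) \<and> (\<forall>p \<in> {1..Suc h}. \<exists>X. class_ok m' p X))) (?m, out1)"
  proof (rule wp_For[where I = "\<lambda>k m out. prim_inv m1 ?p k m" and h = N, OF B_pos], goal_cases)
    case (6 k m out f)
    show ?case by simp
  next
    case (7 k m out)
    show ?case by (rule attach[OF 7(2) p 7(1)])
  next
    case (8 m2 out2)
    show ?case
    proof (rule wp_mono_frame[OF assign_groups[OF 8(1) p]], goal_cases)
      case (1 s3)
      obtain m3 out3 where s3: "s3 = (m3, out3)" by (cases s3)
      note f3 = frameD[OF 1(2), unfolded writes_assign_groups s3, simplified]
      have m3: "m3 aIn = m2 aIn" "m3 aRank = m2 aRank" "m3 aPos = m2 aPos" by (simp_all add: f3)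
      have g2: "m2 aGroup = m1 aGroup" using 8(2) by (auto simp: frame_def writes_attach)
      have "\<exists>X. class_ok m3 p' X" if p': "p' \<in> {1..h}" for p'
      proof -
        obtain X where "class_ok m1 p' X" using 7(2) p' by blast
        then have "class_ok m3 p' X"
        proof (rule class_ok_cong)
          fix a assume a: "a \<in> cl p'"
          then have "q a = p'" by (simp add: cl_def)
          \<comment> \<open>Every class overwrites rank and position of the depot; this does no
            harm, as the depot is in no class.\<close>
          then have "a \<noteq> 0" "q a \<noteq> ?p" using p' q0 by (metis atLeastAtMost_iff not_one_le_zero, auto)
          then show "m3 aRank a = m1 aRank a \<and> m3 aPos a = m1 aPos a \<and> m3 aGroup a = m1 aGroup a"
            using 8(1) 1(1) by (auto simp: m3 s3 g2 prim_inv_def)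
        qed
        then show ?thesis by blast
      qed
      moreover have "\<exists>X. class_ok m3 ?p X" using 1(1) s3 by simp
      moreover have "\<forall>w. m3 aIn w \<le> Suc h" using 8(1) by (simp add: m3 prim_inv_def)
      ultimately show ?case unfolding s3 by (auto simp: le_Suc_eq)
    qed
  qed (use inv0 r1 K_ge less_B in \<open>auto simp: writes_attach frame_def ready_def\<close>)
  then show ?case
    by (intro wp_Seq wp_Assign B_pos) (use pB 7(3) in \<open>simp_all\<close>)
next
  case 1
  show ?case using K_ge(1) N by simp
next
  case 2
  show ?case using K_ge(1) N by (intro less_B) simp
next
  case (5 m' out')
  then have "m' 0 = A" using r by (auto simp: frame_def ready_def writes_attach writes_assign_groups)
  then show ?case using A0 by simp
qed (simp_all add: In writes_attach writes_assign_groups)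

end

section \<open>Assembling and writing one day\<close>

definition encode_day :: "(nat \<times> nat) list \<times> nat list \<Rightarrow> nat list" where
  "encode_day = (\<lambda>(T, J). encode_list (\<lambda>(u, v). [u, v]) T @ encode_list (\<lambda>v. [v]) J)"

definition stores_tour :: "memory \<Rightarrow> (nat \<times> nat) list \<Rightarrow> bool" where
  "stores_tour m T \<longleftrightarrow> m aT 0 = length T \<and> (\<forall>i < length T. (m aTail i, m aHead i) = T ! i)"

definition stores_clients :: "memory \<Rightarrow> nat list \<Rightarrow> bool" where
  "stores_clients m J \<longleftrightarrow> m aC 0 = length J \<and> (\<forall>i < length J. m aJ i = J ! i)"

lemma writes_go_to: "writes go_to = {i2, ax, aTail, aHead, aT, acur}"
  by (auto simp: go_to_def)

lemma writes_stops: "writes stops = {i3, av, i2, ax, aTail, aHead, aT, acur, aJ, aC}"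
  by (auto simp: stops_def writes_go_to)

lemma writes_write_day: "writes write_day = {i3}"
  by (auto simp: write_day_def)

lemma outputs_stops: "\<not> outputs go_to" "\<not> outputs stops"
  by (auto simp: stops_def go_to_def)

context resources
begin

lemma idx_assoc: "a * (N * N) + (b * N + v) = (a * N + b) * N + v"
  by (simp add: algebra_simps)

lemma write_day:
  assumes T: "stores_tour m T" "length T \<le> K" and J: "stores_clients m J" "length J \<le> K"
  shows "wp K B write_day (\<lambda>(m', out'). out' = out @ encode_day (T, J)) (m, out)"
  unfolding write_day_def
proof (intro wp_Seq wp_Write B_pos, rule wp_For[where I = "\<lambda>h m out'.
    out' = out @ [length T] @ concat (map (\<lambda>(u, v). [u, v]) (take h T))" and h = "length T", OF B_pos], goal_cases)
  case (7 h m1 out1)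
  have "m1 aTail = m aTail" "m1 aHead = m aHead" using 7(4) by (auto simp: frame_def)
  moreover have "(m aTail h, m aHead h) = T ! h" using T(1) 7(1) by (simp add: stores_tour_def)
  ultimately have "T ! h = (m1 aTail h, m1 aHead h)" by simp
  then show ?case using 7(1-3)
    by (intro wp_Seq wp_Write B_pos) (simp add: take_Suc_conv_app_nth)
next
  case (8 m1 out1)
  have m1: "m1 aC = m aC" "m1 aJ = m aJ" using 8(2) by (auto simp: frame_def)
  show ?case
  proof (intro wp_Seq wp_Write B_pos, rule wp_For[where I = "\<lambda>h m out'.
    out' = out1 @ [length J] @ concat (map (\<lambda>v. [v]) (take h J))" and h = "length J", OF B_pos], goal_cases)
    case (7 h m2 out2)
    have "m2 aJ = m1 aJ" using 7(4) by (auto simp: frame_def)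
    moreover have "m aJ h = J ! h" using J(1) 7(1) by (simp add: stores_clients_def)
    ultimately show ?case using 7(1-3) m1
      by (intro wp_Seq wp_Write B_pos) (simp add: take_Suc_conv_app_nth)
  next
    case (8 m2 out2)
    then show ?case using \<open>out1 = _\<close> by (simp add: encode_day_def encode_list_def)
  qed (use J less_B m1 in \<open>auto simp: stores_clients_def frame_def\<close>)
qed (use T less_B in \<open>auto simp: stores_tour_def frame_def\<close>)

end

definition power_of_two :: "nat \<Rightarrow> bool" where
  "power_of_two p \<longleftrightarrow> (\<exists>l. p = 2 ^ l)"

text \<open>Freezes the memory \<open>m0\<close> left by the preprocessing; the tables it fixes are
  only read while days are written.\<close>

locale scheduling = clustering +
  fixes m0 :: memory and X :: "nat \<Rightarrow> nat" and r :: nat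
  assumes ready: "ready m0"
    and hop: "\<And>k u v. k < N \<Longrightarrow> u < N \<Longrightarrow> v < N \<Longrightarrow> m0 aHop (Suc k * (N * N) + u * N + v) < N \<and>
         sp (Suc k) u v = w u (m0 aHop (Suc k * (N * N) + u * N + v))
           + sp k (m0 aHop (Suc k * (N * N) + u * N + v)) v"
    and q: "\<And>v. v \<in> {1..n} \<Longrightarrow> q v \<in> {1..n} \<and> power_of_two (q v)"
    and ok: "\<And>p. p \<in> {1..n} \<Longrightarrow> class_ok m0 p (X p)"
    and r: "\<And>v. v < N \<Longrightarrow> dist 0 v \<le> r"
begin

definition agree :: "memory \<Rightarrow> bool" where
  "agree m \<longleftrightarrow> (\<forall>a \<in> {0, aN, aNN, aHop, aQ, aRank, aPos, aGroup, aP}. m a = m0 a)"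

lemma agreeD:
  assumes "agree m"
  shows "m aN 0 = N" "m aNN 0 = N * N" "m aHop = m0 aHop" "m aQ = q" "m aRank = m0 aRank"
    "m aGroup = m0 aGroup" "m aP = m0 aP"
  using assms ready by (auto simp: agree_def ready_def)

lemma agree_frame:
  assumes "agree m" "\<And>a. a \<in> {0, aN, aNN, aHop, aQ, aRank, aPos, aGroup, aP} \<Longrightarrow> m' a = m a"
  shows "agree m'"
  using assms by (simp add: agree_def)

text \<open>The cost walked so far and the hop-bounded distance still to go always add up to
  \<open>dist\<close>. Once no hops remain, a current vertex other than the target would contribute
  \<open>big\<close>, more than any distance.\<close>

lemma go_to:
  assumes a: "agree m" and T: "stores_tour m T" "length T + N \<le> K"
    and u: "m acur 0 < N" and v: "m av 0 < N"
  shows "wp K B go_to (\<lambda>(m', out'). m' acur 0 = m av 0 \<and> (\<exists>p. awalk (m acur 0) p (m av 0) \<and>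
     walk_cost p = dist (m acur 0) (m av 0) \<and> stores_tour m' (T @ p) \<and> length p \<le> N)) (m, out)"
proof -
  define u where "u = m acur 0"
  define v where "v = m av 0"
  have uv: "u < N" "v < N" using assms by (auto simp: u_def v_def)
  define I where "I = (\<lambda>h (m' :: memory) (out' :: nat list). \<exists>p. awalk u p (m' acur 0) \<and>
     walk_cost p + sp (N - h) (m' acur 0) v = dist u v \<and> stores_tour m' (T @ p) \<and> length p \<le> h)"
  show ?thesis
    unfolding go_to_def u_def[symmetric] v_def[symmetric]
  proof (rule wp_For[where I = I and h = N, OF B_pos], goal_cases)
    case 4
    show ?case using T(1) uv
      by (auto simp: I_def awalk_Nil_iff verts dist_def stores_tour_def u_def[symmetric] intro: exI[of _ "[]"])
  next
    case (6 k m out f)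
    show ?case by (simp add: I_def stores_tour_def)
  next
    case (7 h m1 out1)
    have "agree m1" by (rule agree_frame[OF a]) (use 7(4) in \<open>auto simp: frame_def\<close>)
    note m1 = agreeD[OF this]
    have m1v: "m1 av 0 = v" using 7(4) by (auto simp: frame_def v_def)
    define y where "y = m1 acur 0"
    obtain p where p: "awalk u p y" "walk_cost p + sp (N - h) y v = dist u v" "stores_tour m1 (T @ p)" "length p \<le> h"
      using 7(2) by (auto simp: I_def y_def)
    have y: "y < N" using awalk_last_in_verts[OF p(1)] verts by simp
    define k where "k = N - Suc h"
    have k: "N - h = Suc k" "k < N" "N - Suc h = k" using 7(1) by (auto simp: k_def)
    define x where "x = m0 aHop (Suc k * (N * N) + y * N + v)"
    have x: "x < N" "sp (Suc k) y v = w y x + sp k x v" using hop[OF k(2) y uv(2)] by (auto simp: x_def)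
    have xB: "x < 2 ^ B" "y < 2 ^ B" using x(1) y K_ge(1) by (intro less_B; simp)+
    have len: "length T + length p < K" using T(2) p(4) 7(1) by simp
    then have lenB: "Suc (length T + length p) < 2 ^ B" by (intro less_B) simp
    have lT: "m1 aT 0 = length T + length p" using p(3) by (simp add: stores_tour_def)
    let ?m2 = "m1(ax := (m1 ax)(0 := x))"
    have "wp K B (When (~. (Var ax =. Var acur))
        (Assign aTail (Var aT) (Var acur) ;; Assign aHead (Var aT) (Var ax) ;;
         Set aT (Var aT +. Num 1) ;; Set acur (Var ax))) (\<lambda>(m', out'). I (Suc h) m' out') (?m2, out1)"
    proof (rule wp_Cond[OF B_pos])
      assume "\<not> holds (~. (Var ax =. Var acur)) ?m2"
      then have "x = y" by (simp add: y_def)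
      then have "I (Suc h) ?m2 out1" using p x k w_diag
        by (auto simp: I_def y_def[symmetric] stores_tour_def intro!: exI[of _ p])
      then show "wp K B Skip (\<lambda>(m', out'). I (Suc h) m' out') (?m2, out1)" by (intro wp_Skip) simp
    next
      assume "holds (~. (Var ax =. Var acur)) ?m2"
      then have ne: "y \<noteq> x" by (simp add: y_def)
      have "w y x < big" using p(2) k(1) x(2) dist_less_big[OF uv] by simp
      then have arc: "(y, x) \<in> parcs G" using ne by (rule arcI)
      let ?m3 = "?m2(aTail := (m1 aTail)(length T + length p := y), aHead := (m1 aHead)(length T + length p := x),
          aT := (m1 aT)(0 := Suc (length T + length p)), acur := (m1 acur)(0 := x))"
      have aw: "awalk u (p @ [(y, x)]) x"
        by (rule awalk_appendI[OF p(1)]) (use arc x(1) verts in \<open>auto simp: awalk_simps\<close>)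
      have "stores_tour ?m3 (T @ (p @ [(y, x)]))"
        using p(3) by (auto simp: stores_tour_def less_Suc_eq nth_append)
      then have "I (Suc h) ?m3 out1"
        unfolding I_def using aw p(2,4) x(2) k by (intro exI[of _ "p @ [(y, x)]"]) simp
      then show "wp K B (Assign aTail (Var aT) (Var acur) ;; Assign aHead (Var aT) (Var ax) ;;
         Set aT (Var aT +. Num 1) ;; Set acur (Var ax)) (\<lambda>(m', out'). I (Suc h) m' out') (?m2, out1)"
        by (intro wp_Seq wp_Assign B_pos) (use xB lenB in \<open>simp_all add: y_def[symmetric] lT\<close>)
    qed
    then show ?case
      by (intro wp_Seq wp_Assign B_pos)
        (use xB in \<open>simp_all add: m1 m1v 7(3) y_def[symmetric] k x_def del: mult_Suc\<close>)
  next
    case (8 m1 out1)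
    obtain p where p: "awalk u p (m1 acur 0)" "walk_cost p + sp 0 (m1 acur 0) v = dist u v"
        "stores_tour m1 (T @ p)" "length p \<le> N"
      using 8(1) by (auto simp: I_def)
    have "m1 acur 0 = v"
    proof (rule ccontr)
      assume "m1 acur 0 \<noteq> v"
      then have "big \<le> dist u v" using p(2) by simp
      then show False using dist_less_big[OF uv] by simp
    qed
    then show ?case using p by auto
  qed (use a agreeD[OF a] K_ge(1) less_B in \<open>auto simp: frame_def\<close>)
qed

text \<open>Besides one piece, a class is charged a trip from the depot and back, even though the
  tour may pass directly from class to class.\<close>

definition class_cost :: "nat \<Rightarrow> nat" where
  "class_cost p = 2 * r + X p"

definition classes_cost :: "nat \<Rightarrow> nat" where
  "classes_cost p = (\<Sum>x \<in> {x. 1 \<le> x \<and> x < p \<and> power_of_two x}. class_cost x)"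

lemma classes_cost_step:
  assumes "1 \<le> p" "power_of_two p" "p < p'"
  shows "classes_cost p + class_cost p \<le> classes_cost p'"
proof -
  have "classes_cost p + class_cost p = (\<Sum>x \<in> insert p {x. 1 \<le> x \<and> x < p \<and> power_of_two x}. class_cost x)"
    by (simp add: classes_cost_def)
  also have "\<dots> \<le> classes_cost p'"
    unfolding classes_cost_def using assms by (intro sum_mono2) auto
  finally show ?thesis .
qed

definition good_day :: "nat \<Rightarrow> (nat \<times> nat) list \<times> nat list \<Rightarrow> bool" where
  "good_day k = (\<lambda>(T, J). awalk 0 T 0 \<and> set J \<subseteq> {1..n} \<inter> set (pawalk_verts 0 T) \<and>
     (\<forall>v \<in> {1..n}. k mod q v = m0 aGroup v \<longrightarrow> v \<in> set J) \<and> walk_cost T \<le> classes_cost N)"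

definition stop :: "nat \<Rightarrow> nat \<Rightarrow> bool" where
  "stop k e \<longleftrightarrow> q (e mod N) = e div (N * N) + 1 \<and> m0 aRank (e mod N) = e div N mod N \<and>
     k mod q (e mod N) = m0 aGroup (e mod N)"

lemma stop_client: "stop k e \<Longrightarrow> e mod N \<in> {1..n} \<and> e mod N \<in> cl (q (e mod N))"
proof -
  assume s: "stop k e"
  have "e mod N \<noteq> 0"
  proof
    assume "e mod N = 0"
    then show False using s q0 by (simp add: stop_def)
  qed
  moreover have "e mod N < N" using N_pos by simp
  moreover have "e mod N \<le> n" using \<open>e mod N < N\<close> N by linarith
  ultimately show ?thesis by (simp add: cl_def)
qed

text \<open>The witness \<open>f\<close> is the first client of the current class served on this
  day. The cost so far is bounded by the charges of smaller classes, \<open>r\<close> for reaching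
  the class, and the position gained since \<open>f\<close>. The second \<open>r\<close> of
  \<open>class_cost\<close> stays in reserve for leaving.\<close>

definition stops_inv :: "nat \<Rightarrow> nat \<Rightarrow> memory \<Rightarrow> bool" where
  "stops_inv k h m \<longleftrightarrow> (\<exists>T J. stores_tour m T \<and> stores_clients m J \<and> awalk 0 T (m acur 0) \<and>
     length T \<le> h * N \<and> length J \<le> h \<and>
     set J \<subseteq> {1..n} \<inter> set (pawalk_verts 0 T) \<and> (\<forall>e < h. stop k e \<longrightarrow> e mod N \<in> set J) \<and>
     (m acur 0 = 0 \<and> T = [] \<or>
      (\<exists>e < h. stop k e \<and> m acur 0 = e mod N \<and>
        (\<exists>f \<in> cl (q (m acur 0)). m0 aGroup f = m0 aGroup (m acur 0) \<and>
           walk_cost T + m0 aPos f \<le> classes_cost (q (m acur 0)) + r + m0 aPos (m acur 0)))))"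

lemma last_in_verts: "awalk u p v \<Longrightarrow> v \<in> set (pawalk_verts u p)"
  by (metis awlast_of_awalk awalk_verts_non_Nil last_in_set awalkE')

lemma verts_append: "awalk u p v \<Longrightarrow> awalk v p' v' \<Longrightarrow> set (pawalk_verts u p) \<subseteq> set (pawalk_verts u (p @ p'))"
  using set_awalk_verts[of u p v] set_awalk_verts[of u "p @ p'" v'] awalk_appendI[of u p v p' v'] by auto

text \<open>Within a class the difference of positions pays for the step and \<open>f\<close> is
  kept. A change of class costs at most \<open>2 * r\<close>, via the depot: one \<open>r\<close>
  completes the charge of the old class, the other is the way into the new one, whose first client
  becomes the witness.\<close>

lemma stops_cost:
  assumes c: "stop k e" "e < h" and v: "stop k h" and f: "f \<in> cl (q (e mod N))"
    "m0 aGroup f = m0 aGroup (e mod N)"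
    and W: "W + m0 aPos f \<le> classes_cost (q (e mod N)) + r + m0 aPos (e mod N)"
  shows "\<exists>f' \<in> cl (q (h mod N)). m0 aGroup f' = m0 aGroup (h mod N) \<and>
     W + dist (e mod N) (h mod N) + m0 aPos f' \<le> classes_cost (q (h mod N)) + r + m0 aPos (h mod N)"
proof -
  let ?c = "e mod N" and ?v = "h mod N"
  have le: "e div (N * N) \<le> h div (N * N)" using c(2) by (simp add: div_le_mono)
  have C: "?c \<in> {1..n}" "?c \<in> cl (q ?c)" and V: "?v \<in> {1..n}" "?v \<in> cl (q ?v)"
    using stop_client c(1) v by auto
  have cN: "?c < N" "?v < N" using N_pos by auto
  note okc = ok[OF conjunct1[OF q[OF C(1)]], unfolded class_ok_def]
  show ?thesis
  proof (cases "q ?c = q ?v")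
    case True
    \<comment> \<open>The class digits agree, so the order of the loop indices is the order of the
      ranks.\<close>
    then have "e div N div N = h div N div N"
      using c(1) v by (simp add: stop_def div_mult2_eq)
    moreover have "e div N \<le> h div N" using c(2) by (simp add: div_le_mono)
    ultimately have "e div N mod N \<le> h div N mod N"
      by (metis div_mult_mod_eq nat_add_left_cancel_le)
    then have "m0 aRank ?c \<le> m0 aRank ?v" using c(1) v by (simp add: stop_def)
    then have "m0 aPos ?c + dist ?c ?v \<le> m0 aPos ?v" using okc C(2) V(2) True by auto
    moreover have "m0 aGroup ?c = k mod q ?c" "m0 aGroup ?v = k mod q ?v"
      using c(1) v unfolding stop_def by metis+
    then have "m0 aGroup f = m0 aGroup ?v" using f(2) True by simp
    ultimately show ?thesis using f(1) W True by (intro bexI[of _ f]) auto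
  next
    case False
    then have lt: "q ?c < q ?v" using le c(1) v by (simp add: stop_def)
    have "dist ?c ?v \<le> dist ?c 0 + dist 0 ?v" using cN N_pos by (intro dist.d_tri) auto
    also have "dist ?c 0 = dist 0 ?c" using cN N_pos by (intro dist.d_sym) auto
    finally have "dist ?c ?v \<le> 2 * r" using r[OF cN(1)] r[OF cN(2)] by simp
    moreover have "m0 aPos ?c \<le> m0 aPos f + X (q ?c)" using okc C(2) f by blast
    moreover have "classes_cost (q ?c) + class_cost (q ?c) \<le> classes_cost (q ?v)"
      using q[OF C(1)] lt by (intro classes_cost_step) auto
    ultimately have "W + dist ?c ?v \<le> classes_cost (q ?v) + r" using W by (simp add: class_cost_def)
    then show ?thesis using V(2) by (intro bexI[of _ ?v]) auto
  qed
qed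

lemma stops:
  assumes a: "agree m" and k: "m i1 0 = k"
    and init: "m acur 0 = 0" "m aT 0 = 0" "m aC 0 = 0"
  shows "wp K B stops (\<lambda>(m', out'). stops_inv k (N * (N * N)) m') (m, out)"
  unfolding stops_def
proof (rule wp_For[where I = "\<lambda>h m out. stops_inv k h m" and h = "N * (N * N)", OF B_pos], goal_cases)
  case 1 then show ?case using K_ge(3) by (simp add: mult.assoc)
next
  case 2 then show ?case using less_B[OF K_ge(3)] by (simp add: mult.assoc)
next
  case 3 then show ?case by (simp add: writes_go_to)
next
  case 4
  show ?case unfolding stops_inv_def using init N_pos
    by (intro exI[of _ "[]"]) (auto simp: stores_tour_def stores_clients_def awalk_Nil_iff verts)
next
  case (5 m' out')
  then have "agree m'" using a by (intro agree_frame[OF a]) (auto simp: frame_def writes_go_to)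
  then show ?case by (simp add: agreeD)
next
  case (6 k m out f)
  show ?case by (simp add: stops_inv_def stores_tour_def stores_clients_def)
next
  case (7 h m1 out1)
  have "agree m1" by (rule agree_frame[OF a]) (use 7(4) in \<open>auto simp: frame_def writes_go_to\<close>)
  note m1 = agreeD[OF this]
  have k1: "m1 i1 0 = k" using 7(4) k by (auto simp: frame_def writes_go_to)
  define v where "v = h mod N"
  have v: "v < N" using N_pos by (simp add: v_def)
  have vB: "v < 2 ^ B" using v K_ge(1) by (intro less_B) simp
  let ?m2 = "m1(av := (m1 av)(0 := v))"
  obtain T J where TJ: "stores_tour m1 T" "stores_clients m1 J" "awalk 0 T (m1 acur 0)"
     "length T \<le> h * N" "length J \<le> h"
     "set J \<subseteq> {1..n} \<inter> set (pawalk_verts 0 T)" "\<forall>e < h. stop k e \<longrightarrow> e mod N \<in> set J"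
    and cost: "m1 acur 0 = 0 \<and> T = [] \<or>
      (\<exists>e < h. stop k e \<and> m1 acur 0 = e mod N \<and>
        (\<exists>f \<in> cl (q (m1 acur 0)). m0 aGroup f = m0 aGroup (m1 acur 0) \<and>
           walk_cost T + m0 aPos f \<le> classes_cost (q (m1 acur 0)) + r + m0 aPos (m1 acur 0)))"
    using 7(2) unfolding stops_inv_def by blast
  have cN: "m1 acur 0 < N" using awalk_last_in_verts[OF TJ(3)] verts by simp
  have hN: "Suc h * N \<le> K"
  proof -
    have "Suc h * N \<le> N * (N * N) * N" using 7(1) by (intro mult_le_mono1) simp
    also have "\<dots> = N * N * N * N" by (simp add: mult.assoc)
    finally show ?thesis using K_ge(4) by simp
  qed
  have hK: "Suc h < 2 ^ B" using 7(1) K_ge(3) by (intro less_B) (simp add: mult.assoc)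
  define c where "c = (Cell aQ (Var av) =. Var i3 /. Var aNN +. Num 1 &.
          Cell aRank (Var av) =. Var i3 /. Var aN %. Var aN &.
          Var i1 %. Cell aQ (Var av) =. Cell aGroup (Var av))"
  have c: "holds c ?m2 \<longleftrightarrow> stop k h"
    by (simp add: c_def m1 k1 7(3) stop_def v_def[symmetric] minus_div_mult_eq_mod)
  have "wp K B (When c (go_to ;; Assign aJ (Var aC) (Var av) ;; Set aC (Var aC +. Num 1)))
     (\<lambda>(m', out'). stops_inv k (Suc h) m') (?m2, out1)"
  proof (rule wp_Cond[OF B_pos], unfold c)
    assume ns: "\<not> stop k h"
    have "stops_inv k (Suc h) ?m2"
      unfolding stops_inv_def
    proof (intro exI conjI)
      show "stores_tour ?m2 T" "stores_clients ?m2 J" using TJ by (auto simp: stores_tour_def stores_clients_def)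
      show "\<forall>e < Suc h. stop k e \<longrightarrow> e mod N \<in> set J" using TJ(7) ns by (auto simp: less_Suc_eq)
      show "?m2 acur 0 = 0 \<and> T = [] \<or>
      (\<exists>e < Suc h. stop k e \<and> ?m2 acur 0 = e mod N \<and>
        (\<exists>f \<in> cl (q (?m2 acur 0)). m0 aGroup f = m0 aGroup (?m2 acur 0) \<and>
           walk_cost T + m0 aPos f \<le> classes_cost (q (?m2 acur 0)) + r + m0 aPos (?m2 acur 0)))"
        using cost by (auto intro: less_SucI)
    qed (use TJ in auto)
    then show "wp K B Skip (\<lambda>(m', out'). stops_inv k (Suc h) m') (?m2, out1)" by (intro wp_Skip) simp
  next
    assume s: "stop k h"
    have V: "v \<in> {1..n}" "v \<in> cl (q v)" using stop_client[OF s] by (auto simp: v_def)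
    show "wp K B (go_to ;; Assign aJ (Var aC) (Var av) ;; Set aC (Var aC +. Num 1))
     (\<lambda>(m', out'). stops_inv k (Suc h) m') (?m2, out1)"
    proof (rule wp_Seq, rule wp_mono_frame[OF go_to[where T = T]], goal_cases)
      case 1 show ?case by (rule agree_frame[OF \<open>agree m1\<close>]) auto
    next
      case 2 show ?case using TJ(1) by (simp add: stores_tour_def)
    next
      case 3 show ?case using TJ(4) hN by simp
    next
      case 4 show ?case using cN by simp
    next
      case 5 show ?case using v by simp
    next
      case (6 s3)
      obtain m3 out3 where s3: "s3 = (m3, out3)" by (cases s3)
      note f3 = frameD[OF 6(2), unfolded writes_go_to s3, simplified]
      have m3: "m3 aJ = m1 aJ" "m3 aC = m1 aC" "m3 av 0 = v" by (simp_all add: f3)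
      obtain p where p: "m3 acur 0 = v" "awalk (m1 acur 0) p v" "walk_cost p = dist (m1 acur 0) v"
        "stores_tour m3 (T @ p)" "length p \<le> N"
        using 6(1) by (auto simp: s3)
      have lJ: "m1 aC 0 = length J" using TJ(2) by (simp add: stores_clients_def)
      have lB: "Suc (length J) < 2 ^ B" using TJ(5) hK by simp
      let ?m4 = "m3(aJ := (m1 aJ)(length J := v), aC := (m1 aC)(0 := Suc (length J)))"
      have aw: "awalk 0 (T @ p) v" using TJ(3) p(2) by (rule awalk_appendI)
      have "stops_inv k (Suc h) ?m4"
        unfolding stops_inv_def
      proof (intro exI conjI)
        show "stores_tour ?m4 (T @ p)" using p(4) by (simp add: stores_tour_def)
        show "stores_clients ?m4 (J @ [v])"
          using TJ(2) by (auto simp: stores_clients_def nth_append less_Suc_eq)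
        show "awalk 0 (T @ p) (?m4 acur 0)" using aw p(1) by simp
        show "length (T @ p) \<le> Suc h * N" using TJ(4) p(5) by simp
        show "length (J @ [v]) \<le> Suc h" using TJ(5) by simp
        show "set (J @ [v]) \<subseteq> {1..n} \<inter> set (pawalk_verts 0 (T @ p))"
          using TJ(6) V(1) last_in_verts[OF aw] verts_append[OF TJ(3) p(2)] by auto
        show "\<forall>e<Suc h. stop k e \<longrightarrow> e mod N \<in> set (J @ [v])"
          using TJ(7) by (auto simp: less_Suc_eq v_def)
        have "\<exists>f \<in> cl (q v). m0 aGroup f = m0 aGroup v \<and>
           walk_cost (T @ p) + m0 aPos f \<le> classes_cost (q v) + r + m0 aPos v"
          using cost
        proof (elim disjE exE conjE bexE)
          assume "m1 acur 0 = 0" "T = []"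
          then show ?thesis using p(3) r[OF v] V(2) by (intro bexI[of _ v]) auto
        next
          fix e f
          assume "e < h" "stop k e" "m1 acur 0 = e mod N" "f \<in> cl (q (m1 acur 0))"
            "m0 aGroup f = m0 aGroup (m1 acur 0)"
            "walk_cost T + m0 aPos f \<le> classes_cost (q (m1 acur 0)) + r + m0 aPos (m1 acur 0)"
          then show ?thesis using stops_cost[of k e h f "walk_cost T"] s p(3) by (auto simp: v_def)
        qed
        then show "?m4 acur 0 = 0 \<and> T @ p = [] \<or>
          (\<exists>e < Suc h. stop k e \<and> ?m4 acur 0 = e mod N \<and>
            (\<exists>f \<in> cl (q (?m4 acur 0)). m0 aGroup f = m0 aGroup (?m4 acur 0) \<and>
           walk_cost (T @ p) + m0 aPos f \<le> classes_cost (q (?m4 acur 0)) + r + m0 aPos (?m4 acur 0)))"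
          using s p(1) by (intro disjI2 exI[of _ h]) (simp add: v_def)
      qed
      then show ?case unfolding s3
        by (intro wp_Seq wp_Assign B_pos) (use lB vB in \<open>simp_all add: m3 lJ\<close>)
    qed
  qed
  then show ?case
    unfolding c_def[symmetric] by (intro wp_Seq wp_Assign B_pos)
      (use vB in \<open>simp_all add: m1 7(3) v_def minus_div_mult_eq_mod\<close>)
qed simp

lemma writes_day: "writes day = {i3, av, i2, ax, aTail, aHead, aT, acur, aJ, aC}"
  by (auto simp: day_def writes_go_to writes_stops writes_write_day)

lemma day:
  assumes a: "agree m" and k: "m i1 0 = k"
  shows "wp K B day (\<lambda>(m', out'). \<exists>D. out' = out @ encode_day D \<and> good_day k D) (m, out)"
  unfolding day_def
proof (rule wp_Seq, rule wp_Assign[OF B_pos], simp, rule wp_Seq, rule wp_Assign[OF B_pos], simp,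
    rule wp_Seq, rule wp_Assign[OF B_pos], simp, rule wp_Seq, rule wp_mono_frame[OF stops[where k = k]], goal_cases)
  case 1 show ?case by (rule agree_frame[OF a]) auto
next
  case (6 s1)
  obtain m1 out1 where s1: "s1 = (m1, out1)" by (cases s1)
  have o1: "out1 = out" using 6(2) outputs_stops by (simp add: frame_def s1)
  note f1 = frameD[OF 6(2), unfolded writes_stops s1, simplified]
  have "agree m1" by (rule agree_frame[OF a]) (use f1 in auto)
  obtain T J where TJ: "stores_tour m1 T" "stores_clients m1 J" "awalk 0 T (m1 acur 0)"
     "length T \<le> N * (N * N) * N" "length J \<le> N * (N * N)"
     "set J \<subseteq> {1..n} \<inter> set (pawalk_verts 0 T)" "\<forall>e < N * (N * N). stop k e \<longrightarrow> e mod N \<in> set J"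
    and cost: "m1 acur 0 = 0 \<and> T = [] \<or>
      (\<exists>e < N * (N * N). stop k e \<and> m1 acur 0 = e mod N \<and>
        (\<exists>f \<in> cl (q (m1 acur 0)). m0 aGroup f = m0 aGroup (m1 acur 0) \<and>
           walk_cost T + m0 aPos f \<le> classes_cost (q (m1 acur 0)) + r + m0 aPos (m1 acur 0)))"
    using 6(1) unfolding stops_inv_def s1 by blast
  have cN: "m1 acur 0 < N" using awalk_last_in_verts[OF TJ(3)] verts by simp
  have lT: "length T + N \<le> K" using TJ(4) K by (simp add: mult.assoc)
  show ?case unfolding s1
  proof (rule wp_Seq, rule wp_Assign[OF B_pos], simp, rule wp_Seq, rule wp_mono_frame[OF go_to[where T = T]], goal_cases)
    case 1 show ?case by (rule agree_frame[OF \<open>agree m1\<close>]) auto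
  next
    case 2 show ?case using TJ(1) by (simp add: stores_tour_def)
  next
    case (6 s2)
    obtain m2 out2 where s2: "s2 = (m2, out2)" by (cases s2)
    have o2: "out2 = out" using 6(2) outputs_stops o1 by (simp add: frame_def s2)
    note f2 = frameD[OF 6(2), unfolded writes_go_to s2, simplified]
    have m2: "m2 aJ = m1 aJ" "m2 aC = m1 aC" by (simp_all add: f2)
    obtain p where p: "awalk (m1 acur 0) p 0" "walk_cost p = dist (m1 acur 0) 0"
        "stores_tour m2 (T @ p)" "length p \<le> N"
      using 6(1) by (auto simp: s2)
    have "good_day k (T @ p, J)"
      unfolding good_day_def prod.case
    proof (intro conjI ballI impI)
      show "awalk 0 (T @ p) 0" using TJ(3) p(1) by (rule awalk_appendI)
      show "set J \<subseteq> {1..n} \<inter> set (pawalk_verts 0 (T @ p))"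
        using TJ(6) verts_append[OF TJ(3) p(1)] by auto
      show "v \<in> set J" if v: "v \<in> {1..n}" "k mod q v = m0 aGroup v" for v
      proof -
        have vN: "v < N" using v N by simp
        have qv: "q v \<in> {1..n}" using q v by blast
        have "v \<in> cl (q v)" using vN by (simp add: cl_def)
        then have rk: "m0 aRank v < N" using ok[OF qv] by (simp add: class_ok_def)
        \<comment> \<open>The round that serves \<open>v\<close>: its digits are class, rank and
          vertex, the class digit being one less than \<open>q v\<close>.\<close>
        let ?e = "(q v - 1) * (N * N) + (m0 aRank v * N + v)"
        note l = idx_less[OF rk vN]
        have "?e div (N * N) = q v - 1" using block_div_mod[OF l] by blast
        moreover have "?e mod N = v" unfolding idx_assoc using vN by (rule idx_div_mod)
        moreover have "?e div N mod N = m0 aRank v"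
        proof -
          have "?e div N = (q v - 1) * N + m0 aRank v"
            unfolding idx_assoc using vN by (rule idx_div_mod)
          then show ?thesis using rk by simp
        qed
        moreover have "?e < N * (N * N)"
        proof -
          have "?e < (q v - 1) * (N * N) + N * N" using l by simp
          also have "\<dots> = Suc (q v - 1) * (N * N)" by simp
          also have "\<dots> \<le> N * (N * N)" using qv N by (intro mult_le_mono1) simp
          finally show ?thesis .
        qed
        ultimately show ?thesis using TJ(7)[rule_format, of ?e] v qv by (simp add: stop_def)
      qed
      show "walk_cost (T @ p) \<le> classes_cost N"
        using cost
      proof (elim disjE exE conjE bexE)
        assume "m1 acur 0 = 0" "T = []"
        then have "walk_cost (T @ p) = dist 0 0" using p(2) by (simp only: append_Nil)
        then show ?thesis using dist.d_diag[of 0] N_pos by (metis le0 lessThan_iff)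
      next
        fix e f
        assume e: "stop k e" "m1 acur 0 = e mod N" and f: "f \<in> cl (q (m1 acur 0))"
            "m0 aGroup f = m0 aGroup (m1 acur 0)"
            "walk_cost T + m0 aPos f \<le> classes_cost (q (m1 acur 0)) + r + m0 aPos (m1 acur 0)"
        let ?c = "m1 acur 0"
        have C: "?c \<in> {1..n}" "?c \<in> cl (q ?c)" using stop_client[OF e(1)] e(2) by auto
        note Q = q[OF C(1)]
        have "m0 aPos ?c \<le> m0 aPos f + X (q ?c)" using ok[OF conjunct1[OF Q]] C(2) f by (simp add: class_ok_def)
        moreover have "dist ?c 0 \<le> r" using r[OF cN] dist.d_sym[of ?c 0] cN N_pos by simp
        moreover have "classes_cost (q ?c) + class_cost (q ?c) \<le> classes_cost N"
          using Q N by (intro classes_cost_step) auto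
        ultimately show ?thesis using f(3) p(2) by (simp add: class_cost_def)
      qed
    qed
    moreover have "length (T @ p) \<le> K" "length J \<le> K"
      using lT p(4) TJ(5) K_ge(3) by (simp_all add: mult.assoc)
    moreover have "stores_clients m2 J" using TJ(2) by (simp add: stores_clients_def m2)
    ultimately show ?case unfolding s2 o2 using p(3)
      by (intro wp_mono_frame[OF write_day[where T = "T @ p" and J = J]]) auto
  qed (use lT cN N_pos in auto)
qed (use k in auto)

end

section \<open>Composing the phases\<close>

definition main_part :: com where
  "main_part = distances ;; turnovers ;; classes ;; Write (Var aP) ;; For i1 (Var aP) day"

lemma algorithm_split:
  assumes "wp K B init (wp K B main_part Q) s"
  shows "wp K B algorithm Q s"
proof -
  have "algorithm = init ;; main_part" by (simp add: algorithm_def main_part_def)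
  then show ?thesis using wp_Seq[OF assms] by simp
qed

context phases
begin

definition radius :: nat where
  "radius = (MAX v \<in> {..<N}. dist 0 v)"

lemma dist_le_radius: "v < N \<Longrightarrow> dist 0 v \<le> radius"
  unfolding radius_def by (rule Max_ge) auto

text \<open>Rounded values, tables and piece lengths are known only during the run; hiding them
  existentially gives a postcondition about the output alone.\<close>

definition good_schedule :: "((nat \<times> nat) list \<times> nat list) list \<Rightarrow> bool" where
  "good_schedule D \<longleftrightarrow> (\<exists>q m0 X. scheduling n N K B G w big A q m0 X radius \<and>
     is_period n (length D) \<and> (\<forall>v \<in> {1..n}. is_period (A v) (q v)) \<and>
     (\<forall>k < length D. scheduling.good_day n N G w q m0 X radius k (D ! k)))"

lemma main_part:
  assumes m: "m aN 0 = N" "m aNN 0 = N * N" "\<forall>e < N * N. m aW e = w (e div N) (e mod N)"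
    "\<forall>e < N * N. m aDist e = sp 0 (e div N) (e mod N)" "m 0 = A" "\<And>v. m aIn v = 0"
  shows "wp K B main_part (\<lambda>(m', out). \<exists>D. good_schedule D \<and>
     out = length D # concat (map encode_day D)) (m, [])"
  unfolding main_part_def
proof (rule wp_Seq, rule wp_mono_frame[OF distances[OF m(1-4)]], goal_cases)
  case (1 s1)
  obtain m1 o1 where s1: "s1 = (m1, o1)" by (cases s1)
  have o1: "o1 = []" using 1(2) by (simp add: frame_def s1 distances_def)
  note f1 = frameD[OF 1(2), unfolded writes_distances s1, simplified]
  have m1: "m1 aN 0 = N" "m1 aNN 0 = N * N" "m1 0 = A" "\<And>v. m1 aIn v = 0" using m by (simp_all add: f1)
  show ?case unfolding s1 o1
  proof (rule wp_Seq, rule wp_mono_frame[OF turnovers[OF m1(1,3)]], goal_cases)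
    case (1 s2)
    note d1 = \<open>case s1 of (m', out') \<Rightarrow> _ m' out'\<close>[unfolded s1 prod.case]
    obtain m2 o2 where s2: "s2 = (m2, o2)" by (cases s2)
    have o2: "o2 = []" using 1(2) by (simp add: frame_def s2 turnovers_def)
    note f2 = frameD[OF 1(2), unfolded writes_turnovers s2, simplified]
    have m2: "m2 aN 0 = N" "m2 aNN 0 = N * N" "m2 0 = A" "\<And>v. m2 aIn v = 0"
      "m2 aDist = m1 aDist" "m2 aHop = m1 aHop" using m1 by (simp_all add: f2)
    have per: "is_period n (m2 aP 0)" "\<forall>j \<in> {1..n}. is_period (A j) (m2 aQ j)" and q0: "m2 aQ 0 = 0"
      using 1(1) by (auto simp: s2)
    \<comment> \<open>The rounded turnover times exist only as memory contents, so the locale is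
      entered in the middle of the run with these as parameter.\<close>
    interpret clustering n N K B G w big A "m2 aQ" by unfold_locales (rule q0)
    have r2: "ready m2" using m2 d1 by (simp add: ready_def)
    show ?case unfolding s2 o2
    proof (rule wp_Seq, rule wp_mono_frame[OF classes[OF r2 m2(4)]], goal_cases)
      case (1 s3)
      obtain m3 o3 where s3: "s3 = (m3, o3)" by (cases s3)
      have o3: "o3 = []"
        using 1(2) by (simp add: frame_def s3 classes_def assign_groups_def attach_def nearest_def shift_def)
      note f3 = frameD[OF 1(2), unfolded writes_classes s3, simplified]
      have m3: "m3 aN = m2 aN" "m3 aNN = m2 aNN" "m3 0 = m2 0" "m3 aDist = m2 aDist" "m3 aHop = m2 aHop"
        "m3 aQ = m2 aQ" "m3 aP = m2 aP" by (simp_all add: f3)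
      have r3: "ready m3" by (rule ready_cong[OF r2]) (simp_all add: m3)
      have "\<forall>p \<in> {1..n}. \<exists>X. class_ok m3 p X" using 1(1) by (simp add: s3)
      then obtain X where X: "\<And>p. p \<in> {1..n} \<Longrightarrow> class_ok m3 p (X p)" by metis
      have sch: "scheduling n N K B G w big A (m2 aQ) m3 X radius"
      proof (unfold_locales, goal_cases)
        case 1 show ?case by (rule r3)
      next
        case (2 k u v)
        then show ?case using d1 unfolding m3 m2 by blast
      next
        case (3 v)
        then show ?case using per(2) by (force simp: is_period_def power_of_two_def)
      next
        case (4 p) then show ?case by (rule X)
      next
        case (5 v) then show ?case by (rule dist_le_radius)
      qed
      interpret scheduling n N K B G w big A "m2 aQ" m3 X radius by (rule sch)
      have P: "m3 aP 0 \<le> N" using per(1) N by (auto simp: m3 is_period_def)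
      show ?case unfolding s3 o3
      proof (rule wp_Seq, rule wp_Write[OF B_pos], rule wp_For[where I = "\<lambda>h m out. \<exists>D. length D = h \<and>
            out = m3 aP 0 # concat (map encode_day D) \<and> (\<forall>k < h. good_day k (D ! k))"
            and h = "m3 aP 0", OF B_pos], goal_cases)
        case (5 m out)
        then have "m aP = m3 aP" by (auto simp: frame_def writes_day)
        then show ?case by simp
      next
        case (7 h m out)
        obtain D where D: "length D = h" "out = m3 aP 0 # concat (map encode_day D)" "\<forall>k < h. good_day k (D ! k)"
          using 7(2) by blast
        have "agree m" using 7(4) by (auto simp: frame_def writes_day agree_def)
        from day[OF this 7(3), of out] show ?case
        proof (rule wp_mono_frame, clarify)
          fix m' out' T J assume "good_day h (T, J)"
          then show "\<exists>D'. length D' = Suc h \<and>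
            out @ encode_day (T, J) = m3 aP 0 # concat (map encode_day D') \<and> (\<forall>k < Suc h. good_day k (D' ! k))"
            using D by (intro exI[of _ "D @ [(T, J)]"]) (auto simp: nth_append less_Suc_eq)
        qed
      next
        case (8 m out)
        then obtain D where D: "length D = m3 aP 0" "out = m3 aP 0 # concat (map encode_day D)"
          "\<forall>k < m3 aP 0. good_day k (D ! k)" by blast
        then have "good_schedule D"
          unfolding good_schedule_def using sch per by (intro exI[of _ "m2 aQ"] exI[of _ m3] exI[of _ X]) (simp add: m3)
        then show ?case using D by auto
      qed (use P K_ge(1) in \<open>auto intro: less_B simp: writes_day\<close>)
    qed
  qed
qed

end

section \<open>Instances as program inputs\<close>

lemma nth_concat_map_const:
  assumes "\<And>x. length (f x) = c" "i < length xs" "j < c"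
  shows "concat (map f xs) ! (c * i + j) = f (xs ! i) ! j"
  using assms(2)
proof (induction xs arbitrary: i)
  case (Cons x xs)
  show ?case
  proof (cases i)
    case 0 then show ?thesis using assms(1,3) by (simp add: nth_append)
  next
    case (Suc i')
    then have "c * i + j = length (f x) + (c * i' + j)" using assms(1) by simp
    then show ?thesis using Cons Suc by (simp only: list.map concat.simps nth_append_length_plus) simp
  qed
qed simp

lemma length_concat_map_const: "(\<And>x. length (f x) = c) \<Longrightarrow> length (concat (map f xs)) = c * length xs"
  by (induction xs) auto

lemma length_encode_entry: "length (encode_entry I e) = 3"
  by (simp add: encode_entry_def)

locale input =
  fixes I :: rftt
  assumes inst: "rftt_instance I"
begin

abbreviation n where "n \<equiv> clients I"
abbreviation xs where "xs \<equiv> encode_instance I"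
abbreviation S where "S \<equiv> input_size xs"
abbreviation K where "K \<equiv> S\<^sup>2"
abbreviation B where "B \<equiv> (S + 3)\<^sup>2"

definition N :: nat where
  "N = Suc n"

definition A :: "nat \<Rightarrow> nat" where
  "A = input_memory xs 0"

lemma xs_split: "xs = (n # map (turnover I) [1..<N]) @
    concat (map (encode_entry I) (List.product [0..<N] [0..<N]))"
  by (simp add: encode_instance_def N_def del: upt_Suc)

lemma length_xs: "length xs = N + 3 * (N * N)"
proof -
  have "length (n # map (turnover I) [1..<N]) = N" by (simp add: N_def del: upt_Suc)
  moreover have "length xs = length (n # map (turnover I) [1..<N])
      + length (concat (map (encode_entry I) (List.product [0..<N] [0..<N])))"
    by (subst xs_split) (rule length_append)
  ultimately show ?thesis by (simp add: length_concat_map_const[where c = 3] length_encode_entry)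
qed

lemma A_0: "A 0 = n"
  by (simp add: A_def input_memory_def xs_split)

lemma A_turnover: "v \<in> {1..n} \<Longrightarrow> A v = turnover I v"
proof -
  assume v: "v \<in> {1..n}"
  then have "v < length xs" by (simp add: length_xs N_def)
  moreover have "xs ! v = (n # map (turnover I) [1..<N]) ! v"
    using v by (subst xs_split, subst nth_append) (auto simp: N_def simp del: upt_Suc)
  moreover have "(n # map (turnover I) [1..<N]) ! v = turnover I v"
    using v by (auto simp: N_def nth_Cons' simp del: upt_Suc)
  ultimately show ?thesis by (simp add: A_def input_memory_def)
qed

lemma A_entry:
  assumes "u < N" "v < N" "j < 3"
  shows "A (N + 3 * (u * N + v) + j) = encode_entry I (u, v) ! j"
proof -
  have e: "u * N + v < N * N"
  proof -
    have "u * N + v < Suc u * N" using assms(2) by simp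
    also have "\<dots> \<le> N * N" using assms by (intro mult_le_mono1) simp
    finally show ?thesis .
  qed
  moreover have "N + (3 * x + j) < N + 3 * y" if "x < y" for x y using that assms(3) by simp
  ultimately have "N + (3 * (u * N + v) + j) < length xs" unfolding length_xs by blast
  moreover have "xs ! (N + (3 * (u * N + v) + j))
      = concat (map (encode_entry I) (List.product [0..<N] [0..<N])) ! (3 * (u * N + v) + j)"
  proof -
    have "length (n # map (turnover I) [1..<N]) = N" by (simp add: N_def del: upt_Suc)
    then show ?thesis unfolding xs_split by (metis nth_append_length_plus)
  qed
  moreover have "\<dots> = encode_entry I (List.product [0..<N] [0..<N] ! (u * N + v)) ! j"
    using assms e by (intro nth_concat_map_const) (simp_all add: length_encode_entry)
  moreover have "List.product [0..<N] [0..<N] ! (u * N + v) = (u, v)"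
    using assms e by (subst product_nth) simp_all
  ultimately show ?thesis by (simp only: A_def input_memory_def add.assoc if_True simp_thms)
qed

lemma sum_bits_ge: "x \<in> set ys \<Longrightarrow> bits x \<le> (\<Sum>x\<leftarrow>ys. bits x)" for ys
  by (induction ys) auto

lemma sum_bits_length: "length ys \<le> (\<Sum>x\<leftarrow>ys. bits x)" for ys
proof (induction ys)
  case (Cons y ys) then show ?case using bits_pos[of y] by simp
qed simp

lemma A_less_power: "A i < 2 ^ S"
proof (cases "i < length xs")
  case True
  have "xs ! i < 2 ^ bits (xs ! i)" by (rule less_power_bits)
  also have "\<dots> \<le> 2 ^ S" using True sum_bits_ge[of "xs ! i" xs]
    by (intro power_increasing) (auto simp: input_size_def)
  finally show ?thesis using True by (simp add: A_def input_memory_def)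
qed (simp add: A_def input_memory_def)

lemma S_ge: "N + 3 * (N * N) \<le> S"
  using sum_bits_length[of xs] by (simp add: input_size_def length_xs)

lemma NN_le: "N * N \<le> S" using S_ge by simp

sublocale resources n N K B
proof
  \<comment> \<open>The matrix occupies three cells per pair of vertices; two of them suffice, and
    squaring \<open>2 * (N * N)\<close> leaves room for the extra \<open>N\<close>.\<close>
  have "N * N + N * N \<le> S" using S_ge by simp
  then have "(N * N + N * N) * (N * N + N * N) \<le> S * S" by (intro mult_le_mono)
  moreover have "N * N * N * N + N \<le> (N * N + N * N) * (N * N + N * N)"
  proof -
    have "(N * N + N * N) * (N * N + N * N) = N * N * N * N + 3 * (N * N * N * N)" by (simp only: algebra_simps)
    moreover have "N * 1 \<le> N * (N * N * N)" by (intro mult_le_mono) (auto simp: N_def)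
    then have "N \<le> N * N * N * N" by (simp only: mult.assoc mult_1_right)
    ultimately show ?thesis by linarith
  qed
  ultimately show "N * N * N * N + N \<le> K" by (simp only: power2_eq_square)
  have "S < 2 ^ S" by simp
  then have "S * S < 2 ^ S * 2 ^ S" by (intro mult_strict_mono) auto
  also have "\<dots> = 2 ^ (2 * S)" by (simp add: mult_2 power_add)
  also have "\<dots> \<le> 2 ^ B" by (intro power_increasing) (auto simp: power2_eq_square algebra_simps)
  finally show "K < 2 ^ B" by (simp add: power2_eq_square)
qed (rule N_def)

lemma power_S: "N < 2 ^ S" "N * N < 2 ^ S"
proof -
  have "S < 2 ^ S" by simp
  then show "N < 2 ^ S" "N * N < 2 ^ S" using S_ge by linarith+
qed

sublocale scaling n N K B A "2 ^ S"
proof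
  show "A 0 = n" by (rule A_0)
  show "A i < 2 ^ S" for i by (rule A_less_power)
  have "(2 ^ S) ^ (N * N) = (2 :: nat) ^ (S * (N * N))" by (simp only: power_mult)
  also have "\<dots> < 2 ^ B"
  proof (rule power_strict_increasing)
    have "S * (N * N) \<le> S * S" using NN_le by (intro mult_le_mono) auto
    also have "\<dots> < B" by (simp add: power2_eq_square algebra_simps)
    finally show "S * (N * N) < B" .
  qed simp
  finally show "(2 ^ S) ^ (N * N) < (2 :: nat) ^ B" .
  have "N * N * 2 ^ S < 2 ^ S * 2 ^ S" using power_S by (intro mult_strict_right_mono) auto
  also have "\<dots> = 2 ^ (2 * S)" by (simp add: mult_2 power_add)
  also have "\<dots> \<le> 2 ^ B" by (intro power_increasing) (auto simp: power2_eq_square algebra_simps)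
  finally show "N * N * 2 ^ S < 2 ^ B" .
qed

text \<open>The scale is a product of \<open>N * N \<le> S\<close> factors below
  \<open>2 ^ S\<close>, which forces the term \<open>S * S\<close> in the exponent; everything else
  adds \<open>4 * S + 3\<close>. The shape of \<open>B\<close> comes from here.\<close>

lemma large_less: "4 * N * large < 2 ^ B"
proof -
  have "scale (N * N) \<le> 2 ^ (S * S)"
  proof -
    have "scale (N * N) \<le> (2 ^ S) ^ (N * N)" by (rule scale_le) simp
    also have "\<dots> = (2 :: nat) ^ (S * (N * N))" by (simp only: power_mult)
    also have "\<dots> \<le> 2 ^ (S * S)" using NN_le by (intro power_increasing mult_le_mono) auto
    finally show ?thesis .
  qed
  moreover have "num_sum (N * N) \<le> 2 ^ S * 2 ^ S"
  proof -
    have "num_sum (N * N) \<le> N * N * 2 ^ S" by (rule num_sum_le) simp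
    also have "\<dots> \<le> 2 ^ S * 2 ^ S" using power_S by (intro mult_le_mono1) simp
    finally show ?thesis .
  qed
  ultimately have "N * scale (N * N) * num_sum (N * N) \<le> 2 ^ S * 2 ^ (S * S) * (2 ^ S * 2 ^ S)"
    using power_S by (intro mult_le_mono) auto
  moreover have "1 \<le> (2 ^ S * 2 ^ (S * S) * (2 ^ S * 2 ^ S) :: nat)" by simp
  ultimately have "large \<le> 2 * (2 ^ S * 2 ^ (S * S) * (2 ^ S * 2 ^ S))"
    unfolding large_def by linarith
  then have "4 * N * large \<le> 4 * 2 ^ S * (2 * (2 ^ S * 2 ^ (S * S) * (2 ^ S * 2 ^ S)))"
    using power_S by (intro mult_le_mono) auto
  also have "\<dots> = 2 ^ (S * S + 4 * S + 3)" 
  proof -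
    have "(2::nat) ^ (4 * S) = (2 ^ S) ^ 4" by (metis mult.commute power_mult)
    then show ?thesis by (simp add: power_add power4_eq_xxxx)
  qed
  also have "\<dots> < 2 ^ B" by (intro power_strict_increasing) (auto simp: power2_eq_square algebra_simps)
  finally show ?thesis .
qed

section \<open>Exactness of the scaled weights\<close>

abbreviation arcs where "arcs \<equiv> parcs (graph I)"

definition num :: "nat \<times> nat \<Rightarrow> nat" where "num e = nat (fst (quotient_of (weight I e)))"
definition den :: "nat \<times> nat \<Rightarrow> nat" where "den e = nat (snd (quotient_of (weight I e)))"
definition D :: nat where "D = scale (N * N)"

definition wt :: "nat \<Rightarrow> nat \<Rightarrow> nat" where
  "wt u v = (if u = v then 0 else if (u, v) \<in> arcs then num (u, v) * (D div den (u, v)) else large)"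

lemma graph_facts:
  "pair_graph (graph I)" "pverts (graph I) = {..<N}" "Digraph_Component.connected (with_proj (graph I))"
  "(u, v) \<in> arcs \<Longrightarrow> 0 \<le> weight I (u, v) \<and> weight I (u, v) = weight I (v, u)"
  "v \<in> {1..n} \<Longrightarrow> 1 \<le> turnover I v"
  using inst by (auto simp: rftt_instance_def N_def)

sublocale g: pair_graph "graph I" by (rule graph_facts)

lemma arc_less: "(u, v) \<in> arcs \<Longrightarrow> u < N \<and> v < N"
  using g.in_arcsD1[of u v] g.in_arcsD2[of u v] graph_facts(2) by auto

lemma A_entries:
  assumes "u < N" "v < N"
  shows "A (N + 3 * (u * N + v)) \<noteq> 0 \<longleftrightarrow> (u, v) \<in> arcs"
    "(u, v) \<in> arcs \<Longrightarrow> A (N + 3 * (u * N + v) + 1) = num (u, v)"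
    "(u, v) \<in> arcs \<Longrightarrow> A (N + 3 * (u * N + v) + 2) = den (u, v)"
  using A_entry[OF assms, of 0] A_entry[OF assms, of 1] A_entry[OF assms, of 2]
  by (simp_all only: encode_entry_def num_def den_def) (auto simp: numeral_2_eq_2)

lemma den_pos: "0 < den e"
  using quotient_of_denom_pos' by (simp add: den_def)

text \<open>The denominator is one of the factors of \<open>D\<close>, so the integer division made
  by the program is exact.\<close>

lemma den_dvd: "(u, v) \<in> arcs \<Longrightarrow> den (u, v) dvd D"
proof -
  assume a: "(u, v) \<in> arcs"
  note l = arc_less[OF a]
  let ?f = "\<lambda>e. if A (N + 3 * e) \<noteq> 0 then A (N + 3 * e + 2) else 1"
  have "?f (u * N + v) dvd D" unfolding D_def scale_def
    using l idx_less[of u v] by (intro dvd_prodI) auto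
  then show ?thesis using A_entries[of u v] l a by simp
qed

lemma D_pos: "0 < D"
proof -
  have "0 < A (N + 3 * e + 2)" if "e < N * N" "A (N + 3 * e) \<noteq> 0" for e
  proof -
    have l: "e div N < N" "e mod N < N" using div_less[OF that(1)] by auto
    have e: "e div N * N + e mod N = e" by simp
    show ?thesis using A_entries[OF l, unfolded e] that(2) den_pos by metis
  qed
  then show ?thesis unfolding D_def scale_def by (intro prod_pos) auto
qed

lemma flat_weight_eq: "e < N * N \<Longrightarrow> flat_weight e = wt (e div N) (e mod N)"
proof -
  assume e: "e < N * N"
  have l: "e div N < N" "e mod N < N" using div_less[OF e] by auto
  have "e div N * N + e mod N = e" by simp
  note A = A_entries[OF l, unfolded this]
  show ?thesis
  proof (cases "(e div N, e mod N) \<in> arcs")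
    case True then show ?thesis using A by (simp only: flat_weight_def wt_def D_def simp_thms if_True)
  next
    case False then show ?thesis using A by (simp only: flat_weight_def wt_def simp_thms if_False)
  qed
qed

lemma num_le: "(u, v) \<in> arcs \<Longrightarrow> num (u, v) \<le> num_sum (N * N)"
  using arc_less A_entries(2) num_le_sum idx_less by metis

sublocale int_weighted_graph "graph I" n N wt large
proof
  show "(u, v) \<in> arcs \<Longrightarrow> wt u v = wt v u" for u v
    using graph_facts(4) g.arcs_symmetric by (auto simp: wt_def num_def den_def)
  show "N * wt u v < large" if "(u, v) \<in> arcs" for u v
  proof -
    have "wt u v \<le> num_sum (N * N) * D"
      using num_le[OF that] that by (auto simp: wt_def intro: mult_le_mono)
    then have "N * wt u v \<le> N * (num_sum (N * N) * D)" by (rule mult_le_mono2)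
    also have "\<dots> = N * scale (N * N) * num_sum (N * N)" by (simp add: D_def)
    finally show ?thesis unfolding large_def by linarith
  qed
  show "0 < large" by (simp add: large_def)
qed (use graph_facts in \<open>auto simp: wt_def N_def\<close>)

sublocale phases n N K B "graph I" wt large A
  by unfold_locales (rule A_0, rule large_less)

lemma weight_real:
  assumes "(u, v) \<in> arcs"
  shows "real (wt u v) = real D * of_rat (weight I (u, v))"
proof -
  obtain a b where ab: "quotient_of (weight I (u, v)) = (a, b)" by (cases "quotient_of (weight I (u, v))")
  have b: "0 < b" using quotient_of_denom_pos[OF ab] .
  have wq: "weight I (u, v) = of_int a / of_int b" using quotient_of_div[OF ab] .
  have "0 \<le> rat_of_int a / rat_of_int b" using graph_facts(4)[OF assms] wq by simp
  then have a: "0 \<le> a" using b by (auto simp: zero_le_divide_iff)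
  have "u \<noteq> v" using assms g.no_loops' by blast
  then have "real (wt u v) = real (num (u, v)) * (real D / real (den (u, v)))"
    using assms den_dvd[OF assms] by (simp add: wt_def real_of_nat_div)
  also have "\<dots> = real D * (of_int a / of_int b)"
    using a b by (simp add: num_def den_def ab)
  finally show ?thesis by (simp add: wq of_rat_divide)
qed

lemma tour_cost_real: "set T \<subseteq> arcs \<Longrightarrow> real D * tour_cost I T = real (walk_cost T)"
proof (induction T)
  case (Cons e T)
  then show ?case using weight_real[of "fst e" "snd e"]
    by (cases e) (simp add: tour_cost_def distrib_left)
qed (simp add: tour_cost_def)

lemma runs_good_schedule:
  obtains t Ds where "runs algorithm xs t (encode_schedule Ds)" "good_schedule Ds"
    "t \<le> time_bound K B algorithm"
proof -
  let ?m = "input_memory xs"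
  have "wp K B init (\<lambda>(m', out'). m' aN 0 = N \<and> m' aNN 0 = N * N \<and>
      (\<forall>e < N * N. m' aW e = flat_weight e \<and>
      m' aDist e = (if e div N = e mod N then 0 else large))) (?m, [])"
    by (rule init) (simp_all add: big_less_B, simp add: A_def)
  then have "wp K B init (wp K B main_part (\<lambda>(m', out). \<exists>D. good_schedule D \<and>
     out = length D # concat (map encode_day D))) (?m, [])"
  proof (rule wp_mono_frame)
    fix s' assume Q: "case s' of (m', out') \<Rightarrow> m' aN 0 = N \<and> m' aNN 0 = N * N \<and>
      (\<forall>e < N * N. m' aW e = flat_weight e \<and>
      m' aDist e = (if e div N = e mod N then 0 else large))" and f: "frame init (?m, []) s'"
    obtain m' out' where s': "s' = (m', out')" by (cases s')
    have w: "writes init = {aN, aNN, aD, aS, aBig, i1, aW, aDist}"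
      by (auto simp: init_def writes_init)
    have m': "m' 0 = A" "m' aIn v = 0" for v
      using frameD[OF f, of 0] frameD[OF f, of aIn] by (auto simp: w s' A_def input_memory_def)
    have o': "out' = []" using f by (simp add: frame_def s' init_def scale_loop_def weight_loop_def)
    show "wp K B main_part (\<lambda>(m', out). \<exists>D. good_schedule D \<and>
      out = length D # concat (map encode_day D)) s'"
      unfolding s' o' using Q m' by (intro main_part) (auto simp: s' flat_weight_eq)
  qed
  then have "wp K B algorithm (\<lambda>(m', out). \<exists>D. good_schedule D \<and>
     out = length D # concat (map encode_day D)) (?m, [])" by (rule algorithm_split)
  moreover have "bounded B (?m, [])"
  proof -
    have "(2::nat) ^ S \<le> 2 ^ B" by (intro power_increasing) (auto simp: power2_eq_square algebra_simps)
    then have "A i < 2 ^ B" for i using A_less_power[of i] by (rule less_le_trans[rotated])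
    then have "input_memory xs a i < 2 ^ B" for a i
      by (cases "a = 0") (simp_all add: A_def input_memory_def)
    then show ?thesis by (simp add: bounded_def)
  qed
  ultimately obtain t m' out Ds where "exec algorithm (?m, []) t (m', out)" "t \<le> time_bound K B algorithm"
     "good_schedule Ds" "out = length Ds # concat (map encode_day Ds)"
    unfolding wp_def by auto
  moreover have "encode_schedule Ds = length Ds # concat (map encode_day Ds)"
    by (simp add: encode_schedule_def encode_list_def encode_day_def)
  ultimately show ?thesis using that unfolding runs_def by metis
qed

end

section \<open>Lower bounds on the optimum\<close>

text \<open>Going back by whole periods reduces every day to one of the first \<open>P\<close>.
  Without finiteness the \<open>MAX\<close> in \<open>max_cost\<close> would be unspecified.\<close>

lemma finite_tours:
  assumes "solution I Sol"
  shows "finite ((\<lambda>k. tour_cost I (tour Sol k)) ` {1..})"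
proof -
  obtain P where P: "P \<ge> 1" "\<And>k. k \<ge> 1 \<Longrightarrow> tour Sol (k + P) = tour Sol k"
    using assms unfolding solution_def by blast
  have red: "\<exists>k' \<in> {1..P}. tour Sol k = tour Sol k'" if "1 \<le> k" for k
    using that
  proof (induction k rule: less_induct)
    case (less k)
    show ?case
    proof (cases "k \<le> P")
      case True then show ?thesis using less.prems by (intro bexI[of _ k]) auto
    next
      case False
      then have "tour Sol k = tour Sol (k - P)" using P(2)[of "k - P"] by simp
      then show ?thesis using less.IH[of "k - P"] False P(1) by simp
    qed
  qed
  have "(\<lambda>k. tour_cost I (tour Sol k)) ` {1..} \<subseteq> (\<lambda>k. tour_cost I (tour Sol k)) ` {1..P}"
  proof
    fix c assume "c \<in> (\<lambda>k. tour_cost I (tour Sol k)) ` {1..}"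
    then obtain k where k: "1 \<le> k" "c = tour_cost I (tour Sol k)" by auto
    obtain k' where "k' \<in> {1..P}" "tour Sol k = tour Sol k'" using red[OF k(1)] by blast
    then show "c \<in> (\<lambda>k. tour_cost I (tour Sol k)) ` {1..P}" using k(2) by simp
  qed
  then show ?thesis by (rule finite_subset) simp
qed

lemma tour_cost_le_max_cost:
  "solution I Sol \<Longrightarrow> 1 \<le> k \<Longrightarrow> tour_cost I (tour Sol k) \<le> max_cost I Sol"
  unfolding max_cost_def by (rule Max_ge[OF finite_tours]) auto

text \<open>Powers of two form a chain under divisibility. Applied to the period, it makes the
  period a common multiple of all rounded turnover times.\<close>

lemma power_of_two_dvd: "power_of_two p \<Longrightarrow> power_of_two p' \<Longrightarrow> p < 2 * p' \<Longrightarrow> p dvd p'"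
proof -
  assume "power_of_two p" "power_of_two p'" and l: "p < 2 * p'"
  then obtain a b where ab: "p = 2 ^ a" "p' = 2 ^ b" by (auto simp: power_of_two_def)
  then have "(2::nat) ^ a < 2 ^ Suc b" using l by simp
  then have "a \<le> b" by (simp only: power_strict_increasing_iff)
  then show ?thesis using ab by (simp add: le_imp_power_dvd)
qed

lemma card_powers_of_two: "card {x. 1 \<le> x \<and> x < Suc n \<and> power_of_two x} \<le> floorlog 2 n"
proof -
  have "{x. 1 \<le> x \<and> x < Suc n \<and> power_of_two x} \<subseteq> (\<lambda>l. 2 ^ l) ` {..<floorlog 2 n}"
  proof
    fix x assume x: "x \<in> {x. 1 \<le> x \<and> x < Suc n \<and> power_of_two x}"
    then obtain l where l: "x = 2 ^ l" by (auto simp: power_of_two_def)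
    have "(2::nat) ^ l \<le> n" using x l by simp
    also have "n < 2 ^ floorlog 2 n" using floorlog_bounds[of n 2] x by (cases "n = 0") auto
    finally have "l < floorlog 2 n" by simp
    then show "x \<in> (\<lambda>l. 2 ^ l) ` {..<floorlog 2 n}" using l by simp
  qed
  then have "card {x. 1 \<le> x \<and> x < Suc n \<and> power_of_two x} \<le> card ((\<lambda>l. 2 ^ l :: nat) ` {..<floorlog 2 n})"
    by (rule card_mono[rotated]) simp
  also have "\<dots> \<le> card {..<floorlog 2 n}" by (rule card_image_le) simp
  finally show ?thesis by simp
qed

context input
begin

lemma solution_walk:
  assumes "solution I Sol" "1 \<le> k"
  shows "g.awalk 0 (tour Sol k) 0" "visited Sol k \<subseteq> {1..n} \<inter> set (pawalk_verts 0 (tour Sol k))"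
  using assms by (auto simp: solution_def)

lemma walk_cost_le_max_cost:
  assumes "solution I Sol" "1 \<le> k"
  shows "real (walk_cost (tour Sol k)) \<le> real D * max_cost I Sol"
proof -
  have "set (tour Sol k) \<subseteq> arcs" using solution_walk(1)[OF assms] by auto
  then have "real (walk_cost (tour Sol k)) = real D * tour_cost I (tour Sol k)" by (simp add: tour_cost_real)
  also have "\<dots> \<le> real D * max_cost I Sol"
    using tour_cost_le_max_cost[OF assms] by (intro mult_left_mono) auto
  finally show ?thesis .
qed

lemma max_cost_nonneg: "solution I Sol \<Longrightarrow> 0 \<le> real D * max_cost I Sol"
  using walk_cost_le_max_cost[of Sol 1] by (meson le_refl of_nat_0_le_iff order_trans)

text \<open>The farthest client is visited on some day, and that tour splits there into a way out
  and a way back, each at least as long as the distance.\<close>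

lemma radius_bound:
  assumes "feasible I Sol"
  shows "2 * real radius \<le> real D * max_cost I Sol"
proof -
  have sol: "solution I Sol" using assms by (simp add: feasible_def)
  have "radius \<in> (\<lambda>v. dist 0 v) ` {..<N}" unfolding radius_def
    by (rule Max_in) (auto simp: lessThan_empty_iff N_def)
  then obtain v where v: "v < N" "radius = dist 0 v" by auto
  show ?thesis
  proof (cases "v = 0")
    case True
    then have "radius = 0" using v dist.d_diag[of 0] by simp
    then show ?thesis using max_cost_nonneg[OF sol] by simp
  next
    case False
    then have "v \<in> {1..n}" using v(1) by (simp add: N_def)
    then have "v \<in> (\<Union>k \<in> {0 + 1..0 + turnover I v}. visited Sol k)"
      using assms unfolding feasible_def by blast
    then obtain k where k: "1 \<le> k" "v \<in> visited Sol k" by auto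
    note w = solution_walk[OF sol k(1)]
    have "v \<in> set (pawalk_verts 0 (tour Sol k))" using w(2) k(2) by auto
    then obtain p q where pq: "tour Sol k = p @ q" "g.awalk 0 p v" "g.awalk v q 0"
      using g.awalk_decomp[OF w(1)] by (metis g.awalk_append_iff)
    have "dist 0 v \<le> walk_cost p" "dist v 0 \<le> walk_cost q"
      using pq by (auto intro: dist_le_walk_cost)
    moreover have "dist v 0 = dist 0 v" using v(1) by (intro dist.d_sym) (auto simp: N_def)
    ultimately have "2 * radius \<le> walk_cost (tour Sol k)" using v(2) pq(1) by simp
    then show ?thesis using walk_cost_le_max_cost[OF sol k(1)] by linarith
  qed
qed

text \<open>Read as vertex sequences, tours already form a cover. Days come as a list because one
  day may be chosen for several clients.\<close>

lemma cover_by_days: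
  assumes sol: "solution I Sol" and ks: "\<forall>k \<in> set ks. 1 \<le> k" "C \<subseteq> (\<Union>k \<in> set ks. visited Sol k)"
  shows "\<exists>Q. covers {..<N} {0} C Q \<and> real (paths_cost dist Q) \<le> length ks * (real D * max_cost I Sol)"
proof (intro exI conjI)
  let ?Q = "map (\<lambda>k. pawalk_verts 0 (tour Sol k)) ks"
  show "covers {..<N} {0} C ?Q"
    unfolding covers_def
  proof (intro conjI ballI)
    fix qs assume "qs \<in> set ?Q"
    then obtain k where k: "1 \<le> k" "qs = pawalk_verts 0 (tour Sol k)" using ks(1) by auto
    note w = solution_walk(1)[OF sol k(1)]
    have "set qs \<subseteq> pverts (graph I)" "hd qs = 0"
      using w unfolding g.awalk_conv k(2) by blast+
    then show "qs \<noteq> []" "hd qs \<in> {0}" "set qs \<subseteq> {..<N}"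
      using g.awalk_verts_non_Nil k(2) graph_facts(2) by simp_all
  next
    show "C \<subseteq> (\<Union>q \<in> set ?Q. set q)" using ks solution_walk(2)[OF sol] by fastforce
  qed
  show "real (paths_cost dist ?Q) \<le> length ks * (real D * max_cost I Sol)"
    using ks(1)
  proof (induction ks)
    case (Cons k ks)
    then have k: "1 \<le> k" by simp
    have "real (path_cost dist (pawalk_verts 0 (tour Sol k))) \<le> real (walk_cost (tour Sol k))"
      using path_cost_awalk_verts[OF solution_walk(1)[OF sol k]] by simp
    also have "\<dots> \<le> real D * max_cost I Sol" by (rule walk_cost_le_max_cost[OF sol k])
    finally show ?case using Cons by (simp add: distrib_right)
  qed simp
qed

end

section \<open>Feasibility and cost of the schedule\<close>

locale scheduled_input = input + scheduling n N K B "graph I" wt large A q m0 X radius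
  for q m0 X +
  assumes period: "\<And>v. v \<in> {1..n} \<Longrightarrow> is_period (A v) (q v)"
begin

lemma period_turnover:
  assumes "v \<in> {1..n}"
  shows "q v \<le> turnover I v" "turnover I v < 2 * q v \<or> n < 2 * q v"
  using period[OF assms] A_turnover[OF assms] graph_facts(5)[OF assms] by (auto simp: is_period_def)

lemma class_cover:
  assumes f: "feasible I Sol" and p: "p \<in> {1..n}"
  shows "\<exists>Q. covers {..<N} {0} (cl p) Q \<and> real (paths_cost dist Q) \<le> 2 * real p * (real D * max_cost I Sol)"
proof -
  have sol: "solution I Sol" using f by (simp add: feasible_def)
  have cl: "v \<in> {1..n} \<and> q v = p" if "v \<in> cl p" for v
  proof -
    have v: "q v = p" "v < N" using that by (simp_all add: cl_def)
    then have "v \<noteq> 0" using p q0 by (metis atLeastAtMost_iff not_one_le_zero)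
    then show ?thesis using v by (simp add: N_def)
  qed
  have vis: "\<exists>k. 1 \<le> k \<and> k \<le> turnover I v \<and> v \<in> visited Sol k" if "v \<in> {1..n}" for v
  proof -
    have "v \<in> (\<Union>k \<in> {0 + 1..0 + turnover I v}. visited Sol k)"
      using f that unfolding feasible_def by blast
    then show ?thesis by auto
  qed
  have "\<exists>ks. (\<forall>k \<in> set ks. 1 \<le> k) \<and> cl p \<subseteq> (\<Union>k \<in> set ks. visited Sol k) \<and> length ks \<le> 2 * p"
  proof (cases "n < 2 * p")
    case True
    obtain d where d: "\<And>v. v \<in> {1..n} \<Longrightarrow> 1 \<le> d v \<and> v \<in> visited Sol (d v)" using vis by metis
    show ?thesis
      by (rule exI[of _ "map d [1..<Suc n]"]) (use d cl True in \<open>fastforce simp del: upt_Suc\<close>)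
  next
    case False
    have "v \<in> (\<Union>k \<in> set [1..<Suc (2 * p)]. visited Sol k)" if v: "v \<in> cl p" for v
    proof -
      obtain k where "1 \<le> k" "k \<le> turnover I v" "v \<in> visited Sol k" using vis cl[OF v] by blast
      moreover have "turnover I v < 2 * p" using period_turnover[of v] cl[OF v] False by auto
      ultimately show ?thesis by (auto simp del: upt_Suc)
    qed
    then show ?thesis by (intro exI[of _ "[1..<Suc (2 * p)]"]) (auto simp del: upt_Suc)
  qed
  then obtain ks where ks: "\<forall>k \<in> set ks. 1 \<le> k" "cl p \<subseteq> (\<Union>k \<in> set ks. visited Sol k)" "length ks \<le> 2 * p"
    by blast
  obtain Q where Q: "covers {..<N} {0} (cl p) Q" "real (paths_cost dist Q) \<le> length ks * (real D * max_cost I Sol)"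
    using cover_by_days[OF sol ks(1,2)] by blast
  have "real (length ks) \<le> 2 * real p" using ks(3) by linarith
  then have "length ks * (real D * max_cost I Sol) \<le> 2 * real p * (real D * max_cost I Sol)"
    using max_cost_nonneg[OF sol] by (rule mult_right_mono)
  then show ?thesis using Q by (meson order_trans)
qed

text \<open>With \<open>M\<close> for the scaled maximum cost,
  \<open>p * X \<le> 2 * (2 * p * M)\<close> gives \<open>X \<le> 4 * M\<close>, and the radius
  bound turns \<open>2 * r\<close> into one more \<open>M\<close>.\<close>

lemma classes_cost_bound:
  assumes f: "feasible I Sol"
  shows "real (classes_cost N) \<le> 5 * real (floorlog 2 n) * (real D * max_cost I Sol)"
proof -
  let ?M = "real D * max_cost I Sol"
  let ?P = "{x. 1 \<le> x \<and> x < N \<and> power_of_two x}"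
  have M: "0 \<le> ?M" using f max_cost_nonneg by (simp add: feasible_def)
  have "real (class_cost p) \<le> 5 * ?M" if p: "p \<in> ?P" for p
  proof -
    have pn: "p \<in> {1..n}" using p by (simp add: N_def)
    obtain Q where Q: "covers {..<N} {0} (cl p) Q" "real (paths_cost dist Q) \<le> 2 * real p * ?M"
      using class_cover[OF f pn] by blast
    have "p * X p \<le> 2 * paths_cost dist Q" using ok[OF pn] Q(1) by (simp add: class_ok_def)
    then have "real p * real (X p) \<le> 2 * real (paths_cost dist Q)"
      by (metis of_nat_le_iff of_nat_mult of_nat_numeral)
    also have "\<dots> \<le> real p * (4 * ?M)" using Q(2) by (simp add: algebra_simps)
    finally have "real (X p) \<le> 4 * ?M" using pn by simp
    then show ?thesis using radius_bound[OF f] by (simp add: class_cost_def)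
  qed
  then have "real (classes_cost N) \<le> (\<Sum>p \<in> ?P. 5 * ?M)"
    unfolding classes_cost_def of_nat_sum by (intro sum_mono)
  also have "\<dots> = real (card ?P) * (5 * ?M)" by simp
  also have "\<dots> \<le> real (floorlog 2 n) * (5 * ?M)"
    using card_powers_of_two[of n] M by (intro mult_right_mono) (simp_all add: N_def)
  finally show ?thesis by (simp add: algebra_simps)
qed

context
  fixes Ds :: schedule
  assumes P: "is_period n (length Ds)" and good: "\<And>k. k < length Ds \<Longrightarrow> good_day k (Ds ! k)"
begin

lemma length_pos: "0 < length Ds"
  using P by (auto simp: is_period_def)

lemma good_plan_day:
  assumes "1 \<le> k"
  shows "good_day ((k - 1) mod length Ds) (tour (plan_of Ds) k, snd (Ds ! ((k - 1) mod length Ds)))"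
    "visited (plan_of Ds) k = set (snd (Ds ! ((k - 1) mod length Ds)))"
  using good[of "(k - 1) mod length Ds"] length_pos by (simp_all add: plan_of_def)

lemma solution_plan: "solution I (plan_of Ds)"
  unfolding solution_def
proof (intro conjI allI impI)
  fix k :: nat assume "k \<ge> 1"
  from good_plan_day[OF this] show
    "pre_digraph.awalk (with_proj (graph I)) 0 (tour (plan_of Ds) k) 0"
    "visited (plan_of Ds) k \<subseteq> {1..n} \<inter>
       set (pre_digraph.awalk_verts (with_proj (graph I)) 0 (tour (plan_of Ds) k))"
    by (auto simp: good_day_def)
next
  have "(k + length Ds - 1) mod length Ds = (k - 1) mod length Ds" if "1 \<le> k" for k
    using that by (metis Nat.add_diff_assoc2 mod_add_self2)
  moreover have "1 \<le> length Ds" using length_pos by linarith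
  ultimately show "\<exists>P\<ge>1. \<forall>k\<ge>1. tour (plan_of Ds) (k + P) = tour (plan_of Ds) k \<and>
      visited (plan_of Ds) (k + P) = visited (plan_of Ds) k"
    by (intro exI[of _ "length Ds"]) (simp add: plan_of_def)
qed

lemma exists_residue: "g < p \<Longrightarrow> \<exists>x. t \<le> x \<and> x < t + p \<and> x mod p = g" for t p g :: nat
proof -
  assume g: "g < p"
  show ?thesis
  proof (cases "t mod p \<le> g")
    case True
    have "(t div p * p + g) mod p = g" using g by simp
    moreover have "t div p * p + t mod p = t" by simp
    ultimately show ?thesis using True g by (intro exI[of _ "t div p * p + g"]) linarith
  next
    case False
    have "t div p * p + p + g = g + (t div p + 1) * p" by simp
    then have "(t div p * p + p + g) mod p = g" using g by (simp only: mod_mult_self1 mod_less)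
    moreover have "t div p * p + t mod p = t" by simp
    moreover have "t mod p < p" using g by simp
    ultimately show ?thesis using False g by (intro exI[of _ "t div p * p + p + g"]) linarith
  qed
qed

lemma feasible_plan: "feasible I (plan_of Ds)"
  unfolding feasible_def
proof (intro conjI allI ballI)
  fix t v assume v: "v \<in> {1..n}"
  note qv = q[OF v]
  have "v \<in> cl (q v)" unfolding cl_def using v by (simp add: N_def)
  then have "m0 aGroup v < q v" using ok[OF conjunct1[OF qv]] by (simp add: class_ok_def)
  then obtain x where x: "t \<le> x" "x < t + q v" "x mod q v = m0 aGroup v" using exists_residue by blast
  have "power_of_two (length Ds)" "n < 2 * length Ds"
    using P by (auto simp: is_period_def power_of_two_def)
  then have "q v dvd length Ds" using qv by (intro power_of_two_dvd) auto
  \<comment> \<open>The cyclic reading preserves residues since \<open>q v\<close> divides the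
    length. Day \<open>Suc x\<close> uses the entry of index \<open>x\<close>, as days count from
    1.\<close>
  then have "x mod length Ds mod q v = m0 aGroup v" using x(3) by (simp add: mod_mod_cancel)
  then have "v \<in> visited (plan_of Ds) (Suc x)"
    using good_plan_day[of "Suc x"] v by (simp add: good_day_def)
  moreover have "Suc x \<in> {t + 1..t + turnover I v}" using x period_turnover(1)[OF v] by simp
  ultimately show "v \<in> (\<Union>k \<in> {t + 1..t + turnover I v}. visited (plan_of Ds) k)" by blast
qed (rule solution_plan)

lemma max_cost_plan:
  assumes f: "feasible I Sol"
  shows "max_cost I (plan_of Ds) \<le> 5 * real (floorlog 2 n) * max_cost I Sol"
proof -
  have "tour_cost I (tour (plan_of Ds) k) \<le> 5 * real (floorlog 2 n) * max_cost I Sol" if k: "1 \<le> k" for k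
  proof -
    let ?T = "tour (plan_of Ds) k"
    have "g.awalk 0 ?T 0" "walk_cost ?T \<le> classes_cost N"
      using good_plan_day(1)[OF k] by (auto simp: good_day_def)
    then have "real D * tour_cost I ?T = real (walk_cost ?T)" by (intro tour_cost_real) auto
    also have "\<dots> \<le> real (classes_cost N)" using \<open>walk_cost ?T \<le> classes_cost N\<close> by simp
    also have "\<dots> \<le> real D * (5 * real (floorlog 2 n) * max_cost I Sol)"
      using classes_cost_bound[OF f] by (simp add: algebra_simps)
    finally show ?thesis using D_pos by simp
  qed
  then show ?thesis
    unfolding max_cost_def[of I "plan_of Ds"]
    by (subst Max_le_iff[OF finite_tours[OF solution_plan]]) auto
qed

lemma max_cost_plan_opt: "max_cost I (plan_of Ds) \<le> 5 * real (floorlog 2 n) * opt I"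
proof (cases "floorlog 2 n = 0")
  case True
  \<comment> \<open>The ratio is 0 and cannot be divided by; comparing the plan with itself already
    bounds its cost by 0.\<close>
  then show ?thesis using max_cost_plan[OF feasible_plan] by simp
next
  case False
  let ?a = "5 * real (floorlog 2 n)"
  have "max_cost I (plan_of Ds) / ?a \<le> opt I"
    unfolding opt_def
  proof (rule cINF_greatest)
    show "{Sol. feasible I Sol} \<noteq> {}" using feasible_plan by blast
    show "max_cost I (plan_of Ds) / ?a \<le> max_cost I Sol" if "Sol \<in> {Sol. feasible I Sol}" for Sol
      using max_cost_plan[of Sol] that False by (simp add: divide_le_eq mult.commute)
  qed
  then show ?thesis using False by (simp add: divide_le_eq mult.commute)
qed

end

end

text \<open>For \<open>n \<ge> 2\<close> the value is at most
  \<open>log 2 n + 1 \<le> 2 * log 2 n\<close>, hence the constant \<open>10 / ln 2\<close>.\<close>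

lemma floorlog_bigo: "(\<lambda>n. 5 * real (floorlog 2 n)) \<in> O(\<lambda>n. ln (real n))"
proof (rule bigoI[of _ "10 / ln 2"])
  show "eventually (\<lambda>n. norm (5 * real (floorlog 2 n)) \<le> 10 / ln 2 * norm (ln (real n))) sequentially"
    using eventually_ge_at_top[of 2]
  proof eventually_elim
    case (elim n)
    have "real (floorlog 2 n) = real_of_int \<lfloor>log 2 n\<rfloor> + 1"
      using elim by (simp add: floorlog_def)
    also have "\<dots> \<le> log 2 n + 1" by simp
    also have "\<dots> \<le> 2 * log 2 n" using elim le_log_iff[of 2 n 1] by simp
    finally have "5 * real (floorlog 2 n) \<le> 10 * log 2 n" by simp
    then show ?case using elim by (simp add: log_def)
  qed
qed

theorem theorem7:
  shows "\<exists>(c :: com) (\<alpha> :: nat \<Rightarrow> real).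
    polynomial_time c \<and> min_max_approx_algorithm c \<alpha> \<and> \<alpha> \<in> O(\<lambda>n. ln (real n))"
proof (intro exI conjI)
  \<comment> \<open>The coefficient lists are \<open>s^2\<close> and \<open>(s + 3)^2\<close>, the
    bounds on iterations and on bit length, now as polynomials in the input size.\<close>
  let ?p = "time_bound [:0, 0, 1:] [:9, 6, 1:] algorithm :: nat poly"
  have poly: "poly ?p s = time_bound (s\<^sup>2) ((s + 3)\<^sup>2) algorithm" for s
    unfolding poly_time_bound by (simp add: power2_eq_square algebra_simps)
  show "polynomial_time algorithm"
    unfolding polynomial_time_def
  proof (intro exI[of _ ?p] allI impI)
    fix I assume "rftt_instance I"
    then interpret input I by unfold_locales
    show "\<exists>t ys. runs algorithm (encode_instance I) t ys \<and> t \<le> poly ?p (input_size (encode_instance I))"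
      unfolding poly by (rule runs_good_schedule) blast
  qed
  show "min_max_approx_algorithm algorithm (\<lambda>n. 5 * real (floorlog 2 n))"
    unfolding min_max_approx_algorithm_def
  proof (intro allI impI)
    fix I assume "rftt_instance I"
    then interpret input I by unfold_locales
    obtain t Ds where run: "runs algorithm (encode_instance I) t (encode_schedule Ds)" and "good_schedule Ds"
      by (rule runs_good_schedule)
    then obtain q m0 X where sch: "scheduling n N K B (graph I) wt large A q m0 X radius"
      and P: "is_period n (length Ds)" and per: "\<forall>v \<in> {1..n}. is_period (A v) (q v)"
      and good: "\<forall>k < length Ds. scheduling.good_day n N (graph I) wt q m0 X radius k (Ds ! k)"
      unfolding good_schedule_def by blast
    interpret scheduling n N K B "graph I" wt large A q m0 X radius by (rule sch)
    interpret scheduled_input I q m0 X by unfold_locales (rule per[rule_format])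
    note day = good[rule_format]
    show "\<exists>t D. runs algorithm (encode_instance I) t (encode_schedule D) \<and> D \<noteq> [] \<and>
        feasible I (plan_of D) \<and>
        max_cost I (plan_of D) \<le> 5 * real (floorlog 2 (clients I)) * opt I"
      using run feasible_plan[OF P day] max_cost_plan_opt[OF P day] length_pos[OF P day] by blast
  qed
qed (rule floorlog_bigo)

end
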